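(* Let $\kappa<\mathfrak c$ be a cardinal number and assume that Martin's axiom for $\kappa$, $\mathrm{MA}(\kappa)$, holds. Let $\mathcal A$ be an almost disjoint family of subsets of $\omega$ with $|\mathcal A|=\kappa$. Let $K=\mathrm{ult}(\mathfrak A)$ be the Stone space of the algebra $\mathfrak A$ of subsets of $\omega$ generated by $\mathcal A$ and all finite sets. Then $K$ has the $^*$extension property, and hence every twisted sum of $c_0$ and $C(K)$ is trivial.
   Context: Compact spaces are Hausdorff; $\mathfrak c=2^{\aleph_0}$. A family of subsets of $\omega$ is almost disjoint if the intersection of any two distinct members is finite. For a Boolean algebra $\mathfrak A$, $\mathrm{ult}(\mathfrak A)$ is its Stone space of ultrafilters. For compact $K$, $C(K)$ is the Banach space of continuous real-valued functions on $K$, and $C(K)^*$ is identified with the space $M(K)$ of signed Radon measures on $K$ of finite variation. $M_1(K)$ is the closed unit ball of $M(K)$ with the weak$^*$ topology; write $\nu(g)=\int g\,d\nu$. A compact space $L'\supseteq L$ is a countable discrete extension of a compact space $L$ if $L'\setminus L$ is countable and discrete. A compact space $K$ has the $^*$extension property if for every countable discrete extension $L'$ of $M_1(K)$ there is a bounded linear operator $E:C(K)\to C(L')$ such that $Eg(\nu)=\nu(g)$ for all $g\in C(K)$ and $\nu\in M_1(K)$. A twisted sum of Banach spaces $Z$ and $Y$ is a short exact sequence $0\to Z\to X\to Y\to 0$ with $X$ a Banach space and the maps bounded linear operators; it is trivial if it splits, i.e. the map $Z\to X$ has a bounded linear left inverse (equivalently, the range of $Z\to X$ is complemented in $X$). $\mathrm{MA}(\kappa)$: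 for every nonempty partially ordered set $(\mathbb P,\le)$ satisfying ccc (every uncountable subset of $\mathbb P$ contains two distinct elements $p_1,p_2$ having a common upper bound $q\in\mathbb P$, $p_1,p_2\le q$) and every family $\{\mathbb D_\xi:\xi<\kappa\}$ of dense subsets of $\mathbb P$ (for every $p\in \mathbb P$ there is $d\in \mathbb D_\xi$ with $p\le d$), there is a directed set $\mathbb G\subseteq\mathbb P$ (any $p_1,p_2\in\mathbb G$ have an upper bound in $\mathbb G$) with $\mathbb G\cap\mathbb D_\xi\neq\emptyset$ for every $\xi<\kappa$. *)

theory Defs
  imports "HOL-Analysis.Analysis" "HOL-Library.Function_Algebras"
begin

unbundle cardinal_syntax

section \<open>Martin's axiom\<close>

definition ccc_poset :: "'p set \<Rightarrow> 'p rel \<Rightarrow> bool" where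
  "ccc_poset P r \<longleftrightarrow>
     (\<forall>X\<subseteq>P. uncountable X \<longrightarrow>
        (\<exists>p1\<in>X. \<exists>p2\<in>X. p1 \<noteq> p2 \<and> (\<exists>q\<in>P. (p1, q) \<in> r \<and> (p2, q) \<in> r)))"

definition dense_in_poset :: "'p set \<Rightarrow> 'p rel \<Rightarrow> 'p set \<Rightarrow> bool" where
  "dense_in_poset P r D \<longleftrightarrow> D \<subseteq> P \<and> (\<forall>p\<in>P. \<exists>d\<in>D. (p, d) \<in> r)"

definition directed_in_poset :: "'p rel \<Rightarrow> 'p set \<Rightarrow> bool" where
  "directed_in_poset r G \<longleftrightarrow> (\<forall>p1\<in>G. \<forall>p2\<in>G. \<exists>q\<in>G. (p1, q) \<in> r \<and> (p2, q) \<in> r)"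

text \<open>
  The cardinal \<open>\<kappa>\<close> is a cardinal order in the sense of the HOL cardinals, and
  \<open>Field \<kappa>\<close> indexes the dense sets. A formula of HOL cannot quantify over types, so the
  posets are those whose carrier is a subset of a given type \<open>'p\<close>. This is no loss once
  \<open>'p\<close> has at least \<open>max \<kappa> \<aleph>\<^sub>0\<close> elements: every poset contains a subposet of size at most
  \<open>max \<kappa> \<aleph>\<^sub>0\<close> that is closed under a choice of upper bounds of compatible pairs and of
  witnesses of density for the given dense sets, and such a subposet inherits ccc.
\<close>

definition martin_axiom :: "'p itself \<Rightarrow> 'k rel \<Rightarrow> bool" where
  "martin_axiom (_ :: 'p itself) \<kappa> \<longleftrightarrow>
     (\<forall>(P :: 'p set) r (D :: 'k \<Rightarrow> 'p set).
        P \<noteq> {} \<and> partial_order_on P r \<and> ccc_poset P r \<and>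
        (\<forall>\<xi>\<in>Field \<kappa>. dense_in_poset P r (D \<xi>)) \<longrightarrow>
        (\<exists>G\<subseteq>P. directed_in_poset r G \<and> (\<forall>\<xi>\<in>Field \<kappa>. G \<inter> D \<xi> \<noteq> {})))"


section \<open>Almost disjoint families and Stone spaces\<close>

definition almost_disjoint :: "'a set set \<Rightarrow> bool" where
  "almost_disjoint A \<longleftrightarrow> (\<forall>a\<in>A. \<forall>b\<in>A. a \<noteq> b \<longrightarrow> finite (a \<inter> b))"

definition generated_algebra :: "'a set \<Rightarrow> 'a set set \<Rightarrow> 'a set set" where
  "generated_algebra \<Omega> G = algebra \<Omega> hull G"

definition ultrafilters_on :: "'a set \<Rightarrow> 'a set set \<Rightarrow> 'a set set set" where
  "ultrafilters_on \<Omega> M =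
     {U. U \<subseteq> M \<and> \<Omega> \<in> U \<and> {} \<notin> U \<and>
         (\<forall>a\<in>U. \<forall>b\<in>U. a \<inter> b \<in> U) \<and>
         (\<forall>a\<in>U. \<forall>b\<in>M. a \<subseteq> b \<longrightarrow> b \<in> U) \<and>
         (\<forall>a\<in>M. a \<in> U \<or> \<Omega> - a \<in> U)}"

definition stone_space :: "'a set \<Rightarrow> 'a set set \<Rightarrow> 'a set set topology" where
  "stone_space \<Omega> M = topology_generated_by ((\<lambda>a. {U \<in> ultrafilters_on \<Omega> M. a \<in> U}) ` M)"


section \<open>Spaces of functions and bounded operators\<close>

instantiation "fun" :: (type, real_vector) real_vector
begin

definition scaleR_fun :: "real \<Rightarrow> ('a \<Rightarrow> 'b) \<Rightarrow> 'a \<Rightarrow> 'b" where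
  "scaleR_fun c f = (\<lambda>x. c *\<^sub>R f x)"

instance
  by standard
    (simp_all add: scaleR_fun_def plus_fun_def fun_eq_iff scaleR_add_right scaleR_add_left)

end

text \<open>Inserting \<open>0\<close> only matters for \<open>S = {}\<close>, where the supremum would be unspecified.\<close>

definition sup_norm :: "'a set \<Rightarrow> ('a \<Rightarrow> real) \<Rightarrow> real" where
  "sup_norm S f = Sup (insert 0 ((\<lambda>x. \<bar>f x\<bar>) ` S))"

text \<open>
  As the topology \<open>K\<close> need not live on a whole type, a continuous function on \<open>K\<close> is
  represented by its extension by zero. The space \<open>C_space K\<close> is then a linear subspace
  of the functions on the type, and carries the norm \<open>sup_norm (topspace K)\<close>.
\<close>

definition C_space :: "'a topology \<Rightarrow> ('a \<Rightarrow> real) set" where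
  "C_space K = {f. continuous_map K euclideanreal f \<and> (\<forall>x. x \<notin> topspace K \<longrightarrow> f x = 0)}"

definition c0_space :: "(nat \<Rightarrow> real) set" where
  "c0_space = {x. x \<longlonglongrightarrow> 0}"

text \<open>
  Bounded linear operators from the linear subspace \<open>V\<close> with norm \<open>nV\<close> to the linear
  subspace \<open>W\<close> with norm \<open>nW\<close>; nothing is said about the values outside \<open>V\<close>.
\<close>

definition bounded_operator ::
  "'v::real_vector set \<Rightarrow> ('v \<Rightarrow> real) \<Rightarrow> 'w::real_vector set \<Rightarrow> ('w \<Rightarrow> real) \<Rightarrow> ('v \<Rightarrow> 'w) \<Rightarrow> bool"
where
  "bounded_operator V nV W nW T \<longleftrightarrow>
     (\<forall>x\<in>V. T x \<in> W) \<and>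
     (\<forall>x\<in>V. \<forall>y\<in>V. T (x + y) = T x + T y) \<and>
     (\<forall>c. \<forall>x\<in>V. T (c *\<^sub>R x) = c *\<^sub>R T x) \<and>
     (\<exists>B. \<forall>x\<in>V. nW (T x) \<le> B * nV x)"


section \<open>Twisted sums\<close>

text \<open>\<open>0 \<rightarrow> Z \<rightarrow> X \<rightarrow> Y \<rightarrow> 0\<close>, where the Banach space \<open>X\<close> is the type \<open>'x\<close>.\<close>

definition twisted_sum ::
  "'z::real_vector set \<Rightarrow> ('z \<Rightarrow> real) \<Rightarrow> 'y::real_vector set \<Rightarrow> ('y \<Rightarrow> real) \<Rightarrow>
   ('z \<Rightarrow> 'x::banach) \<Rightarrow> ('x \<Rightarrow> 'y) \<Rightarrow> bool"
where
  "twisted_sum Z nZ Y nY i q \<longleftrightarrow>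
     bounded_operator Z nZ UNIV norm i \<and> bounded_operator UNIV norm Y nY q \<and>
     inj_on i Z \<and> i ` Z = {x. q x = 0} \<and> range q = Y"

definition trivial_twisted_sum ::
  "'z::real_vector set \<Rightarrow> ('z \<Rightarrow> real) \<Rightarrow> ('z \<Rightarrow> 'x::banach) \<Rightarrow> bool"
where
  "trivial_twisted_sum Z nZ i \<longleftrightarrow>
     (\<exists>r. bounded_operator UNIV norm Z nZ r \<and> (\<forall>z\<in>Z. r (i z) = z))"


section \<open>Signed Radon measures\<close>

definition borel_sets :: "'a topology \<Rightarrow> 'a set set" where
  "borel_sets K = sigma_sets (topspace K) {U. openin K U}"

text \<open>Used for real-valued signed measures \<open>\<nu>\<close> and Borel sets \<open>X\<close>.\<close>

definition partition_sums :: "'a topology \<Rightarrow> ('a set \<Rightarrow> real) \<Rightarrow> 'a set \<Rightarrow> real set" where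
  "partition_sums K \<nu> X =
     {(\<Sum>B\<in>P. \<bar>\<nu> B\<bar>) | P. finite P \<and> P \<subseteq> borel_sets K \<and> disjoint P \<and> \<Union>P = X}"

definition variation :: "'a topology \<Rightarrow> ('a set \<Rightarrow> real) \<Rightarrow> 'a set \<Rightarrow> real" where
  "variation K \<nu> X = Sup (partition_sums K \<nu> X)"

text \<open>
  A signed Radon measure is a set function on the Borel sets (with the value \<open>0\<close> on all
  other sets, so that equality of measures is equality of functions) whose total variation
  is inner regular with respect to compact sets.
\<close>

definition radon_measures :: "'a topology \<Rightarrow> ('a set \<Rightarrow> real) set" where
  "radon_measures K =
     {\<nu>. (\<forall>X. X \<notin> borel_sets K \<longrightarrow> \<nu> X = 0) \<and>
         (\<forall>B :: nat \<Rightarrow> 'a set. range B \<subseteq> borel_sets K \<and> disjoint_family B \<longrightarrow>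
            (\<lambda>n. \<nu> (B n)) sums \<nu> (\<Union>n. B n)) \<and>
         bdd_above (partition_sums K \<nu> (topspace K)) \<and>
         (\<forall>X\<in>borel_sets K. \<forall>\<epsilon>>0. \<exists>C. compactin K C \<and> C \<subseteq> X \<and> variation K \<nu> (X - C) < \<epsilon>)}"

text \<open>The Jordan decomposition of \<open>\<nu>\<close>, as positive measures on the Borel sets.\<close>

definition positive_part :: "'a topology \<Rightarrow> ('a set \<Rightarrow> real) \<Rightarrow> 'a measure" where
  "positive_part K \<nu> =
     measure_of (topspace K) (borel_sets K) (\<lambda>X. ennreal ((variation K \<nu> X + \<nu> X) / 2))"

definition negative_part :: "'a topology \<Rightarrow> ('a set \<Rightarrow> real) \<Rightarrow> 'a measure" where
  "negative_part K \<nu> =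
     measure_of (topspace K) (borel_sets K) (\<lambda>X. ennreal ((variation K \<nu> X - \<nu> X) / 2))"

definition signed_integral :: "'a topology \<Rightarrow> ('a set \<Rightarrow> real) \<Rightarrow> ('a \<Rightarrow> real) \<Rightarrow> real" where
  "signed_integral K \<nu> g =
     (\<integral>x. g x \<partial>positive_part K \<nu>) - (\<integral>x. g x \<partial>negative_part K \<nu>)"

text \<open>The weak* topology is that of pointwise convergence on \<open>C_space K\<close>.\<close>

definition M1_space :: "'a topology \<Rightarrow> ('a set \<Rightarrow> real) topology" where
  "M1_space K =
     pullback_topology {\<nu> \<in> radon_measures K. variation K \<nu> (topspace K) \<le> 1}
       (\<lambda>\<nu>. \<lambda>g\<in>C_space K. signed_integral K \<nu> g)
       (product_topology (\<lambda>_. euclideanreal) (C_space K))"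


section \<open>The *extension property\<close>

text \<open>The inclusion of \<open>L\<close> in \<open>L'\<close> is given by an embedding \<open>e\<close>.\<close>

definition countable_discrete_extension ::
  "'a topology \<Rightarrow> 'l topology \<Rightarrow> ('a \<Rightarrow> 'l) \<Rightarrow> bool"
where
  "countable_discrete_extension L L' e \<longleftrightarrow>
     compact_space L' \<and> Hausdorff_space L' \<and> embedding_map L L' e \<and>
     countable (topspace L' - e ` topspace L) \<and>
     subtopology L' (topspace L' - e ` topspace L)
       = discrete_topology (topspace L' - e ` topspace L)"

text \<open>
  The first argument is the type that carries the extensions \<open>L'\<close>. A theorem about
  \<open>TYPE('l)\<close> for a type variable \<open>'l\<close> covers all extensions.
\<close>

definition star_extension_property :: "'l itself \<Rightarrow> 'a topology \<Rightarrow> bool" where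
  "star_extension_property (_ :: 'l itself) K \<longleftrightarrow>
     compact_space K \<and> Hausdorff_space K \<and>
     (\<forall>(L' :: 'l topology) e. countable_discrete_extension (M1_space K) L' e \<longrightarrow>
        (\<exists>E. bounded_operator (C_space K) (sup_norm (topspace K))
                (C_space L') (sup_norm (topspace L')) E \<and>
             (\<forall>g\<in>C_space K. \<forall>\<nu>\<in>topspace (M1_space K). E g (e \<nu>) = signed_integral K \<nu> g)))"

end

theory Submission
  imports Defs
begin

text \<open>
  Both assertions about \<open>K\<close> reduce to one lifting property: every bounded operator from \<open>C(K)\<close> into
  \<open>l\<^sub>\<infinity> / c\<^sub>0\<close> lifts to a bounded operator into \<open>l\<^sub>\<infinity>\<close>. For a twisted sum \<open>X\<close> of \<open>c\<^sub>0\<close> and \<open>C(K)\<close>,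
  extending the coordinate functionals of \<open>c\<^sub>0\<close> to \<open>X\<close> gives such an operator, and a lift of it
  corrects the extended functionals to a projection onto \<open>c\<^sub>0\<close> (\<open>trivial_twisted_sum_if_lifting\<close>; this
  takes the Hahn--Banach and the open mapping theorem). For a countable discrete extension of
  \<open>M\<^sub>1(K)\<close>, extending the functions \<open>\<nu> \<mapsto> \<nu>(g)\<close> by Tietze's theorem gives such an operator, and a lift
  of it makes the extension linear (\<open>star_extension_property_if_lifting\<close>). The second reduction takes
  compactness of \<open>M\<^sub>1(K)\<close>, that is, the Riesz representation theorem for \<open>K\<close>; as \<open>K\<close> is scattered,
  the representing measures are atomic and their point masses can be written down.

  For the lifting property (\<open>lifting_modulo_c0\<close>), \<open>K\<close> is described by its points. After
  passing to suitable generators it consists of the isolated points \<open>n\<close>, a limit point for each infinite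
  set \<open>B\<close> of the almost disjoint family, and one point at infinity, and the characteristic functions
  of singletons, of the sets \<open>B\<close> and of \<open>K\<close> span a dense subspace of \<open>C(K)\<close>. A lift is a bounded sequence of
  measures on \<open>K\<close>. Singletons and the constant function are easily taken care of, by truncation
  and by a multiple of the point mass at infinity. There remain the values \<open>t B n\<close> for the sets \<open>B\<close>, such
  that for every finite set \<open>F\<close> of them the sums \<open>\<Sum>B\<in>F. \<bar>t B n\<bar>\<close> are eventually bounded by a constant
  independent of \<open>F\<close>. What is needed are measures \<open>\<lambda>\<^sub>n\<close> on \<open>\<nat>\<close> of bounded norm, with supports moving to
  infinity, such that \<open>\<lambda>\<^sub>n(B) - t B n\<close> tends to \<open>0\<close> for every \<open>B\<close>.

  This is where Martin's axiom enters (\<open>martin_axiom_atomic_measures\<close>). Conditions are finite sequences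
  of finitely supported rational measures together with a finite set of \<open>B\<close> for which all later
  measures have to be accurate. Two conditions with the same measures are compatible: finitely many
  almost disjoint sets have points of their own, at which masses can be placed independently, and
  allowing norm \<open>2\<close> instead of \<open>1\<close> leaves room for two sets of promises at once. As there are only
  countably many finite sequences of such measures, the order satisfies the countable chain condition.
\<close>

section \<open>Continuous functions and the supremum norm\<close>

lemma sup_norm_least:
  assumes "0 \<le> c" "\<And>x. x \<in> S \<Longrightarrow> \<bar>f x\<bar> \<le> c"
  shows "sup_norm S f \<le> c"
  unfolding sup_norm_def using assms by (intro cSup_least) auto

lemma sup_norm_upper:
  assumes "bdd_above ((\<lambda>x. \<bar>f x\<bar>) ` S)" "x \<in> S"
  shows "\<bar>f x\<bar> \<le> sup_norm S f"
  unfolding sup_norm_def using assms by (intro cSup_upper) auto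

lemma sup_norm_nonneg:
  assumes "bdd_above ((\<lambda>x. \<bar>f x\<bar>) ` S)"
  shows "0 \<le> sup_norm S f"
  unfolding sup_norm_def using assms by (intro cSup_upper) auto

lemma sup_norm_scaleR:
  assumes "bdd_above ((\<lambda>x. \<bar>f x\<bar>) ` S)"
  shows "sup_norm S (c *\<^sub>R f) = \<bar>c\<bar> * sup_norm S f"
proof -
  have le: "sup_norm S (a *\<^sub>R g) \<le> \<bar>a\<bar> * sup_norm S g" if "bdd_above ((\<lambda>x. \<bar>g x\<bar>) ` S)" for a and g :: "'a \<Rightarrow> real"
    using that by (intro sup_norm_least)
      (auto simp: scaleR_fun_def abs_mult sup_norm_nonneg sup_norm_upper mult_left_mono)
  show ?thesis
  proof (cases "c = 0")
    case True
    then show ?thesis by (cases "S = {}") (simp_all add: sup_norm_def image_constant_conv)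
  next
    case False
    have "bdd_above ((\<lambda>x. \<bar>(c *\<^sub>R f) x\<bar>) ` S)"
      using sup_norm_upper[OF assms]
      by (intro bdd_aboveI2[of _ _ "\<bar>c\<bar> * sup_norm S f"]) (auto simp: scaleR_fun_def abs_mult mult_left_mono)
    from le[OF this, of "inverse c"] have "sup_norm S f \<le> \<bar>inverse c\<bar> * sup_norm S (c *\<^sub>R f)"
      using False by simp
    then have "\<bar>c\<bar> * sup_norm S f \<le> sup_norm S (c *\<^sub>R f)"
      using False by (simp add: field_simps)
    with le[OF assms, of c] show ?thesis by simp
  qed
qed

lemma sup_norm_add:
  assumes "bdd_above ((\<lambda>x. \<bar>f x\<bar>) ` S)" "bdd_above ((\<lambda>x. \<bar>g x\<bar>) ` S)"
  shows "sup_norm S (f + g) \<le> sup_norm S f + sup_norm S g"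
proof (rule sup_norm_least)
  show "0 \<le> sup_norm S f + sup_norm S g" using assms by (simp add: sup_norm_nonneg)
  fix x assume "x \<in> S"
  then show "\<bar>(f + g) x\<bar> \<le> sup_norm S f + sup_norm S g"
    using sup_norm_upper[OF assms(1), of x] sup_norm_upper[OF assms(2), of x] by simp
qed

lemma sum_fun_apply: "(\<Sum>i\<in>I. f i) x = (\<Sum>i\<in>I. f i x)"
  by (induction I rule: infinite_finite_induct) auto

lemma C_space_bdd:
  assumes "compact_space K" "f \<in> C_space K"
  shows "bdd_above ((\<lambda>x. \<bar>f x\<bar>) ` topspace K)"
proof -
  have "compactin euclideanreal (f ` topspace K)"
    using assms by (intro image_compactin) (auto simp: C_space_def compact_space_def)
  then have "bounded (f ` topspace K)"
    by (simp add: compact_imp_bounded)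
  then obtain b where "\<And>x. x \<in> topspace K \<Longrightarrow> \<bar>f x\<bar> \<le> b"
    by (auto simp: bounded_iff)
  then show ?thesis by (intro bdd_aboveI2[of _ _ b])
qed

lemma C_space_le_sup_norm:
  assumes "compact_space K" "f \<in> C_space K"
  shows "\<bar>f x\<bar> \<le> sup_norm (topspace K) f"
  using assms C_space_bdd[OF assms] sup_norm_upper[of f "topspace K" x] sup_norm_nonneg[of f "topspace K"]
  by (cases "x \<in> topspace K") (auto simp: C_space_def)

lemma subspace_C_space: "subspace (C_space K)"
  by (auto simp: subspace_def C_space_def plus_fun_def zero_fun_def scaleR_fun_def
      intro!: continuous_map_add continuous_map_real_mult_left)

text \<open>
  Maps into the bounded sequences that are linear modulo null sequences. Such a \<open>\<tau>\<close> is a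
  bounded operator from \<open>C(K)\<close> into \<open>l\<^sub>\<infinity> / c\<^sub>0\<close>, given by representatives of its values.
\<close>

locale almost_linear =
  fixes K :: "'a topology" and \<tau> :: "('a \<Rightarrow> real) \<Rightarrow> nat \<Rightarrow> real" and c :: real
  assumes compact: "compact_space K"
    and bound: "\<And>g n. g \<in> C_space K \<Longrightarrow> \<bar>\<tau> g n\<bar> \<le> c * sup_norm (topspace K) g"
    and add: "\<And>g h. g \<in> C_space K \<Longrightarrow> h \<in> C_space K \<Longrightarrow> (\<lambda>n. \<tau> (g + h) n - (\<tau> g n + \<tau> h n)) \<longlonglongrightarrow> 0"
    and scale: "\<And>g a. g \<in> C_space K \<Longrightarrow> (\<lambda>n. \<tau> (a *\<^sub>R g) n - a * \<tau> g n) \<longlonglongrightarrow> 0"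
    and c_nonneg: "c \<ge> 0"
begin

lemma zero_C: "0 \<in> C_space K"
  by (rule subspace_0[OF subspace_C_space])

lemma zero: "(\<lambda>n. \<tau> 0 n) \<longlonglongrightarrow> 0"
  using scale[of 0 0] zero_C by simp

lemma linear_combination:
  assumes "finite I" "\<And>i. i \<in> I \<Longrightarrow> f i \<in> C_space K"
  shows "(\<lambda>n. \<tau> (\<Sum>i\<in>I. a i *\<^sub>R f i) n - (\<Sum>i\<in>I. a i * \<tau> (f i) n)) \<longlonglongrightarrow> 0"
  using assms
proof (induction I rule: finite_induct)
  case empty
  then show ?case using zero by (simp add: zero_fun_def)
next
  case (insert j I)
  let ?s = "\<Sum>i\<in>I. a i *\<^sub>R f i"
  have C: "f j \<in> C_space K" "a j *\<^sub>R f j \<in> C_space K" "?s \<in> C_space K"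
    using insert.prems by (auto intro!: subspace_scale subspace_sum subspace_C_space)
  have "(\<lambda>n. (\<tau> (a j *\<^sub>R f j + ?s) n - (\<tau> (a j *\<^sub>R f j) n + \<tau> ?s n)) +
      (\<tau> (a j *\<^sub>R f j) n - a j * \<tau> (f j) n) + (\<tau> ?s n - (\<Sum>i\<in>I. a i * \<tau> (f i) n))) \<longlonglongrightarrow> 0 + 0 + 0"
    using insert C by (intro tendsto_add add scale) auto
  then show ?case using insert by (simp add: algebra_simps plus_fun_def)
qed

text \<open>
  For a fixed choice of signs the signed sum of the \<open>f i\<close> lies in the unit ball, so \<open>\<tau>\<close> maps it
  to a sequence bounded by \<open>c\<close>, and this sequence differs from the signed sum of the \<open>\<tau> (f i)\<close> by a
  null sequence. There are only finitely many choices of signs, so all these differences are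
  eventually below \<open>1\<close>, and then the signs can be taken from the values at \<open>n\<close>.
\<close>

lemma eventually_sum_abs_le:
  assumes I: "finite I" and f: "\<And>i. i \<in> I \<Longrightarrow> f i \<in> C_space K"
    and disj: "\<And>x. x \<in> topspace K \<Longrightarrow> (\<Sum>i\<in>I. \<bar>f i x\<bar>) \<le> 1"
  shows "\<forall>\<^sub>F n in sequentially. (\<Sum>i\<in>I. \<bar>\<tau> (f i) n\<bar>) \<le> c + 1"
proof -
  let ?g = "\<lambda>s. \<Sum>i\<in>I. s i *\<^sub>R f i"
  have "\<forall>\<^sub>F n in sequentially. \<bar>\<tau> (?g s) n - (\<Sum>i\<in>I. s i * \<tau> (f i) n)\<bar> < 1" for s
    using linear_combination[where f = f and I = I and a = s, OF I f] by (auto dest: tendstoD[of _ _ _ 1] simp: dist_real_def)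
  then have "\<forall>\<^sub>F n in sequentially. \<forall>s\<in>I \<rightarrow>\<^sub>E {-1, 1}. \<bar>\<tau> (?g s) n - (\<Sum>i\<in>I. s i * \<tau> (f i) n)\<bar> < 1"
    using I by (intro eventually_ball_finite finite_PiE) auto
  then show ?thesis
  proof eventually_elim
    case (elim n)
    define s where "s = (\<lambda>i\<in>I. if \<tau> (f i) n \<ge> 0 then 1 else -1 :: real)"
    have s: "s \<in> I \<rightarrow>\<^sub>E {-1, 1}" by (auto simp: s_def)
    have gC: "?g s \<in> C_space K"
      using f by (auto intro!: subspace_scale subspace_sum subspace_C_space)
    have "sup_norm (topspace K) (?g s) \<le> 1"
    proof (rule sup_norm_least)
      fix x assume x: "x \<in> topspace K"
      have "\<bar>?g s x\<bar> \<le> (\<Sum>i\<in>I. \<bar>s i * f i x\<bar>)"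
        by (simp add: sum_fun_apply scaleR_fun_def sum_abs)
      also have "\<dots> = (\<Sum>i\<in>I. \<bar>f i x\<bar>)" by (intro sum.cong) (auto simp: s_def abs_mult)
      finally show "\<bar>?g s x\<bar> \<le> 1" using disj[OF x] by simp
    qed simp
    then have "\<bar>\<tau> (?g s) n\<bar> \<le> c"
      using bound[OF gC, of n] c_nonneg mult_left_le[of "sup_norm (topspace K) (?g s)" c] by linarith
    moreover have "(\<Sum>i\<in>I. s i * \<tau> (f i) n) = (\<Sum>i\<in>I. \<bar>\<tau> (f i) n\<bar>)"
      by (intro sum.cong) (auto simp: s_def)
    ultimately show ?case using elim s by fastforce
  qed
qed

text \<open>
  Together with the next lemma: whether a bounded linear \<open>E\<close> lifts \<open>\<tau>\<close> can be tested on any set of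
  functions with dense linear span.
\<close>

lemma subspace_close:
  assumes E_add: "\<And>g h n. g \<in> C_space K \<Longrightarrow> h \<in> C_space K \<Longrightarrow> E (g + h) n = E g n + E h n"
    and E_scale: "\<And>g a n. g \<in> C_space K \<Longrightarrow> E (a *\<^sub>R g) n = a * E g n"
  shows "subspace {g \<in> C_space K. (\<lambda>n. E g n - \<tau> g n :: real) \<longlonglongrightarrow> 0}"
  unfolding subspace_def
proof (intro conjI ballI allI)
  have "E 0 n = 0" for n using E_scale[of 0 0 n] zero_C by simp
  then show "0 \<in> {g \<in> C_space K. (\<lambda>n. E g n - \<tau> g n :: real) \<longlonglongrightarrow> 0}"
    using zero tendsto_minus[OF zero] by (simp add: zero_C)
next
  fix g h assume "g \<in> {g \<in> C_space K. (\<lambda>n. E g n - \<tau> g n) \<longlonglongrightarrow> 0}" "h \<in> {g \<in> C_space K. (\<lambda>n. E g n - \<tau> g n) \<longlonglongrightarrow> 0}"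
  then have gh: "g \<in> C_space K" "h \<in> C_space K" "(\<lambda>n. E g n - \<tau> g n) \<longlonglongrightarrow> 0" "(\<lambda>n. E h n - \<tau> h n) \<longlonglongrightarrow> 0" by auto
  have "(\<lambda>n. (E g n - \<tau> g n) + (E h n - \<tau> h n) - (\<tau> (g + h) n - (\<tau> g n + \<tau> h n))) \<longlonglongrightarrow> 0 + 0 - 0"
    by (intro tendsto_intros gh add)
  moreover have "(E g n - \<tau> g n) + (E h n - \<tau> h n) - (\<tau> (g + h) n - (\<tau> g n + \<tau> h n)) = E (g + h) n - \<tau> (g + h) n" for n
    using E_add[OF gh(1,2), of n] by simp
  ultimately show "g + h \<in> {g \<in> C_space K. (\<lambda>n. E g n - \<tau> g n) \<longlonglongrightarrow> 0}"
    using gh subspace_add[OF subspace_C_space] by simp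
next
  fix a g assume "g \<in> {g \<in> C_space K. (\<lambda>n. E g n - \<tau> g n) \<longlonglongrightarrow> 0}"
  then have g: "g \<in> C_space K" "(\<lambda>n. E g n - \<tau> g n) \<longlonglongrightarrow> 0" by auto
  have "(\<lambda>n. a * (E g n - \<tau> g n) - (\<tau> (a *\<^sub>R g) n - a * \<tau> g n)) \<longlonglongrightarrow> a * 0 - 0"
    by (intro tendsto_intros g scale)
  moreover have "a * (E g n - \<tau> g n) - (\<tau> (a *\<^sub>R g) n - a * \<tau> g n) = E (a *\<^sub>R g) n - \<tau> (a *\<^sub>R g) n" for n
    using E_scale[OF g(1), of a n] by (simp add: algebra_simps)
  ultimately show "a *\<^sub>R g \<in> {g \<in> C_space K. (\<lambda>n. E g n - \<tau> g n) \<longlonglongrightarrow> 0}"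
    using g subspace_scale[OF subspace_C_space] by simp
qed

lemma close_limit:
  assumes E_add: "\<And>g h n. g \<in> C_space K \<Longrightarrow> h \<in> C_space K \<Longrightarrow> E (g + h) n = E g n + E h n"
    and E_bound: "\<And>g n. g \<in> C_space K \<Longrightarrow> \<bar>E g n\<bar> \<le> d * sup_norm (topspace K) g"
    and g: "g \<in> C_space K"
    and approx: "\<And>\<epsilon>. \<epsilon> > 0 \<Longrightarrow> \<exists>s\<in>C_space K. (\<lambda>n. E s n - \<tau> s n) \<longlonglongrightarrow> 0 \<and> (\<forall>x\<in>topspace K. \<bar>g x - s x\<bar> \<le> \<epsilon>)"
  shows "(\<lambda>n. E g n - \<tau> g n :: real) \<longlonglongrightarrow> 0"
proof (rule tendstoI)
  fix \<epsilon> :: real assume \<epsilon>: "\<epsilon> > 0"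
  define \<delta> where "\<delta> = \<epsilon> / (3 * (\<bar>d\<bar> + c + 1))"
  have den: "\<bar>d\<bar> + c + 1 > 0" using c_nonneg by linarith
  then have \<delta>: "\<delta> > 0" using \<epsilon> by (simp add: \<delta>_def)
  have "(\<bar>d\<bar> + c) * \<delta> \<le> (\<bar>d\<bar> + c + 1) * \<delta>" using \<delta> by (intro mult_right_mono) auto
  also have "\<dots> = \<epsilon> / 3" using den by (simp add: \<delta>_def field_simps)
  finally have small: "\<bar>d\<bar> * \<delta> + c * \<delta> \<le> \<epsilon> / 3" by (simp add: distrib_right)
  obtain s where s: "s \<in> C_space K" "(\<lambda>n. E s n - \<tau> s n) \<longlonglongrightarrow> 0" "\<And>x. x \<in> topspace K \<Longrightarrow> \<bar>g x - s x\<bar> \<le> \<delta>"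
    using approx[OF \<delta>] by auto
  have h: "g - s \<in> C_space K" using g s by (intro subspace_diff subspace_C_space)
  have gs: "s + (g - s) = g" by simp
  have norm: "sup_norm (topspace K) (g - s) \<le> \<delta>"
    using s \<delta> by (intro sup_norm_least) auto
  have norm0: "sup_norm (topspace K) (g - s) \<ge> 0"
    using C_space_bdd[OF compact h] by (rule sup_norm_nonneg)
  have 1: "\<forall>\<^sub>F n in sequentially. \<bar>E s n - \<tau> s n\<bar> < \<epsilon> / 3"
    using tendstoD[OF s(2), of "\<epsilon> / 3"] \<epsilon> by (simp add: dist_real_def)
  have 2: "\<forall>\<^sub>F n in sequentially. \<bar>\<tau> g n - (\<tau> s n + \<tau> (g - s) n)\<bar> < \<epsilon> / 3"
    using tendstoD[OF add[OF s(1) h], of "\<epsilon> / 3"] \<epsilon> by (simp add: dist_real_def gs)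
  show "\<forall>\<^sub>F n in sequentially. dist (E g n - \<tau> g n) 0 < \<epsilon>"
    using 1 2
  proof eventually_elim
    case (elim n)
    have "\<bar>E (g - s) n\<bar> \<le> \<bar>d\<bar> * \<delta>"
      using E_bound[OF h, of n] norm norm0
      by (meson abs_ge_self abs_ge_zero mult_mono order_trans)
    moreover have "\<bar>\<tau> (g - s) n\<bar> \<le> c * \<delta>"
      using bound[OF h, of n] norm c_nonneg by (meson mult_left_mono order_trans)
    moreover have "E g n = E s n + E (g - s) n" using E_add[OF s(1) h, of n] gs by simp
    ultimately show ?case using elim small unfolding dist_real_def by linarith
  qed
qed

end

section \<open>The Hahn--Banach and the open mapping theorem\<close>

text \<open>
  A functional on a subspace is represented by its graph. Extension is then inclusion, and Zorn's
  lemma applies to unions of chains directly.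
\<close>

definition partial_functional :: "real \<Rightarrow> ('x::real_normed_vector \<times> real) set \<Rightarrow> bool" where
  "partial_functional C \<Gamma> \<longleftrightarrow> subspace \<Gamma> \<and> (\<forall>(x, a)\<in>\<Gamma>. \<bar>a\<bar> \<le> C * norm x)"

lemma partial_functional_unique:
  fixes \<Gamma> :: "('x::real_normed_vector \<times> real) set"
  assumes \<Gamma>: "partial_functional C \<Gamma>" and "(x, a) \<in> \<Gamma>" "(x, b) \<in> \<Gamma>"
  shows "a = b"
proof -
  have "(x, a) - (x, b) \<in> \<Gamma>" using assms by (intro subspace_diff) (auto simp: partial_functional_def)
  then have "(0, a - b) \<in> \<Gamma>" by simp
  then have "\<bar>a - b\<bar> \<le> C * norm (0 :: 'x)" using \<Gamma> unfolding partial_functional_def by blast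
  then show ?thesis by simp
qed

text \<open>
  The value \<open>\<alpha>\<close> at \<open>x\<close> has to lie above all numbers \<open>- C * norm (y + x) - a\<close> and below all numbers
  \<open>C * norm (z + x) - b\<close> for \<open>(y, a)\<close> and \<open>(z, b)\<close> in the graph. There is room for it because
  \<open>b - a \<le> C * norm (z - y)\<close>, and homogeneity carries the bound from \<open>y + x\<close> to \<open>y + s *\<^sub>R x\<close>.
\<close>

lemma partial_functional_extend:
  fixes \<Gamma> :: "('x::real_normed_vector \<times> real) set"
  assumes \<Gamma>: "partial_functional C \<Gamma>" and C: "C \<ge> 0" and x: "x \<notin> fst ` \<Gamma>"
  shows "\<exists>\<Delta>. partial_functional C \<Delta> \<and> \<Gamma> \<subset> \<Delta>"
proof -
  have sub: "subspace \<Gamma>" and bd: "\<And>y a. (y, a) \<in> \<Gamma> \<Longrightarrow> \<bar>a\<bar> \<le> C * norm y"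
    using \<Gamma> by (auto simp: partial_functional_def)
  have zero: "(0, 0) \<in> \<Gamma>" using subspace_0[OF sub] by (simp add: zero_prod_def)
  have cross: "- C * norm (y + x) - a \<le> C * norm (z + x) - b" if "(y, a) \<in> \<Gamma>" "(z, b) \<in> \<Gamma>" for y a z b
  proof -
    have "(z, b) - (y, a) \<in> \<Gamma>" using that by (intro subspace_diff sub)
    then have "\<bar>b - a\<bar> \<le> C * norm (z - y)" by (simp add: bd)
    also have "\<dots> = C * norm ((z + x) - (y + x))" by simp
    also have "\<dots> \<le> C * (norm (z + x) + norm (y + x))"
      using C by (intro mult_left_mono norm_triangle_ineq4)
    finally show ?thesis by (simp add: distrib_left)
  qed
  define L where "L = (\<lambda>(y, a). - C * norm (y + x) - a) ` \<Gamma>"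
  define \<alpha> where "\<alpha> = Sup L"
  have L_ub: "l \<le> C * norm (z + x) - b" if "(z, b) \<in> \<Gamma>" "l \<in> L" for z b l
    using cross that by (auto simp: L_def)
  have L_bdd: "bdd_above L" by (intro bdd_aboveI[of _ "C * norm (0 + x) - 0"] L_ub[OF zero])
  have lower: "- C * norm (y + x) - a \<le> \<alpha>" if "(y, a) \<in> \<Gamma>" for y a
    unfolding \<alpha>_def using L_bdd that by (intro cSup_upper) (force simp: L_def)+
  have upper: "\<alpha> \<le> C * norm (y + x) - a" if "(y, a) \<in> \<Gamma>" for y a
    unfolding \<alpha>_def using L_ub[OF that] zero by (intro cSup_least) (auto simp: L_def)
  define \<Delta> where "\<Delta> = {p + s *\<^sub>R (x, \<alpha>) | p s. p \<in> \<Gamma>}"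
  have "subspace \<Delta>"
    unfolding subspace_def
  proof (intro conjI ballI allI)
    show "0 \<in> \<Delta>" unfolding \<Delta>_def using subspace_0[OF sub] by (intro CollectI exI[of _ 0] exI[of _ "0::real"]) (auto simp: zero_prod_def)
  next
    fix u v assume "u \<in> \<Delta>" "v \<in> \<Delta>"
    then obtain p s q t where "p \<in> \<Gamma>" "q \<in> \<Gamma>" "u = p + s *\<^sub>R (x, \<alpha>)" "v = q + t *\<^sub>R (x, \<alpha>)"
      unfolding \<Delta>_def by blast
    then have "u + v = (p + q) + (s + t) *\<^sub>R (x, \<alpha>)" "p + q \<in> \<Gamma>"
      using subspace_add[OF sub] by (auto simp: algebra_simps)
    then show "u + v \<in> \<Delta>" unfolding \<Delta>_def by blast
  next
    fix c u assume "u \<in> \<Delta>"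
    then obtain p s where "p \<in> \<Gamma>" "u = p + s *\<^sub>R (x, \<alpha>)"
      unfolding \<Delta>_def by blast
    then have "c *\<^sub>R u = c *\<^sub>R p + (c * s) *\<^sub>R (x, \<alpha>)" "c *\<^sub>R p \<in> \<Gamma>"
      using subspace_scale[OF sub] by (auto simp: algebra_simps)
    then show "c *\<^sub>R u \<in> \<Delta>" unfolding \<Delta>_def by blast
  qed
  moreover have "\<bar>a\<bar> \<le> C * norm y" if ya: "(y, a) \<in> \<Delta>" for y a
  proof -
    obtain z b s where z: "(z, b) \<in> \<Gamma>" "y = z + s *\<^sub>R x" "a = b + s * \<alpha>"
      using ya unfolding \<Delta>_def by auto
    show ?thesis
    proof (cases "s = 0")
      case True
      then show ?thesis using z bd by simp
    next
      case False
      have "inverse s *\<^sub>R (z, b) \<in> \<Gamma>" using z by (intro subspace_scale sub)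
      then have "(inverse s *\<^sub>R z, inverse s * b) \<in> \<Gamma>" by simp
      from lower[OF this] upper[OF this]
      have "\<bar>inverse s * b + \<alpha>\<bar> \<le> C * norm (inverse s *\<^sub>R z + x)" by linarith
      then have "\<bar>s\<bar> * \<bar>inverse s * b + \<alpha>\<bar> \<le> \<bar>s\<bar> * (C * norm (inverse s *\<^sub>R z + x))"
        by (intro mult_left_mono) auto
      moreover have "\<bar>s\<bar> * \<bar>inverse s * b + \<alpha>\<bar> = \<bar>a\<bar>"
        using False z by (simp add: abs_mult[symmetric] algebra_simps)
      moreover have "\<bar>s\<bar> * norm (inverse s *\<^sub>R z + x) = norm y"
        using False z by (simp add: norm_scaleR[symmetric] scaleR_add_right del: norm_scaleR)
      ultimately show ?thesis by (simp add: mult.left_commute)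
    qed
  qed
  ultimately have "partial_functional C \<Delta>" by (auto simp: partial_functional_def)
  moreover have "\<Gamma> \<subseteq> \<Delta>" 
    unfolding \<Delta>_def by (intro subsetI CollectI exI[of _ "_ :: 'x \<times> real"] exI[of _ "0::real"]) (auto simp: zero_prod_def)
  moreover have "(x, \<alpha>) \<in> \<Delta>"
    unfolding \<Delta>_def using zero by (intro CollectI exI[of _ "(0, 0)"] exI[of _ 1]) auto
  moreover have "(x, \<alpha>) \<notin> \<Gamma>" using x by force
  ultimately show ?thesis by blast
qed

theorem Hahn_Banach:
  fixes W :: "'x::real_normed_vector set" and f :: "'x \<Rightarrow> real"
  assumes W: "subspace W" and add: "\<And>x y. x \<in> W \<Longrightarrow> y \<in> W \<Longrightarrow> f (x + y) = f x + f y"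
    and scale: "\<And>c x. x \<in> W \<Longrightarrow> f (c *\<^sub>R x) = c * f x"
    and bd: "\<And>x. x \<in> W \<Longrightarrow> \<bar>f x\<bar> \<le> C * norm x" and C: "C \<ge> 0"
  shows "\<exists>F. linear F \<and> (\<forall>x. \<bar>F x\<bar> \<le> C * norm x) \<and> (\<forall>x\<in>W. F x = f x)"
proof -
  define \<Gamma> where "\<Gamma> = (\<lambda>x. (x, f x)) ` W"
  have f0: "f 0 = 0" using scale[of 0 0] subspace_0[OF W] by simp
  have \<Gamma>: "partial_functional C \<Gamma>"
    unfolding partial_functional_def subspace_def
  proof (intro conjI ballI allI)
    show "0 \<in> \<Gamma>" using subspace_0[OF W] f0 by (auto simp: \<Gamma>_def zero_prod_def intro!: image_eqI[of _ _ 0])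
  next
    fix u v assume "u \<in> \<Gamma>" "v \<in> \<Gamma>"
    then obtain x y where "x \<in> W" "y \<in> W" "u = (x, f x)" "v = (y, f y)" by (auto simp: \<Gamma>_def)
    then show "u + v \<in> \<Gamma>"
      unfolding \<Gamma>_def using add subspace_add[OF W] by (intro image_eqI[of _ _ "x + y"]) auto
  next
    fix c u assume "u \<in> \<Gamma>"
    then obtain x where "x \<in> W" "u = (x, f x)" by (auto simp: \<Gamma>_def)
    then show "c *\<^sub>R u \<in> \<Gamma>"
      unfolding \<Gamma>_def using scale subspace_scale[OF W] by (intro image_eqI[of _ _ "c *\<^sub>R x"]) auto
  qed (use bd in \<open>auto simp: \<Gamma>_def\<close>)
  define \<G> where "\<G> = {\<Delta>. partial_functional C \<Delta> \<and> \<Gamma> \<subseteq> \<Delta>}"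
  have "\<exists>M\<in>\<G>. \<forall>X\<in>\<G>. M \<subseteq> X \<longrightarrow> X = M"
  proof (rule subset_Zorn_nonempty)
    show "\<G> \<noteq> {}" using \<Gamma> by (auto simp: \<G>_def)
    fix \<C> assume ne: "\<C> \<noteq> {}" and ch: "subset.chain \<G> \<C>"
    have sub: "subspace X" and bdX: "\<forall>(x, a)\<in>X. \<bar>a\<bar> \<le> C * norm x" and GX: "\<Gamma> \<subseteq> X" if "X \<in> \<C>" for X
      using ch that by (auto simp: subset.chain_def \<G>_def partial_functional_def)
    have "subspace (\<Union>\<C>)"
      unfolding subspace_def
    proof (intro conjI ballI allI)
      show "0 \<in> \<Union>\<C>" using ne sub subspace_0 by blast
    next
      fix u v assume "u \<in> \<Union>\<C>" "v \<in> \<Union>\<C>"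
      then obtain X Y where "X \<in> \<C>" "Y \<in> \<C>" "u \<in> X" "v \<in> Y" by blast
      moreover from this have "X \<subseteq> Y \<or> Y \<subseteq> X" using ch by (auto simp: subset.chain_def)
      ultimately show "u + v \<in> \<Union>\<C>" using sub subspace_add by (metis UnionI subsetD)
    next
      fix c u assume "u \<in> \<Union>\<C>"
      then show "c *\<^sub>R u \<in> \<Union>\<C>" using sub subspace_scale by blast
    qed
    moreover have "\<forall>(x, a)\<in>\<Union>\<C>. \<bar>a\<bar> \<le> C * norm x" using bdX by blast
    moreover have "\<Gamma> \<subseteq> \<Union>\<C>" using ne GX by blast
    ultimately show "\<Union>\<C> \<in> \<G>" by (simp add: \<G>_def partial_functional_def)
  qed
  then obtain M where M: "M \<in> \<G>" "\<And>X. X \<in> \<G> \<Longrightarrow> M \<subseteq> X \<Longrightarrow> X = M" by blast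
  then have pM: "partial_functional C M" and GM: "\<Gamma> \<subseteq> M" by (auto simp: \<G>_def)
  have "\<exists>a. (x, a) \<in> M" for x
  proof (rule ccontr)
    assume "\<nexists>a. (x, a) \<in> M"
    then have "x \<notin> fst ` M" by force
    then obtain \<Delta> where "partial_functional C \<Delta>" "M \<subset> \<Delta>"
      using partial_functional_extend[OF pM C] by blast
    then show False using M(2)[of \<Delta>] GM by (auto simp: \<G>_def)
  qed
  then obtain F where F: "\<And>x. (x, F x) \<in> M" by metis
  have Feq: "F x = a" if "(x, a) \<in> M" for x a
    using partial_functional_unique[OF pM F that] .
  have sM: "subspace M" using pM by (simp add: partial_functional_def)
  have "linear F"
  proof
    fix x y show "F (x + y) = F x + F y"
      using subspace_add[OF sM F F, of x y] by (intro Feq) simp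
  next
    fix c x show "F (c *\<^sub>R x) = c *\<^sub>R F x"
      using subspace_scale[OF sM F, of c x] by (intro Feq) simp
  qed
  moreover have "\<bar>F x\<bar> \<le> C * norm x" for x
    using pM F[of x] by (auto simp: partial_functional_def)
  moreover have "F x = f x" if "x \<in> W" for x
    using GM that by (intro Feq) (auto simp: \<Gamma>_def)
  ultimately show ?thesis by blast
qed

text \<open>
  Banach spaces carried by a linear subspace of a type, with a norm of their own. The spaces
  \<open>C(K)\<close> and \<open>c\<^sub>0\<close> are of this kind, and so are the closed subspaces of a Banach space.
\<close>

locale banach_subspace =
  fixes V :: "'v::real_vector set" and nV :: "'v \<Rightarrow> real"
  assumes subspace: "subspace V"
    and nonneg: "\<And>x. x \<in> V \<Longrightarrow> 0 \<le> nV x"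
    and definite: "\<And>x. x \<in> V \<Longrightarrow> nV x = 0 \<Longrightarrow> x = 0"
    and homogeneous: "\<And>c x. x \<in> V \<Longrightarrow> nV (c *\<^sub>R x) = \<bar>c\<bar> * nV x"
    and triangle: "\<And>x y. x \<in> V \<Longrightarrow> y \<in> V \<Longrightarrow> nV (x + y) \<le> nV x + nV y"
    and complete: "\<And>\<sigma> :: nat \<Rightarrow> 'v. (\<And>n. \<sigma> n \<in> V) \<Longrightarrow>
      (\<And>\<epsilon>. \<epsilon> > 0 \<Longrightarrow> \<exists>N. \<forall>m\<ge>N. \<forall>n\<ge>N. nV (\<sigma> m - \<sigma> n) < \<epsilon>) \<Longrightarrow>
      \<exists>l\<in>V. (\<lambda>n. nV (\<sigma> n - l)) \<longlonglongrightarrow> 0"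
begin

lemma zero_in: "0 \<in> V" by (rule subspace_0[OF subspace])
lemma add_in: "x \<in> V \<Longrightarrow> y \<in> V \<Longrightarrow> x + y \<in> V" by (rule subspace_add[OF subspace])
lemma diff_in: "x \<in> V \<Longrightarrow> y \<in> V \<Longrightarrow> x - y \<in> V" by (rule subspace_diff[OF subspace])
lemma scale_in: "x \<in> V \<Longrightarrow> c *\<^sub>R x \<in> V" by (rule subspace_scale[OF subspace])

lemma norm_zero: "nV 0 = 0" using homogeneous[OF zero_in, of 0] by simp

lemma norm_minus: "x \<in> V \<Longrightarrow> nV (- x) = nV x" using homogeneous[of x "-1"] by simp

lemma norm_commute: "x \<in> V \<Longrightarrow> y \<in> V \<Longrightarrow> nV (x - y) = nV (y - x)"
  using norm_minus[of "x - y"] diff_in by simp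

lemma norm_diff_triangle: "x \<in> V \<Longrightarrow> y \<in> V \<Longrightarrow> z \<in> V \<Longrightarrow> nV (x - z) \<le> nV (x - y) + nV (y - z)"
  using triangle[of "x - y" "y - z"] diff_in by simp

lemma norm_diff_le: "x \<in> V \<Longrightarrow> y \<in> V \<Longrightarrow> nV (x - y) \<le> nV x + nV y"
  using triangle[of x "- y"] norm_minus subspace_neg[OF subspace] by simp

text \<open>
  The locale of metric spaces wants a distance that is nonnegative and symmetric on the whole type;
  the value \<open>0\<close> outside \<open>V\<close> provides this.
\<close>

definition dst :: "'v \<Rightarrow> 'v \<Rightarrow> real" where
  "dst x y = (if x \<in> V \<and> y \<in> V then nV (x - y) else 0)"

sublocale M: Metric_space V dst
proof
  show "0 \<le> dst x y" for x y by (simp add: dst_def nonneg diff_in)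
  show "dst x y = dst y x" for x y by (simp add: dst_def norm_commute)
  show "dst x y = 0 \<longleftrightarrow> x = y" if "x \<in> V" "y \<in> V" for x y
    using that definite[of "x - y"] by (auto simp: dst_def norm_zero diff_in)
  show "dst x z \<le> dst x y + dst y z" if "x \<in> V" "y \<in> V" "z \<in> V" for x y z
    using that norm_diff_triangle[of x y z] by (simp add: dst_def)
qed

lemma mcomplete: "M.mcomplete"
  unfolding M.mcomplete_def
proof (intro allI impI)
  fix \<sigma> assume \<sigma>: "M.MCauchy \<sigma>"
  then have in_V: "\<sigma> n \<in> V" for n by (auto simp: M.MCauchy_def)
  have "\<exists>N. \<forall>m\<ge>N. \<forall>n\<ge>N. nV (\<sigma> m - \<sigma> n) < \<epsilon>" if "\<epsilon> > 0" for \<epsilon>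
    using \<sigma> that in_V unfolding M.MCauchy_def by (auto simp: dst_def)
  then obtain l where l: "l \<in> V" "(\<lambda>n. nV (\<sigma> n - l)) \<longlonglongrightarrow> 0"
    using complete[of \<sigma>] in_V by blast
  have "limitin M.mtopology \<sigma> l sequentially"
    unfolding M.limitin_metric
  proof (intro conjI allI impI)
    fix \<epsilon> :: real assume "\<epsilon> > 0"
    with l(2) have "\<forall>\<^sub>F n in sequentially. nV (\<sigma> n - l) < \<epsilon>" by (rule order_tendstoD)
    then show "\<forall>\<^sub>F n in sequentially. \<sigma> n \<in> V \<and> dst (\<sigma> n) l < \<epsilon>"
      by eventually_elim (simp add: dst_def in_V l)
  qed (rule l)
  then show "\<exists>x. limitin M.mtopology \<sigma> x sequentially" ..
qed

end

lemma bounded_operatorD: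
  assumes "bounded_operator V nV W nW T"
  shows "\<And>x. x \<in> V \<Longrightarrow> T x \<in> W" "\<And>x y. x \<in> V \<Longrightarrow> y \<in> V \<Longrightarrow> T (x + y) = T x + T y"
    "\<And>c x. x \<in> V \<Longrightarrow> T (c *\<^sub>R x) = c *\<^sub>R T x" "\<exists>B. \<forall>x\<in>V. nW (T x) \<le> B * nV x"
  using assms by (simp_all add: bounded_operator_def)

text \<open>
  Banach's theorem for operators onto \<open>W\<close>, in the quantitative form in which it is applied: preimages
  can be chosen with norm bounded by a multiple of the norm of the image.
\<close>

theorem open_mapping:
  assumes "banach_subspace V nV" "banach_subspace W nW"
    and T: "bounded_operator V nV W nW T" and onto: "T ` V = W"
  shows "\<exists>C. \<forall>w\<in>W. \<exists>v\<in>V. T v = w \<and> nV v \<le> C * nW w"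
proof -
  interpret V: banach_subspace V nV by fact
  interpret W: banach_subspace W nW by fact
  note T_in = bounded_operatorD(1)[OF T] and T_add = bounded_operatorD(2)[OF T]
    and T_scale = bounded_operatorD(3)[OF T]
  obtain B where T_bound: "\<And>x. x \<in> V \<Longrightarrow> nW (T x) \<le> B * nV x"
    using bounded_operatorD(4)[OF T] by blast
  have T_diff: "T (x - y) = T x - T y" if "x \<in> V" "y \<in> V" for x y
    using T_add[of x "- y"] T_scale[of y "-1"] that V.scale_in[of y "-1"] by simp
  define A where "A n = T ` {v \<in> V. nV v \<le> real n}" for n :: nat
  have A_W: "A n \<subseteq> W" for n using T_in by (auto simp: A_def)
  \<comment> \<open>By the Baire category theorem the closure of the image of some ball contains a ball.\<close>
  have "\<exists>n. W.M.mtopology interior_of (W.M.mtopology closure_of A n) \<noteq> {}"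
  proof (rule ccontr)
    assume *: "\<nexists>n. W.M.mtopology interior_of (W.M.mtopology closure_of A n) \<noteq> {}"
    let ?\<G> = "range (\<lambda>n. W.M.mtopology closure_of A n)"
    have "W.M.mtopology interior_of \<Union>?\<G> = {}"
      using * by (intro W.M.metric_Baire_category_alt W.mcomplete) auto
    moreover have "\<Union>?\<G> = W"
    proof
      show "\<Union>?\<G> \<subseteq> W" using closure_of_subset_topspace[of W.M.mtopology] by fastforce
      show "W \<subseteq> \<Union>?\<G>"
      proof
        fix w assume "w \<in> W"
        then obtain v where "v \<in> V" "w = T v" using onto by auto
        moreover obtain n where "nV v \<le> real n" using real_arch_simple by blast
        ultimately have "w \<in> A n" by (auto simp: A_def)
        then show "w \<in> \<Union>?\<G>" using closure_of_subset[of "A n" W.M.mtopology] A_W by auto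
      qed
    qed
    moreover have "W.M.mtopology interior_of W = W" using interior_of_topspace[of W.M.mtopology] by simp
    ultimately show False using W.zero_in by auto
  qed
  then obtain n w0 where "w0 \<in> W.M.mtopology interior_of (W.M.mtopology closure_of A n)" by blast
  then obtain r where r: "r > 0" "W.M.mball w0 r \<subseteq> W.M.mtopology closure_of A n" and w0: "w0 \<in> W"
    using openin_interior_of[of W.M.mtopology] interior_of_subset[of W.M.mtopology]
      interior_of_subset_topspace[of W.M.mtopology]
    unfolding W.M.openin_mtopology by (metis subset_trans subsetD W.M.topspace_mtopology)
  have approx: "\<exists>v\<in>V. nV v \<le> real n \<and> nW (T v - w) < \<epsilon>" if w: "w \<in> W.M.mball w0 r" and \<epsilon>: "\<epsilon> > 0" for w \<epsilon>
  proof -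
    have "w \<in> W.M.mtopology closure_of A n" using r w by auto
    then obtain y where "y \<in> A n" "y \<in> W.M.mball w \<epsilon>"
      unfolding W.M.metric_closure_of using \<epsilon> by auto
    then show ?thesis unfolding A_def
      by (auto simp: W.M.in_mball W.dst_def W.norm_commute)
  qed
  \<comment> \<open>Subtracting the centre \<open>w0\<close> doubles the norm of the approximate preimages, and \<open>w\<close> is scaled
    to norm \<open>r / 2\<close>; together this makes the factor \<open>4 n / r\<close>.\<close>
  define K where "K = 4 * real n / r"
  have K: "K \<ge> 0" using r by (simp add: K_def)
  have step: "\<exists>v\<in>V. nV v \<le> K * nW w \<and> nW (w - T v) < \<epsilon>" if w: "w \<in> W" and \<epsilon>: "\<epsilon> > 0" for w \<epsilon>
  proof (cases "nW w = 0")
    case True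
    have "T 0 = 0" using T_scale[OF V.zero_in, of 0] by simp
    then show ?thesis using True W.definite[OF w] \<epsilon> V.zero_in V.norm_zero W.norm_zero by force
  next
    case False
    define a where "a = r / (2 * nW w)"
    have pos: "nW w > 0" using False W.nonneg[OF w] by simp
    have a: "a > 0" using pos r by (simp add: a_def)
    have aw: "a *\<^sub>R w \<in> W" "nW (a *\<^sub>R w) = r / 2"
      using w W.scale_in pos a W.homogeneous[OF w, of a] r by (auto simp: a_def)
    have b1: "w0 + a *\<^sub>R w \<in> W.M.mball w0 r" "w0 \<in> W.M.mball w0 r"
      using aw w0 r W.norm_minus[OF aw(1)] by (auto simp: W.M.in_mball W.dst_def W.add_in W.norm_zero)
    have ae: "a * \<epsilon> / 2 > 0" using a \<epsilon> by simp
    obtain v1 where v1: "v1 \<in> V" "nV v1 \<le> real n" "nW (T v1 - (w0 + a *\<^sub>R w)) < a * \<epsilon> / 2"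
      using approx[OF b1(1) ae] by blast
    obtain v2 where v2: "v2 \<in> V" "nV v2 \<le> real n" "nW (T v2 - w0) < a * \<epsilon> / 2"
      using approx[OF b1(2) ae] by blast
    define v where "v = inverse a *\<^sub>R (v1 - v2)"
    have v: "v \<in> V" unfolding v_def using v1 v2 by (intro V.scale_in V.diff_in)
    have "nV v = inverse a * nV (v1 - v2)"
      unfolding v_def using V.homogeneous[OF V.diff_in[OF v1(1) v2(1)], of "inverse a"] a by simp
    also have "\<dots> \<le> inverse a * (2 * real n)"
      using V.norm_diff_le[OF v1(1) v2(1)] v1 v2 a by (intro mult_left_mono) auto
    also have "\<dots> = K * nW w" using r pos by (simp add: a_def K_def)
    finally have nv: "nV v \<le> K * nW w" .
    have W1: "T v1 - (w0 + a *\<^sub>R w) \<in> W" "T v2 - w0 \<in> W"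
      using v1 v2 T_in w0 aw W.add_in W.diff_in by auto
    have "a *\<^sub>R (w - T v) = a *\<^sub>R w - (T v1 - T v2)"
      using a T_scale[OF V.diff_in[OF v1(1) v2(1)], of "inverse a"] T_diff[OF v1(1) v2(1)]
      by (simp add: v_def scaleR_diff_right)
    also have "\<dots> = (T v2 - w0) - (T v1 - (w0 + a *\<^sub>R w))" by simp
    finally have "nW (a *\<^sub>R (w - T v)) < a * \<epsilon>"
      using W.norm_diff_le[OF W1(2,1)] v1 v2 by simp
    moreover have "nW (a *\<^sub>R (w - T v)) = a * nW (w - T v)"
      using W.homogeneous[of "w - T v" a] W.diff_in[OF w T_in[OF v]] a by simp
    ultimately show ?thesis using v nv a by auto
  qed
  \<comment> \<open>Approximating again what is left, with half the error each time, gives approximate preimages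
    \<open>s k\<close> that form a Cauchy sequence.\<close>
  have "\<exists>v\<in>V. T v = w \<and> nV v \<le> (2 * K) * nW w" if w: "w \<in> W" for w
  proof (cases "w = 0")
    case True
    have "T 0 = 0" using T_scale[OF V.zero_in, of 0] by simp
    then show ?thesis using True V.zero_in V.norm_zero W.norm_zero by force
  next
    case False
    define N where "N = nW w"
    have N: "N > 0" using False W.nonneg[OF w] W.definite[OF w] by (force simp: N_def)
    define P where "P k s \<longleftrightarrow> s \<in> V \<and> nW (w - T s) \<le> N / 2 ^ k" for k :: nat and s
    have "\<exists>s. P 0 s" 
      using V.zero_in T_scale[OF V.zero_in, of 0] by (auto simp: P_def N_def)
    moreover have "\<exists>s'. P (Suc k) s' \<and> nV (s' - s) \<le> K * (N / 2 ^ k)" if s: "P k s" for k s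
    proof -
      have sW: "w - T s \<in> W" "s \<in> V" using s w T_in W.diff_in by (auto simp: P_def)
      obtain v where v: "v \<in> V" "nV v \<le> K * nW (w - T s)" "nW (w - T s - T v) < N / 2 ^ Suc k"
        using step[OF sW(1), of "N / 2 ^ Suc k"] N by auto
      have "K * nW (w - T s) \<le> K * (N / 2 ^ k)" using s K by (intro mult_left_mono) (auto simp: P_def)
      then show ?thesis
        using v sW T_add[OF sW(2) v(1)] V.add_in[OF sW(2) v(1)]
        by (intro exI[of _ "s + v"]) (auto simp: P_def diff_diff_eq)
    qed
    moreover define s0 where "s0 = (0 :: 'a)"
    have "P 0 s0" using V.zero_in T_scale[OF V.zero_in, of 0] by (auto simp: P_def N_def s0_def)
    ultimately obtain s where s: "\<And>k. P k (s k)" "\<And>k. nV (s (Suc k) - s k) \<le> K * (N / 2 ^ k)" and s_0: "s 0 = 0"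
      using dependent_nat_choice[of "\<lambda>k x. P k x \<and> (k = 0 \<longrightarrow> x = s0)" "\<lambda>k x y. nV (y - x) \<le> K * (N / 2 ^ k)"]
      unfolding s0_def by (metis Suc_neq_Zero)
    have sV: "s k \<in> V" for k using s by (simp add: P_def)
    have tail: "nV (s (k + j) - s k) \<le> 2 * K * N * (1 / 2 ^ k - 1 / 2 ^ (k + j))" for k j
    proof (induction j)
      case 0
      then show ?case by (simp add: V.norm_zero)
    next
      case (Suc j)
      have "nV (s (k + Suc j) - s k) \<le> nV (s (Suc (k + j)) - s (k + j)) + nV (s (k + j) - s k)"
        using V.norm_diff_triangle[OF sV sV sV, of "Suc (k + j)" k "k + j"] by simp
      also have "\<dots> \<le> K * (N / 2 ^ (k + j)) + 2 * K * N * (1 / 2 ^ k - 1 / 2 ^ (k + j))"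
        using s(2) Suc by (intro add_mono)
      also have "\<dots> = 2 * K * N * (1 / 2 ^ k - 1 / 2 ^ (k + Suc j))"
        by (simp add: field_simps)
      finally show ?case .
    qed
    have tail': "nV (s m - s k) \<le> 2 * K * N / 2 ^ k" if "k \<le> m" for k m
    proof -
      have "2 * K * N * (1 / 2 ^ k - 1 / 2 ^ m) \<le> 2 * K * N * (1 / 2 ^ k)"
        using K N by (intro mult_left_mono) auto
      then show ?thesis using tail[of k "m - k"] that by simp
    qed
    have null: "(\<lambda>k. c / 2 ^ k) \<longlonglongrightarrow> 0" for c :: real
      using tendsto_mult_right_zero[OF LIMSEQ_inverse_realpow_zero[of 2], of c] by (simp add: divide_inverse)
    have "\<exists>M. \<forall>i\<ge>M. \<forall>j\<ge>M. nV (s i - s j) < \<epsilon>" if \<epsilon>: "\<epsilon> > 0" for \<epsilon>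
    proof -
      obtain M where M: "\<And>k. k \<ge> M \<Longrightarrow> 2 * K * N / 2 ^ k < \<epsilon>"
        using order_tendstoD(2)[OF null \<epsilon>] by (auto simp: eventually_sequentially)
      have "nV (s i - s j) < \<epsilon>" if "i \<ge> M" "j \<ge> M" for i j
        using tail'[of i j] tail'[of j i] M[of i] M[of j] that V.norm_commute[OF sV sV, of i j]
        by (cases "i \<le> j") auto
      then show ?thesis by blast
    qed
    then obtain v where v: "v \<in> V" "(\<lambda>k. nV (s k - v)) \<longlonglongrightarrow> 0"
      using V.complete[of s] sV by blast
    have "nW (w - T v) \<le> 0"
    proof (rule LIMSEQ_le_const)
      show "(\<lambda>k. N / 2 ^ k + B * nV (s k - v)) \<longlonglongrightarrow> 0"
        using tendsto_add[OF null tendsto_mult_right_zero[OF v(2)]] by simp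
      have "nW (w - T v) \<le> N / 2 ^ k + B * nV (s k - v)" for k
      proof -
        have "nW (w - T v) \<le> nW (w - T (s k)) + nW (T (s k) - T v)"
          by (rule W.norm_diff_triangle[OF w T_in[OF sV] T_in[OF v(1)]])
        moreover have "nW (T (s k) - T v) \<le> B * nV (s k - v)"
          using T_bound[OF V.diff_in[OF sV v(1)], of k] T_diff[OF sV v(1)] by simp
        ultimately show ?thesis using s(1)[of k] by (simp add: P_def)
      qed
      then show "\<exists>M. \<forall>k\<ge>M. nW (w - T v) \<le> N / 2 ^ k + B * nV (s k - v)" by blast
    qed
    then have "T v = w"
      using W.definite[OF W.diff_in[OF w T_in[OF v(1)]]] W.nonneg[OF W.diff_in[OF w T_in[OF v(1)]]] by simp
    moreover have "nV v \<le> 2 * K * N"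
    proof (rule LIMSEQ_le_const)
      show "(\<lambda>k. 2 * K * N + nV (s k - v)) \<longlonglongrightarrow> 2 * K * N"
        using tendsto_add[OF tendsto_const v(2)] by simp
      have "nV v \<le> 2 * K * N + nV (s k - v)" for k
      proof -
        have "nV v \<le> nV (v - s k) + nV (s k)" using V.triangle[OF V.diff_in[OF v(1) sV] sV, of k k] by simp
        then show ?thesis using tail'[of 0 k] V.norm_commute[OF v(1) sV, of k] by (simp add: s_0)
      qed
      then show "\<exists>M. \<forall>k\<ge>M. nV v \<le> 2 * K * N + nV (s k - v)" by blast
    qed
    ultimately show ?thesis using v by (auto simp: N_def)
  qed
  then show ?thesis by blast
qed

section \<open>Splitting twisted sums by lifting operators\<close>

lemma le_sup_norm:
  assumes "bdd_above ((\<lambda>x. \<bar>f x\<bar>) ` S)" "\<And>x. x \<notin> S \<Longrightarrow> f x = 0"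
  shows "\<bar>f x\<bar> \<le> sup_norm S f"
  using assms sup_norm_upper[OF assms(1), of x] sup_norm_nonneg[OF assms(1)] by (cases "x \<in> S") auto

text \<open>
  As the functions vanish outside \<open>S\<close>, Cauchy sequences for the supremum over \<open>S\<close> converge uniformly
  on the whole type.
\<close>

lemma banach_subspace_sup_norm:
  fixes V :: "('a \<Rightarrow> real) set"
  assumes sub: "subspace V" and bdd: "\<And>f. f \<in> V \<Longrightarrow> bdd_above ((\<lambda>x. \<bar>f x\<bar>) ` S)"
    and supp: "\<And>f x. f \<in> V \<Longrightarrow> x \<notin> S \<Longrightarrow> f x = 0"
    and closed: "\<And>(\<sigma> :: nat \<Rightarrow> 'a \<Rightarrow> real) l. (\<And>n. \<sigma> n \<in> V) \<Longrightarrow> (\<And>\<epsilon>. \<epsilon> > 0 \<Longrightarrow> \<exists>N. \<forall>n\<ge>N. \<forall>x. \<bar>\<sigma> n x - l x\<bar> \<le> \<epsilon>) \<Longrightarrow> l \<in> V"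
  shows "banach_subspace V (sup_norm S)"
proof
  have le: "\<bar>f x\<bar> \<le> sup_norm S f" if "f \<in> V" for f x
    using le_sup_norm[OF bdd[OF that] supp[OF that]] .
  show "subspace V" by (rule sub)
  show "0 \<le> sup_norm S f" if "f \<in> V" for f using bdd[OF that] by (rule sup_norm_nonneg)
  show "f = 0" if "f \<in> V" "sup_norm S f = 0" for f
  proof
    fix x show "f x = 0 x" using le[OF that(1), of x] that(2) by simp
  qed
  show "sup_norm S (c *\<^sub>R f) = \<bar>c\<bar> * sup_norm S f" if "f \<in> V" for c f
    using bdd[OF that] by (rule sup_norm_scaleR)
  show "sup_norm S (f + g) \<le> sup_norm S f + sup_norm S g" if "f \<in> V" "g \<in> V" for f g
    using bdd[OF that(1)] bdd[OF that(2)] by (rule sup_norm_add)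
  fix \<sigma> :: "nat \<Rightarrow> 'a \<Rightarrow> real"
  assume \<sigma>: "\<And>n. \<sigma> n \<in> V" and Cau: "\<And>\<epsilon>. \<epsilon> > 0 \<Longrightarrow> \<exists>N. \<forall>m\<ge>N. \<forall>n\<ge>N. sup_norm S (\<sigma> m - \<sigma> n) < \<epsilon>"
  have unif: "\<exists>N. \<forall>m\<ge>N. \<forall>n\<ge>N. \<forall>x. \<bar>\<sigma> m x - \<sigma> n x\<bar> < \<epsilon>" if \<epsilon>: "\<epsilon> > 0" for \<epsilon>
  proof -
    obtain N where N: "\<And>m n. m \<ge> N \<Longrightarrow> n \<ge> N \<Longrightarrow> sup_norm S (\<sigma> m - \<sigma> n) < \<epsilon>"
      using Cau[OF \<epsilon>] by auto
    have "\<bar>\<sigma> m x - \<sigma> n x\<bar> < \<epsilon>" if "m \<ge> N" "n \<ge> N" for m n x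
      using le[OF subspace_diff[OF sub \<sigma> \<sigma>], of m n x] N[OF that] by simp
    then show ?thesis by blast
  qed
  have "Cauchy (\<lambda>n. \<sigma> n x)" for x
    unfolding Cauchy_def dist_real_def
  proof (intro allI impI)
    fix \<epsilon> :: real assume "\<epsilon> > 0"
    from unif[OF this] show "\<exists>N. \<forall>m\<ge>N. \<forall>n\<ge>N. \<bar>\<sigma> m x - \<sigma> n x\<bar> < \<epsilon>" by blast
  qed
  then have "\<exists>l. (\<lambda>n. \<sigma> n x) \<longlonglongrightarrow> l" for x
    by (simp add: real_Cauchy_convergent flip: convergent_def)
  then obtain l where l: "\<And>x. (\<lambda>n. \<sigma> n x) \<longlonglongrightarrow> l x" by metis
  have near: "\<exists>N. \<forall>n\<ge>N. \<forall>x. \<bar>\<sigma> n x - l x\<bar> \<le> \<epsilon>" if \<epsilon>: "\<epsilon> > 0" for \<epsilon>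
  proof -
    obtain N where N: "\<And>m n x. m \<ge> N \<Longrightarrow> n \<ge> N \<Longrightarrow> \<bar>\<sigma> m x - \<sigma> n x\<bar> < \<epsilon>"
      using unif[OF \<epsilon>] by auto
    have "\<bar>\<sigma> n x - l x\<bar> \<le> \<epsilon>" if n: "n \<ge> N" for n x
    proof (rule LIMSEQ_le_const2)
      show "(\<lambda>m. \<bar>\<sigma> n x - \<sigma> m x\<bar>) \<longlonglongrightarrow> \<bar>\<sigma> n x - l x\<bar>" by (intro tendsto_intros l)
      show "\<exists>M. \<forall>m\<ge>M. \<bar>\<sigma> n x - \<sigma> m x\<bar> \<le> \<epsilon>" using N[OF n] by (meson less_imp_le)
    qed
    then show ?thesis by blast
  qed
  have lV: "l \<in> V" by (rule closed[of \<sigma>]) (simp_all add: \<sigma> near)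
  have "(\<lambda>n. sup_norm S (\<sigma> n - l)) \<longlonglongrightarrow> 0"
  proof (rule LIMSEQ_I)
    fix \<epsilon> :: real assume "\<epsilon> > 0"
    then obtain N where N: "\<And>n x. n \<ge> N \<Longrightarrow> \<bar>\<sigma> n x - l x\<bar> \<le> \<epsilon> / 2" using near[of "\<epsilon> / 2"] by auto
    have "norm (sup_norm S (\<sigma> n - l) - 0) < \<epsilon>" if "n \<ge> N" for n
    proof -
      have "sup_norm S (\<sigma> n - l) \<le> \<epsilon> / 2" using N[OF that] \<open>\<epsilon> > 0\<close> by (intro sup_norm_least) auto
      moreover have "0 \<le> sup_norm S (\<sigma> n - l)"
        using bdd[OF subspace_diff[OF sub \<sigma> lV]] by (rule sup_norm_nonneg)
      ultimately show ?thesis using \<open>\<epsilon> > 0\<close> by simp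
    qed
    then show "\<exists>N. \<forall>n\<ge>N. norm (sup_norm S (\<sigma> n - l) - 0) < \<epsilon>" by blast
  qed
  then show "\<exists>l\<in>V. (\<lambda>n. sup_norm S (\<sigma> n - l)) \<longlonglongrightarrow> 0" using lV by blast
qed

lemma banach_subspace_C_space:
  assumes "compact_space K"
  shows "banach_subspace (C_space K) (sup_norm (topspace K))"
proof (rule banach_subspace_sup_norm)
  show "subspace (C_space K)" by (rule subspace_C_space)
  show "bdd_above ((\<lambda>x. \<bar>f x\<bar>) ` topspace K)" if "f \<in> C_space K" for f
    using C_space_bdd[OF assms that] .
  show "f x = 0" if "f \<in> C_space K" "x \<notin> topspace K" for f x using that by (auto simp: C_space_def)
  fix \<sigma> :: "nat \<Rightarrow> 'a \<Rightarrow> real" and l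
  assume \<sigma>: "\<And>n. \<sigma> n \<in> C_space K" and lim: "\<And>\<epsilon>. \<epsilon> > 0 \<Longrightarrow> \<exists>N. \<forall>n\<ge>N. \<forall>x. \<bar>\<sigma> n x - l x\<bar> \<le> \<epsilon>"
  have "continuous_map K (Met_TC.mtopology :: real topology) l"
  proof (rule Met_TC.continuous_map_uniform_limit)
    show "\<forall>\<^sub>F n in sequentially. continuous_map K Met_TC.mtopology (\<sigma> n)"
      using \<sigma> by (simp add: C_space_def)
    fix \<epsilon> :: real assume "\<epsilon> > 0"
    then obtain N where N: "\<And>n x. n \<ge> N \<Longrightarrow> \<bar>\<sigma> n x - l x\<bar> \<le> \<epsilon> / 2" using lim[of "\<epsilon> / 2"] by auto
    have "\<bar>\<sigma> n x - l x\<bar> < \<epsilon>" if "n \<ge> N" for n x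
      using N[OF that, of x] \<open>\<epsilon> > 0\<close> by simp
    then show "\<forall>\<^sub>F n in sequentially. \<forall>x\<in>topspace K. l x \<in> UNIV \<and> dist (\<sigma> n x) (l x) < \<epsilon>"
      by (auto simp: eventually_sequentially dist_real_def)
  qed simp
  moreover have "l x = 0" if "x \<notin> topspace K" for x
  proof -
    have z: "\<sigma> n x = 0" for n using \<sigma> that by (auto simp: C_space_def)
    have "\<bar>l x\<bar> \<le> \<epsilon>" if "\<epsilon> > 0" for \<epsilon>
      using lim[OF that] z by (metis abs_minus_commute diff_zero order_refl)
    then show ?thesis by (metis abs_le_zero_iff field_le_epsilon add_0)
  qed
  ultimately show "l \<in> C_space K" by (simp add: C_space_def)
qed

lemma c0_bdd:
  assumes "f \<in> c0_space"
  shows "bdd_above ((\<lambda>n. \<bar>f n\<bar>) ` UNIV)"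
proof -
  have "Bseq f" using assms by (intro convergent_imp_Bseq) (auto simp: c0_space_def convergent_def)
  then obtain b where "\<And>n. \<bar>f n\<bar> \<le> b" by (auto simp: Bseq_def)
  then show ?thesis by (intro bdd_aboveI2[of _ _ b])
qed

lemma banach_subspace_c0: "banach_subspace c0_space (sup_norm UNIV)"
proof (rule banach_subspace_sup_norm)
  show "subspace c0_space"
    by (auto simp: subspace_def c0_space_def plus_fun_def zero_fun_def scaleR_fun_def
        intro: tendsto_add_zero tendsto_mult_right_zero)
  show "bdd_above ((\<lambda>n. \<bar>f n\<bar>) ` UNIV)" if "f \<in> c0_space" for f
    using that by (rule c0_bdd)
  fix \<sigma> :: "nat \<Rightarrow> nat \<Rightarrow> real" and l
  assume \<sigma>: "\<And>n. \<sigma> n \<in> c0_space" and lim: "\<And>\<epsilon>. \<epsilon> > 0 \<Longrightarrow> \<exists>N. \<forall>n\<ge>N. \<forall>x. \<bar>\<sigma> n x - l x\<bar> \<le> \<epsilon>"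
  have "l \<longlonglongrightarrow> 0"
  proof (rule LIMSEQ_I)
    fix \<epsilon> :: real assume \<epsilon>: "\<epsilon> > 0"
    then obtain N where N: "\<And>x. \<bar>\<sigma> N x - l x\<bar> \<le> \<epsilon> / 2" using lim[of "\<epsilon> / 2"] by auto
    obtain M where M: "\<And>x. x \<ge> M \<Longrightarrow> \<bar>\<sigma> N x\<bar> < \<epsilon> / 2"
      using LIMSEQ_D[of "\<sigma> N" 0 "\<epsilon> / 2"] \<sigma> \<epsilon> by (auto simp: c0_space_def)
    have "norm (l x - 0) < \<epsilon>" if "x \<ge> M" for x
      using N[of x] M[OF that] unfolding real_norm_def diff_zero by linarith
    then show "\<exists>M. \<forall>x\<ge>M. norm (l x - 0) < \<epsilon>" by blast
  qed
  then show "l \<in> c0_space" by (simp add: c0_space_def)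
qed auto

lemma banach_subspace_closed:
  fixes V :: "'x::banach set"
  assumes sub: "subspace V" and cl: "closed V"
  shows "banach_subspace V norm"
proof
  fix \<sigma> :: "nat \<Rightarrow> 'x" assume \<sigma>: "\<And>n. \<sigma> n \<in> V"
    and Cau: "\<And>\<epsilon>. \<epsilon> > 0 \<Longrightarrow> \<exists>N. \<forall>m\<ge>N. \<forall>n\<ge>N. norm (\<sigma> m - \<sigma> n) < \<epsilon>"
  have "Cauchy \<sigma>" unfolding Cauchy_def dist_norm using Cau by blast
  then obtain l where l: "\<sigma> \<longlonglongrightarrow> l" using Cauchy_convergent convergent_def by blast
  then have "l \<in> V" using cl \<sigma> closed_sequentially by blast
  moreover have "(\<lambda>n. norm (\<sigma> n - l)) \<longlonglongrightarrow> 0" using l by (simp add: LIM_zero_iff tendsto_norm_zero)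
  ultimately show "\<exists>l\<in>V. (\<lambda>n. norm (\<sigma> n - l)) \<longlonglongrightarrow> 0" by blast
qed (use sub in \<open>auto simp: norm_triangle_ineq\<close>)

lemma closed_kernel:
  fixes q :: "'x::real_normed_vector \<Rightarrow> 'w::real_vector"
  assumes q: "bounded_operator UNIV norm W nW q" and W: "banach_subspace W nW"
  shows "subspace {x. q x = 0}" "closed {x. q x = 0}"
proof -
  interpret W: banach_subspace W nW by fact
  note q_in = bounded_operatorD(1)[OF q, simplified] and q_add = bounded_operatorD(2)[OF q, simplified]
    and q_scale = bounded_operatorD(3)[OF q, simplified]
  obtain B where B: "\<And>x. nW (q x) \<le> B * norm x" using bounded_operatorD(4)[OF q] by blast
  have q0: "q 0 = 0" using q_scale[of 0 0] by simp
  show "subspace {x. q x = 0}" by (auto simp: subspace_def q0 q_add q_scale)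
  show "closed {x. q x = 0}"
    unfolding closed_sequential_limits
  proof (intro allI impI)
    fix \<sigma> l assume \<sigma>: "(\<forall>n. \<sigma> n \<in> {x. q x = 0}) \<and> \<sigma> \<longlonglongrightarrow> l"
    have "nW (q l) \<le> 0"
    proof (rule LIMSEQ_le_const)
      have "(\<lambda>n. norm (l - \<sigma> n)) \<longlonglongrightarrow> norm (l - l)" using \<sigma> by (intro tendsto_intros) auto
      then show "(\<lambda>n. B * norm (l - \<sigma> n)) \<longlonglongrightarrow> 0" using tendsto_mult_right_zero by simp
      have "q l = q (l - \<sigma> n)" for n using q_add[of "l - \<sigma> n" "\<sigma> n"] \<sigma> by simp
      then show "\<exists>N. \<forall>n\<ge>N. nW (q l) \<le> B * norm (l - \<sigma> n)" using B by metis
    qed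
    then show "l \<in> {x. q x = 0}" using W.definite[OF q_in] W.nonneg[OF q_in] by (simp add: order_antisym)
  qed
qed

text \<open>
  Every bounded operator from \<open>C(K)\<close> into \<open>l\<^sub>\<infinity> / c\<^sub>0\<close> lifts to \<open>l\<^sub>\<infinity>\<close>.
\<close>

definition c0_lifting_property :: "'a topology \<Rightarrow> bool" where
  "c0_lifting_property K \<longleftrightarrow> (\<forall>\<tau> c. almost_linear K \<tau> c \<longrightarrow>
     (\<exists>E d. (\<forall>g\<in>C_space K. \<forall>h\<in>C_space K. \<forall>n. E (g + h) n = E g n + E h n) \<and>
            (\<forall>a. \<forall>g\<in>C_space K. \<forall>n. E (a *\<^sub>R g) n = a * E g n) \<and>
            (\<forall>g\<in>C_space K. \<forall>n. \<bar>E g n\<bar> \<le> d * sup_norm (topspace K) g) \<and>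
            (\<forall>g\<in>C_space K. (\<lambda>n. E g n - \<tau> g n) \<longlonglongrightarrow> 0)))"

text \<open>
  The coordinate functionals of \<open>c\<^sub>0\<close> extend to functionals \<open>F n\<close> on \<open>X\<close> of bounded norm, so they
  form an operator \<open>X \<rightarrow> l\<^sub>\<infinity>\<close> that is the identity on \<open>c\<^sub>0\<close>. Modulo \<open>c\<^sub>0\<close> it factors through
  \<open>q\<close> and gives an operator \<open>C(K) \<rightarrow> l\<^sub>\<infinity> / c\<^sub>0\<close>. If \<open>E\<close> lifts the latter, then \<open>F - E q\<close> maps
  \<open>X\<close> into \<open>c\<^sub>0\<close>, and it still is the identity on \<open>c\<^sub>0\<close> because \<open>q\<close> vanishes there.
\<close>

theorem trivial_twisted_sum_if_lifting:
  fixes i :: "(nat \<Rightarrow> real) \<Rightarrow> 'x::banach"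
  assumes K: "compact_space K" and lift: "c0_lifting_property K"
    and tw: "twisted_sum c0_space (sup_norm UNIV) (C_space K) (sup_norm (topspace K)) i q"
  shows "trivial_twisted_sum c0_space (sup_norm UNIV) i"
proof -
  let ?C = "C_space K" and ?N = "sup_norm (topspace K)" and ?Z = "sup_norm (UNIV :: nat set)"
  have i: "bounded_operator c0_space ?Z UNIV norm i" and q: "bounded_operator UNIV norm ?C ?N q"
    and inj: "inj_on i c0_space" and exact: "i ` c0_space = {x. q x = 0}" and onto: "range q = ?C"
    using tw by (auto simp: twisted_sum_def)
  interpret C: banach_subspace ?C ?N by (rule banach_subspace_C_space[OF K])
  interpret Z: banach_subspace c0_space ?Z by (rule banach_subspace_c0)
  have X: "banach_subspace (UNIV :: 'x set) norm" by (intro banach_subspace_closed) auto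
  have ker: "subspace {x. q x = 0}" "closed {x. q x = 0}"
    using closed_kernel[OF q C.banach_subspace_axioms] .
  note q_in = bounded_operatorD(1)[OF q, simplified] and q_add = bounded_operatorD(2)[OF q, simplified]
    and q_scale = bounded_operatorD(3)[OF q, simplified]
  note i_add = bounded_operatorD(2)[OF i] and i_scale = bounded_operatorD(3)[OF i]
  have q_diff: "q (x - y) = q x - q y" for x y using q_add[of "x - y" y] by (simp add: algebra_simps)
  obtain B0 where B0: "\<And>x. ?N (q x) \<le> B0 * norm x" using bounded_operatorD(4)[OF q] by blast

  \<comment> \<open>The inverse \<open>j\<close> of \<open>i\<close> is bounded, so its coordinates are bounded functionals on the kernel of \<open>q\<close>.\<close>
  have "bounded_operator c0_space ?Z {x. q x = 0} norm i"
    using i exact by (auto simp: bounded_operator_def)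
  then obtain C1 where C1: "\<And>w. q w = 0 \<Longrightarrow> \<exists>z\<in>c0_space. i z = w \<and> ?Z z \<le> C1 * norm w"
    using open_mapping[OF Z.banach_subspace_axioms banach_subspace_closed[OF ker] _ exact] by auto
  then obtain j where j: "\<And>w. q w = 0 \<Longrightarrow> j w \<in> c0_space" "\<And>w. q w = 0 \<Longrightarrow> i (j w) = w"
    "\<And>w. q w = 0 \<Longrightarrow> ?Z (j w) \<le> C1 * norm w" by metis
  have ji: "j (i z) = z" if "z \<in> c0_space" for z
    using inj_onD[OF inj, of "j (i z)" z] j[of "i z"] exact that by blast
  define C where "C = max C1 0"
  have C0: "C \<ge> 0" by (simp add: C_def)
  have j_bound: "\<bar>j w n\<bar> \<le> C * norm w" if "q w = 0" for w n
  proof -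
    have "\<bar>j w n\<bar> \<le> ?Z (j w)"
      using c0_bdd[OF j(1)[OF that]] by (intro sup_norm_upper) auto
    also have "\<dots> \<le> C * norm w"
      using j(3)[OF that] mult_right_mono[of C1 C "norm w"] by (simp add: C_def)
    finally show ?thesis .
  qed
  have j_add: "j (v + w) = j v + j w" if "q v = 0" "q w = 0" for v w
    using ji[OF Z.add_in[OF j(1) j(1), OF that]] i_add[OF j(1) j(1), OF that] j(2)[OF that(1)] j(2)[OF that(2)] by simp
  have j_scale: "j (a *\<^sub>R w) = a *\<^sub>R j w" if "q w = 0" for a w
    using ji[OF Z.scale_in[OF j(1), OF that], of a] i_scale[OF j(1)[OF that], of a] j(2)[OF that] by simp
  have "\<exists>F. linear F \<and> (\<forall>x. \<bar>F x\<bar> \<le> C * norm x) \<and> (\<forall>w\<in>{x. q x = 0}. F w = j w n)" for n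
    by (intro Hahn_Banach ker) (auto simp: j_add j_scale j_bound C0 scaleR_fun_def)
  then have "\<exists>F. \<forall>n. linear (F n) \<and> (\<forall>x. \<bar>F n x\<bar> \<le> C * norm x) \<and> (\<forall>w\<in>{x. q x = 0}. F n w = j w n)"
    by (intro choice allI)
  then obtain F where F: "\<And>n. linear (F n)" "\<And>n x. \<bar>F n x\<bar> \<le> C * norm x" "\<And>n w. q w = 0 \<Longrightarrow> F n w = j w n"
    by auto
  have F_null: "(\<lambda>n. F n w) \<longlonglongrightarrow> 0" if "q w = 0" for w
    using F(3)[OF that] j(1)[OF that] by (simp add: c0_space_def)
  \<comment> \<open>A bounded but possibly nonlinear right inverse \<open>\<sigma>\<close> of \<open>q\<close>; its failure to be linear lies in the
    kernel of \<open>q\<close>, where the \<open>F n\<close> are coordinates of null sequences.\<close>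
  obtain C2 where "\<forall>g\<in>?C. \<exists>x\<in>UNIV. q x = g \<and> norm x \<le> C2 * ?N g"
    using open_mapping[OF X C.banach_subspace_axioms q onto] by blast
  then obtain \<sigma> where \<sigma>: "\<And>g. g \<in> ?C \<Longrightarrow> q (\<sigma> g) = g" "\<And>g. g \<in> ?C \<Longrightarrow> norm (\<sigma> g) \<le> C2 * ?N g" by metis
  define \<tau> where "\<tau> g n = F n (\<sigma> g)" for g n
  have "almost_linear K \<tau> (C * max C2 0)"
  proof
    fix g n assume g: "g \<in> ?C"
    have "norm (\<sigma> g) \<le> max C2 0 * ?N g"
      using \<sigma>(2)[OF g] mult_right_mono[OF _ C.nonneg[OF g], of C2 "max C2 0"] by simp
    then show "\<bar>\<tau> g n\<bar> \<le> C * max C2 0 * ?N g"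
      using F(2)[of n "\<sigma> g"] mult_left_mono[OF _ C0] unfolding \<tau>_def by (metis mult.assoc order_trans)
  next
    fix g h assume gh: "g \<in> ?C" "h \<in> ?C"
    have "q (\<sigma> (g + h) - (\<sigma> g + \<sigma> h)) = 0" using gh C.add_in by (simp add: q_diff q_add \<sigma>)
    from F_null[OF this] show "(\<lambda>n. \<tau> (g + h) n - (\<tau> g n + \<tau> h n)) \<longlonglongrightarrow> 0"
      using F(1) by (simp add: \<tau>_def linear_diff linear_add)
  next
    fix g a assume g: "g \<in> ?C"
    have "q (\<sigma> (a *\<^sub>R g) - a *\<^sub>R \<sigma> g) = 0" using g C.scale_in by (simp add: q_diff q_scale \<sigma>)
    from F_null[OF this] show "(\<lambda>n. \<tau> (a *\<^sub>R g) n - a * \<tau> g n) \<longlonglongrightarrow> 0"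
      using F(1) by (simp add: \<tau>_def linear_diff linear_cmul)
  qed (use K C0 in auto)
  from lift[unfolded c0_lifting_property_def, THEN spec, THEN spec, THEN mp, OF this]
  obtain E d where E: "\<forall>g\<in>?C. \<forall>h\<in>?C. \<forall>n. E (g + h) n = E g n + E h n"
    "\<forall>a. \<forall>g\<in>?C. \<forall>n. E (a *\<^sub>R g) n = a * E g n"
    "\<forall>g\<in>?C. \<forall>n. \<bar>E g n\<bar> \<le> d * ?N g" "\<forall>g\<in>?C. (\<lambda>n. E g n - \<tau> g n) \<longlonglongrightarrow> 0"
    by (elim exE conjE) (rule that)
  note E_add = E(1)[rule_format] and E_scale = E(2)[rule_format] and E_bound = E(3)[rule_format]
    and E_lim = E(4)[rule_format]
  define r where "r x = (\<lambda>n. F n x - E (q x) n)" for x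
  have "bounded_operator UNIV norm c0_space ?Z r"
    unfolding bounded_operator_def
  proof (intro conjI ballI allI)
    fix x
    have "q (x - \<sigma> (q x)) = 0" by (simp add: q_diff \<sigma> q_in)
    from tendsto_diff[OF F_null[OF this] E_lim[OF q_in, of x]] show "r x \<in> c0_space"
      using F(1) by (simp add: c0_space_def r_def \<tau>_def linear_diff)
    fix y show "r (x + y) = r x + r y"
      using F(1) by (simp add: r_def fun_eq_iff linear_add q_add E_add q_in)
  next
    fix c x show "r (c *\<^sub>R x) = c *\<^sub>R r x"
    proof
      fix n have "r (c *\<^sub>R x) n = c * F n x - c * E (q x) n"
        using F(1) by (simp add: r_def linear_cmul q_scale E_scale q_in)
      then show "r (c *\<^sub>R x) n = (c *\<^sub>R r x) n" by (simp add: r_def scaleR_fun_def algebra_simps)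
    qed
  next
    show "\<exists>B. \<forall>x\<in>UNIV. ?Z (r x) \<le> B * norm x"
    proof (intro exI ballI)
      fix x :: 'x
      show "?Z (r x) \<le> (C + \<bar>d\<bar> * \<bar>B0\<bar>) * norm x"
      proof (rule sup_norm_least)
        fix n
        have "\<bar>E (q x) n\<bar> \<le> \<bar>d\<bar> * ?N (q x)"
          using E_bound[OF q_in, of x n] mult_right_mono[OF abs_ge_self C.nonneg[OF q_in], of d x] by linarith
        also have "?N (q x) \<le> \<bar>B0\<bar> * norm x"
          using B0[of x] mult_right_mono[OF abs_ge_self norm_ge_zero, of B0 x] by linarith
        finally have "\<bar>E (q x) n\<bar> \<le> \<bar>d\<bar> * (\<bar>B0\<bar> * norm x)" by (simp add: mult_left_mono)
        then show "\<bar>r x n\<bar> \<le> (C + \<bar>d\<bar> * \<bar>B0\<bar>) * norm x"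
          using F(2)[of n x] unfolding r_def by (simp add: distrib_right mult.assoc)
      qed (simp add: C0)
    qed
  qed
  moreover have "r (i z) = z" if z: "z \<in> c0_space" for z
  proof -
    have qi: "q (i z) = 0" using z exact by blast
    have "E 0 n = 0" for n using E_scale[OF C.zero_in, of 0 n] by simp
    then show ?thesis using F(3)[OF qi] ji[OF z] qi by (simp add: r_def)
  qed
  ultimately show ?thesis unfolding trivial_twisted_sum_def by blast
qed

section \<open>Atomic signed measures\<close>

lemma infsum_sums_disjoint:
  fixes f :: "'a \<Rightarrow> real" and B :: "nat \<Rightarrow> 'a set"
  assumes f: "f summable_on \<Omega>" and B: "(\<Union>n. B n) \<subseteq> \<Omega>" "disjoint_family B"
  shows "(\<lambda>n. infsum f (B n)) sums infsum f (\<Union>n. B n)"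
proof -
  have inj: "inj_on snd (Sigma UNIV B)"
    using B(2) by (auto simp: inj_on_def disjoint_family_on_def)
  have img: "snd ` Sigma UNIV B = (\<Union>n. B n)" by force
  have "f summable_on (\<Union>n. B n)" using summable_on_subset_banach[OF f B(1)] .
  then have S: "(\<lambda>(n, x). f x) summable_on Sigma UNIV B"
    using summable_on_reindex[OF inj, of f] unfolding img by (simp add: comp_def case_prod_unfold)
  have "infsum (\<lambda>n. infsum f (B n)) UNIV = infsum f (\<Union>n. B n)"
    using infsum_Sigma'_banach[OF S] infsum_reindex[OF inj, of f] unfolding img
    by (simp add: comp_def case_prod_unfold)
  moreover have "(\<lambda>n. infsum f (B n)) summable_on UNIV"
    using summable_on_Sigma_banach[OF S] .
  ultimately show ?thesis by (metis has_sum_imp_sums has_sum_infsum)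
qed

lemma sum_infsum_disjoint:
  fixes f :: "'a \<Rightarrow> real"
  assumes f: "f summable_on \<Omega>" and P: "finite P" "disjoint P" "\<Union>P \<subseteq> \<Omega>"
  shows "(\<Sum>B\<in>P. infsum f B) = infsum f (\<Union>P)"
  using P
proof (induction P rule: finite_induct)
  case (insert B P)
  have "B \<inter> \<Union>P = {}" using insert by (auto simp: disjoint_def)
  moreover have "f summable_on B" "f summable_on \<Union>P"
    using insert.prems f by (auto intro: summable_on_subset_banach)
  moreover have "disjoint P" using insert.prems by (auto simp: disjoint_def)
  ultimately show ?case using insert by (simp add: infsum_Un_disjoint)
qed simp

lemma infsum_remainder_small:
  fixes f :: "'a \<Rightarrow> real"
  assumes f: "f summable_on \<Omega>" and \<epsilon>: "\<epsilon> > 0"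
  shows "\<exists>C\<subseteq>\<Omega>. finite C \<and> \<bar>infsum f (\<Omega> - C)\<bar> < \<epsilon>"
proof -
  have "(sum f \<longlongrightarrow> infsum f \<Omega>) (finite_subsets_at_top \<Omega>)"
    using f has_sum_infsum has_sum_def by blast
  then have "\<forall>\<^sub>F C in finite_subsets_at_top \<Omega>. dist (sum f C) (infsum f \<Omega>) < \<epsilon>"
    using \<epsilon> by (rule tendstoD)
  then obtain C where C: "finite C" "C \<subseteq> \<Omega>" "dist (sum f C) (infsum f \<Omega>) < \<epsilon>"
    unfolding eventually_finite_subsets_at_top by blast
  have "infsum f (\<Omega> - C) = infsum f \<Omega> - infsum f C"
    using f C by (intro infsum_Diff) auto
  then show ?thesis using C by (intro exI[of _ C]) (auto simp: dist_real_def)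
qed

text \<open>
  Spaces in which every subset is Borel. This is the case for scattered spaces of finite height.
\<close>

locale discrete_borel =
  fixes K :: "'a topology"
  assumes borel: "borel_sets K = Pow (topspace K)"
begin

lemma positive_part_space [simp]: "space (positive_part K \<nu>) = topspace K"
  by (simp add: positive_part_def borel)

lemma positive_part_sets [simp]: "sets (positive_part K \<nu>) = Pow (topspace K)"
  by (simp add: positive_part_def borel sigma_algebra.sigma_sets_eq[OF sigma_algebra_Pow])

lemma negative_part_space [simp]: "space (negative_part K \<nu>) = topspace K"
  by (simp add: negative_part_def borel)

lemma negative_part_sets [simp]: "sets (negative_part K \<nu>) = Pow (topspace K)"
  by (simp add: negative_part_def borel sigma_algebra.sigma_sets_eq[OF sigma_algebra_Pow])

lemma integrable_bounded:
  assumes M: "space M = topspace K" "sets M = Pow (topspace K)" "emeasure M (topspace K) \<le> ennreal m"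
    and g: "\<And>x. x \<in> topspace K \<Longrightarrow> \<bar>g x\<bar> \<le> b" and "m \<ge> 0" and "b \<ge> 0"
  shows "integrable M g" "\<bar>\<integral>x. g x \<partial>M\<bar> \<le> b * m"
proof -
  interpret finite_measure M
    using M by (intro finite_measureI) (auto simp: top_unique)
  have meas: "g \<in> borel_measurable M" using M by (auto simp: measurable_def)
  show int: "integrable M g"
    using g M by (intro integrable_const_bound[of _ b] meas) auto
  have "measure M (space M) \<le> m"
    using M \<open>m \<ge> 0\<close> by (simp add: emeasure_eq_measure)
  moreover have "\<bar>\<integral>x. g x \<partial>M\<bar> \<le> (\<integral>x. b \<partial>M)"
    using g M int by (intro order_trans[OF integral_abs_bound] integral_mono) (auto intro!: integrable_abs)
  ultimately show "\<bar>\<integral>x. g x \<partial>M\<bar> \<le> b * m"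
    using \<open>b \<ge> 0\<close> mult_left_mono[of "measure M (space M)" m b] by (simp add: mult.commute)
qed

text \<open>
  The trivial partition is one of those that define the variation.
\<close>

lemma radon_total_bound:
  assumes "\<nu> \<in> radon_measures K"
  shows "\<bar>\<nu> (topspace K)\<bar> \<le> variation K \<nu> (topspace K)"
proof -
  have "\<bar>\<nu> (topspace K)\<bar> \<in> partition_sums K \<nu> (topspace K)"
    unfolding partition_sums_def using borel
    by (intro CollectI exI[of _ "{topspace K}"]) (auto simp: disjoint_def)
  then show ?thesis
    using assms unfolding variation_def radon_measures_def by (intro cSup_upper) auto
qed

text \<open>
  By convention \<open>measure_of\<close> yields the zero measure when the given set function is not countably
  additive. An upper bound for the total mass holds in either case, and it is all that integrability
  and linearity of \<open>signed_integral\<close> depend on.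
\<close>

lemma
  assumes \<nu>: "\<nu> \<in> radon_measures K"
  shows positive_part_total: "emeasure (positive_part K \<nu>) (topspace K) \<le>
      ennreal ((variation K \<nu> (topspace K) + \<nu> (topspace K)) / 2)"
    and negative_part_total: "emeasure (negative_part K \<nu>) (topspace K) \<le>
      ennreal ((variation K \<nu> (topspace K) - \<nu> (topspace K)) / 2)"
  by (auto simp: positive_part_def negative_part_def emeasure_measure_of_conv)

lemma
  assumes K: "compact_space K" and \<nu>: "\<nu> \<in> radon_measures K" and g: "g \<in> C_space K"
  shows integrable_positive_part: "integrable (positive_part K \<nu>) g"
    and integrable_negative_part: "integrable (negative_part K \<nu>) g"
    and signed_integral_bound:
      "\<bar>signed_integral K \<nu> g\<bar> \<le> sup_norm (topspace K) g * variation K \<nu> (topspace K)"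
proof -
  let ?p = "(variation K \<nu> (topspace K) + \<nu> (topspace K)) / 2"
  let ?n = "(variation K \<nu> (topspace K) - \<nu> (topspace K)) / 2"
  have pn: "?p \<ge> 0" "?n \<ge> 0" using radon_total_bound[OF \<nu>] by auto
  have b: "\<bar>g x\<bar> \<le> sup_norm (topspace K) g" "sup_norm (topspace K) g \<ge> 0" for x
    using C_space_le_sup_norm[OF K g] sup_norm_nonneg[OF C_space_bdd[OF K g]] by auto
  show "integrable (positive_part K \<nu>) g" "integrable (negative_part K \<nu>) g"
    using integrable_bounded(1)[OF positive_part_space positive_part_sets positive_part_total[OF \<nu>] b(1) pn(1) b(2)]
      integrable_bounded(1)[OF negative_part_space negative_part_sets negative_part_total[OF \<nu>] b(1) pn(2) b(2)] .
  have "\<bar>signed_integral K \<nu> g\<bar> \<le> sup_norm (topspace K) g * ?p + sup_norm (topspace K) g * ?n"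
    using integrable_bounded(2)[where g = g, OF positive_part_space positive_part_sets positive_part_total[OF \<nu>] b(1) pn(1) b(2)]
      integrable_bounded(2)[where g = g, OF negative_part_space negative_part_sets negative_part_total[OF \<nu>] b(1) pn(2) b(2)]
    unfolding signed_integral_def by linarith
  also have "\<dots> = sup_norm (topspace K) g * variation K \<nu> (topspace K)"
    by (simp add: distrib_left[symmetric] field_simps)
  finally show "\<bar>signed_integral K \<nu> g\<bar> \<le> sup_norm (topspace K) g * variation K \<nu> (topspace K)" .
qed

lemma
  assumes K: "compact_space K" and \<nu>: "\<nu> \<in> radon_measures K" and g: "g \<in> C_space K"
  shows signed_integral_add: "h \<in> C_space K \<Longrightarrow> signed_integral K \<nu> (g + h) = signed_integral K \<nu> g + signed_integral K \<nu> h"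
    and signed_integral_scaleR: "signed_integral K \<nu> (a *\<^sub>R g) = a * signed_integral K \<nu> g"
  using integrable_positive_part[OF K \<nu>] integrable_negative_part[OF K \<nu>] g
  by (auto simp: signed_integral_def plus_fun_def scaleR_fun_def algebra_simps)

end

definition atomic_measure :: "'a topology \<Rightarrow> ('a \<Rightarrow> real) \<Rightarrow> 'a set \<Rightarrow> real" where
  "atomic_measure K w X = (if X \<subseteq> topspace K then infsum w X else 0)"

text \<open>
  The signed measure with point masses \<open>w\<close>. Its Hahn decomposition is given by the sign of \<open>w\<close>, so
  that a partition into two sets attains the variation.
\<close>

locale atomic = discrete_borel K for K :: "'a topology" +
  fixes w :: "'a \<Rightarrow> real"
  assumes abs_summable: "(\<lambda>x. \<bar>w x\<bar>) summable_on topspace K"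
begin

abbreviation "\<nu> \<equiv> atomic_measure K w"

lemma summable: "X \<subseteq> topspace K \<Longrightarrow> w summable_on X"
  "X \<subseteq> topspace K \<Longrightarrow> (\<lambda>x. \<bar>w x\<bar>) summable_on X"
  using abs_summable_summable[of w] abs_summable summable_on_subset_banach
  by (metis (no_types, lifting) real_norm_def summable_on_cong, metis)

text \<open>
  With \<open>a = 1\<close> and \<open>a = -1\<close> these are the positive and the negative part of \<open>w\<close>; treating both at once
  matches the densities in the definitions of \<open>positive_part\<close> and \<open>negative_part\<close>.
\<close>

lemma pos_summable: "X \<subseteq> topspace K \<Longrightarrow> (\<lambda>x. (\<bar>w x\<bar> + a * w x) / 2) summable_on X"
  using summable_on_cmult_right[OF summable_on_add[OF summable(2) summable_on_cmult_right[OF summable(1)]], of X "1/2" a] by simp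

lemma infsum_parts:
  assumes "X \<subseteq> topspace K"
  shows "infsum (\<lambda>x. (\<bar>w x\<bar> + a * w x) / 2) X = (infsum (\<lambda>x. \<bar>w x\<bar>) X + a * infsum w X) / 2"
proof -
  have "infsum (\<lambda>x. (1/2) * (\<bar>w x\<bar> + a * w x)) X = (1/2) * infsum (\<lambda>x. \<bar>w x\<bar> + a * w x) X"
    by (rule infsum_cmult_right')
  also have "infsum (\<lambda>x. \<bar>w x\<bar> + a * w x) X = infsum (\<lambda>x. \<bar>w x\<bar>) X + infsum (\<lambda>x. a * w x) X"
    using summable[OF assms] by (intro infsum_add summable_on_cmult_right)
  also have "infsum (\<lambda>x. a * w x) X = a * infsum w X" by (rule infsum_cmult_right')
  finally show ?thesis by simp
qed

lemma abs_infsum_le: "X \<subseteq> topspace K \<Longrightarrow> \<bar>infsum w X\<bar> \<le> infsum (\<lambda>x. \<bar>w x\<bar>) X"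
  using norm_infsum_bound[of w X] summable(2) by simp

lemma partition_sum_le:
  assumes "s \<in> partition_sums K \<nu> X" "X \<subseteq> topspace K"
  shows "s \<le> infsum (\<lambda>x. \<bar>w x\<bar>) X"
proof -
  obtain P where P: "finite P" "disjoint P" "\<Union>P = X" "s = (\<Sum>B\<in>P. \<bar>\<nu> B\<bar>)"
    using assms by (auto simp: partition_sums_def)
  have "s \<le> (\<Sum>B\<in>P. infsum (\<lambda>x. \<bar>w x\<bar>) B)"
    unfolding P(4) using P(3) assms(2)
    by (intro sum_mono) (auto simp: atomic_measure_def intro!: abs_infsum_le)
  also have "\<dots> = infsum (\<lambda>x. \<bar>w x\<bar>) X"
    using P assms(2) sum_infsum_disjoint[OF summable(2)[OF subset_refl], of P] by simp
  finally show ?thesis .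
qed

lemma variation_atomic:
  assumes X: "X \<subseteq> topspace K"
  shows "variation K \<nu> X = infsum (\<lambda>x. \<bar>w x\<bar>) X"
proof -
  define A where "A = {x \<in> X. w x \<ge> 0}"
  define B where "B = {x \<in> X. w x < 0}"
  have AB: "A \<inter> B = {}" "A \<union> B = X" "A \<subseteq> topspace K" "B \<subseteq> topspace K"
    using X by (auto simp: A_def B_def)
  have A: "\<bar>\<nu> A\<bar> = infsum (\<lambda>x. \<bar>w x\<bar>) A"
  proof -
    have "infsum w A = infsum (\<lambda>x. \<bar>w x\<bar>) A" by (intro infsum_cong) (auto simp: A_def)
    moreover have "infsum (\<lambda>x. \<bar>w x\<bar>) A \<ge> 0" by (intro infsum_nonneg) auto
    ultimately show ?thesis using AB by (simp add: atomic_measure_def)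
  qed
  have B: "\<bar>\<nu> B\<bar> = infsum (\<lambda>x. \<bar>w x\<bar>) B"
  proof -
    have "infsum (\<lambda>x. \<bar>w x\<bar>) B = infsum (\<lambda>x. - w x) B" by (intro infsum_cong) (auto simp: B_def)
    then have "infsum w B = - infsum (\<lambda>x. \<bar>w x\<bar>) B" by (simp add: infsum_uminus)
    moreover have "infsum (\<lambda>x. \<bar>w x\<bar>) B \<ge> 0" by (intro infsum_nonneg) auto
    ultimately show ?thesis using AB by (simp add: atomic_measure_def)
  qed
  have "(\<Sum>C\<in>{A, B}. \<bar>\<nu> C\<bar>) = \<bar>\<nu> A\<bar> + \<bar>\<nu> B\<bar>"
    using AB by (cases "A = B") (auto simp: atomic_measure_def)
  also have "\<dots> = infsum (\<lambda>x. \<bar>w x\<bar>) X"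
    unfolding A B using AB summable(2) infsum_Un_disjoint[of "\<lambda>x. \<bar>w x\<bar>" A B] by simp
  finally have "infsum (\<lambda>x. \<bar>w x\<bar>) X \<in> partition_sums K \<nu> X"
    unfolding partition_sums_def using AB borel
    by (intro CollectI exI[of _ "{A, B}"]) (auto simp: disjoint_def)
  then show ?thesis
    unfolding variation_def using partition_sum_le[OF _ X] by (intro cSup_eq_maximum) auto
qed

text \<open>
  Inner regularity holds with finite sets: they exhaust the mass of any set up to \<open>\<epsilon>\<close>.
\<close>

lemma radon_atomic: "\<nu> \<in> radon_measures K"
  unfolding radon_measures_def
proof (intro CollectI conjI allI impI ballI)
  show "\<nu> X = 0" if "X \<notin> borel_sets K" for X using that by (auto simp: atomic_measure_def borel)
  show "(\<lambda>n. \<nu> (B n)) sums \<nu> (\<Union>n. B n)" if "range B \<subseteq> borel_sets K \<and> disjoint_family B" for B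
  proof -
    have B: "B n \<subseteq> topspace K" for n using that borel by auto
    then have "\<nu> (B n) = infsum w (B n)" for n by (simp add: atomic_measure_def)
    moreover have "\<nu> (\<Union>n. B n) = infsum w (\<Union>n. B n)" using B by (auto simp: atomic_measure_def)
    ultimately show ?thesis
      using infsum_sums_disjoint[OF summable(1)[OF subset_refl], of B] B that by auto
  qed
  show "bdd_above (partition_sums K \<nu> (topspace K))"
    using partition_sum_le by (intro bdd_aboveI[of _ "infsum (\<lambda>x. \<bar>w x\<bar>) (topspace K)"]) auto
  show "\<exists>C. compactin K C \<and> C \<subseteq> X \<and> variation K \<nu> (X - C) < \<epsilon>" if X: "X \<in> borel_sets K" and \<epsilon>: "\<epsilon> > 0" for X \<epsilon>
  proof -
    have X: "X \<subseteq> topspace K" using X borel by auto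
    obtain C where C: "C \<subseteq> X" "finite C" "\<bar>infsum (\<lambda>x. \<bar>w x\<bar>) (X - C)\<bar> < \<epsilon>"
      using infsum_remainder_small[OF summable(2)[OF X] \<epsilon>] by blast
    moreover have "variation K \<nu> (X - C) = infsum (\<lambda>x. \<bar>w x\<bar>) (X - C)"
      using X by (intro variation_atomic) auto
    ultimately show ?thesis using X by (intro exI[of _ C]) (auto intro: finite_imp_compactin)
  qed
qed

lemma emeasure_part:
  assumes a: "\<bar>a\<bar> = (1::real)" and X: "X \<subseteq> topspace K"
  shows "emeasure (measure_of (topspace K) (borel_sets K) (\<lambda>X. ennreal ((variation K \<nu> X + a * \<nu> X) / 2))) X =
    ennreal ((variation K \<nu> X + a * \<nu> X) / 2)"
proof (rule emeasure_measure_of_sigma)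
  let ?f = "\<lambda>x. (\<bar>w x\<bar> + a * w x) / 2" and ?\<mu> = "\<lambda>X. ennreal ((variation K \<nu> X + a * \<nu> X) / 2)"
  have eq: "?\<mu> Y = ennreal (infsum ?f Y)" if "Y \<subseteq> topspace K" for Y
    using that by (simp add: infsum_parts variation_atomic atomic_measure_def)
  have nn: "?f x \<ge> 0" for x using a by (auto simp: abs_if split: if_splits)
  show "sigma_algebra (topspace K) (borel_sets K)" unfolding borel by (rule sigma_algebra_Pow)
  show "positive (borel_sets K) ?\<mu>" by (simp add: positive_def eq)
  show "countably_additive (borel_sets K) ?\<mu>"
  proof (rule countably_additiveI)
    fix B :: "nat \<Rightarrow> 'a set" assume B: "range B \<subseteq> borel_sets K" "disjoint_family B"
    then have BK: "B n \<subseteq> topspace K" "(\<Union>n. B n) \<subseteq> topspace K" for n using borel by auto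
    have "(\<lambda>n. infsum ?f (B n)) sums infsum ?f (\<Union>n. B n)"
      using infsum_sums_disjoint[OF pos_summable[OF subset_refl] BK(2) B(2)] .
    then have "(\<lambda>n. ennreal (infsum ?f (B n))) sums ennreal (infsum ?f (\<Union>n. B n))"
      using nn by (subst sums_ennreal) (auto intro: infsum_nonneg)
    then show "(\<Sum>n. ?\<mu> (B n)) = ?\<mu> (\<Union>n. B n)"
      using eq BK by (simp add: sums_iff)
  qed
  show "X \<in> borel_sets K" using X borel by auto
qed

lemma signed_integral_indicator:
  assumes X: "X \<subseteq> topspace K"
  shows "signed_integral K \<nu> (indicator X) = infsum w X"
proof -
  have nn: "(variation K \<nu> X + \<nu> X) / 2 \<ge> 0" "(variation K \<nu> X - \<nu> X) / 2 \<ge> 0"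
    using abs_infsum_le[OF X] X by (auto simp: variation_atomic atomic_measure_def)
  have "measure (positive_part K \<nu>) X = (variation K \<nu> X + \<nu> X) / 2"
    using emeasure_part[of 1, OF _ X] nn by (simp add: measure_def positive_part_def)
  moreover have "measure (negative_part K \<nu>) X = (variation K \<nu> X - \<nu> X) / 2"
    using emeasure_part[of "-1", OF _ X] nn by (simp add: measure_def negative_part_def)
  moreover have "X \<inter> topspace K = X" using X by auto
  ultimately show ?thesis
    using X by (simp add: signed_integral_def atomic_measure_def field_simps)
qed

end

section \<open>The Stone space of an almost disjoint family\<close>

text \<open>
  Equality with a finite union of members of \<open>\<B>\<close> up to finitely many points.
\<close>

definition almost_union :: "nat set set \<Rightarrow> nat set \<Rightarrow> bool" where
  "almost_union \<B> X \<longleftrightarrow> (\<exists>F\<subseteq>\<B>. finite F \<and> finite (X - \<Union>F) \<and> finite (\<Union>F - X))"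

definition almost_algebra :: "nat set set \<Rightarrow> nat set set" where
  "almost_algebra \<B> = {X. almost_union \<B> X \<or> almost_union \<B> (- X)}"

lemma almost_disjointD: "almost_disjoint \<B> \<Longrightarrow> A \<in> \<B> \<Longrightarrow> B \<in> \<B> \<Longrightarrow> A \<noteq> B \<Longrightarrow> finite (A \<inter> B)"
  by (simp add: almost_disjoint_def)

lemma almost_union_finite: "finite X \<Longrightarrow> almost_union \<B> X"
  unfolding almost_union_def by (intro exI[of _ "{}"]) auto

lemma almost_union_member: "B \<in> \<B> \<Longrightarrow> almost_union \<B> B"
  unfolding almost_union_def by (intro exI[of _ "{B}"]) auto

lemma finite_overlap:
  assumes "almost_disjoint \<B>" "finite F" "finite G" "F \<subseteq> \<B>" "G \<subseteq> \<B>"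
  shows "finite (\<Union>F \<inter> \<Union>G - \<Union>(F \<inter> G))"
proof -
  have "\<Union>F \<inter> \<Union>G - \<Union>(F \<inter> G) \<subseteq> (\<Union>A\<in>F. \<Union>B\<in>G - {A}. A \<inter> B)" by auto
  moreover have "finite (\<Union>A\<in>F. \<Union>B\<in>G - {A}. A \<inter> B)"
    using assms by (intro finite_UN_I) (auto simp: almost_disjoint_def)
  ultimately show ?thesis by (rule finite_subset)
qed

lemma almost_union_Un:
  assumes "almost_union \<B> X" "almost_union \<B> Y"
  shows "almost_union \<B> (X \<union> Y)"
proof -
  obtain F G where "F \<subseteq> \<B>" "finite F" "finite (X - \<Union>F)" "finite (\<Union>F - X)"
    "G \<subseteq> \<B>" "finite G" "finite (Y - \<Union>G)" "finite (\<Union>G - Y)"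
    using assms unfolding almost_union_def by blast
  moreover have "X \<union> Y - \<Union>(F \<union> G) \<subseteq> (X - \<Union>F) \<union> (Y - \<Union>G)"
    "\<Union>(F \<union> G) - (X \<union> Y) \<subseteq> (\<Union>F - X) \<union> (\<Union>G - Y)" by auto
  ultimately show ?thesis
    unfolding almost_union_def by (intro exI[of _ "F \<union> G"]) (auto intro: finite_subset)
qed

lemma almost_union_Int:
  assumes ad: "almost_disjoint \<B>" and "almost_union \<B> X" "almost_union \<B> Y"
  shows "almost_union \<B> (X \<inter> Y)"
proof -
  obtain F G where FG: "F \<subseteq> \<B>" "finite F" "finite (X - \<Union>F)" "finite (\<Union>F - X)"
    "G \<subseteq> \<B>" "finite G" "finite (Y - \<Union>G)" "finite (\<Union>G - Y)"
    using assms unfolding almost_union_def by blast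
  have "X \<inter> Y - \<Union>(F \<inter> G) \<subseteq> (X - \<Union>F) \<union> (Y - \<Union>G) \<union> (\<Union>F \<inter> \<Union>G - \<Union>(F \<inter> G))"
    "\<Union>(F \<inter> G) - X \<inter> Y \<subseteq> (\<Union>F - X) \<union> (\<Union>G - Y)" by auto
  then have "finite (X \<inter> Y - \<Union>(F \<inter> G))" "finite (\<Union>(F \<inter> G) - X \<inter> Y)"
    using FG finite_overlap[OF ad] by (metis finite_UnI finite_subset)+
  then show ?thesis
    using FG unfolding almost_union_def by (intro exI[of _ "F \<inter> G"]) auto
qed

lemma almost_union_Diff:
  assumes ad: "almost_disjoint \<B>" and "almost_union \<B> X" "almost_union \<B> Y"
  shows "almost_union \<B> (X - Y)"
proof -
  obtain F G where FG: "F \<subseteq> \<B>" "finite F" "finite (X - \<Union>F)" "finite (\<Union>F - X)"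
    "G \<subseteq> \<B>" "finite G" "finite (Y - \<Union>G)" "finite (\<Union>G - Y)"
    using assms unfolding almost_union_def by blast
  have "finite (\<Union>(F - G) \<inter> \<Union>G - \<Union>((F - G) \<inter> G))"
    using FG by (intro finite_overlap[OF ad]) auto
  moreover have "(F - G) \<inter> G = {}" by auto
  ultimately have 1: "finite (\<Union>(F - G) \<inter> \<Union>G)" by simp
  have "X - Y - \<Union>(F - G) \<subseteq> (X - \<Union>F) \<union> (\<Union>G - Y)"
    "\<Union>(F - G) - (X - Y) \<subseteq> (\<Union>F - X) \<union> (Y - \<Union>G) \<union> (\<Union>(F - G) \<inter> \<Union>G)" by auto
  then have "finite (X - Y - \<Union>(F - G))" "finite (\<Union>(F - G) - (X - Y))"
    using FG 1 by (metis finite_UnI finite_subset)+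
  then show ?thesis
    using FG unfolding almost_union_def by (intro exI[of _ "F - G"]) auto
qed

lemma algebra_almost_algebra:
  assumes ad: "almost_disjoint \<B>"
  shows "algebra UNIV (almost_algebra \<B>)"
  unfolding algebra_iff_Un
proof (intro conjI ballI)
  show "{} \<in> almost_algebra \<B>"
    by (auto simp: almost_algebra_def almost_union_finite)
  fix X assume X: "X \<in> almost_algebra \<B>"
  then show "UNIV - X \<in> almost_algebra \<B>"
    by (auto simp: almost_algebra_def Compl_eq_Diff_UNIV double_diff)
  fix Y assume Y: "Y \<in> almost_algebra \<B>"
  have "- (X \<union> Y) = - Y - X" "- (X \<union> Y) = - X - Y" "- (X \<union> Y) = - X \<inter> - Y" by auto
  then show "X \<union> Y \<in> almost_algebra \<B>"
    using X Y almost_union_Un[of \<B> X Y] almost_union_Diff[OF ad, of "- Y" X]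
      almost_union_Diff[OF ad, of "- X" Y] almost_union_Int[OF ad, of "- X" "- Y"]
    unfolding almost_algebra_def by (elim CollectE disjE) (simp_all only: mem_Collect_eq simp_thms)
qed auto

text \<open>
  By almost disjointness the sets that are almost finite unions of members of \<open>\<B>\<close> form a ring
  of sets; with the complements they form the generated algebra.
\<close>

lemma generated_algebra_eq_almost_algebra:
  assumes ad: "almost_disjoint \<B>" and sub: "\<B> \<subseteq> \<A>" and sup: "\<A> \<subseteq> almost_algebra \<B>"
  shows "generated_algebra UNIV (\<A> \<union> {F. finite F}) = almost_algebra \<B>"
  unfolding generated_algebra_def
proof (rule hull_unique)
  show "\<A> \<union> {F. finite F} \<subseteq> almost_algebra \<B>"
    using sup by (auto simp: almost_algebra_def almost_union_finite)
  show "algebra UNIV (almost_algebra \<B>)" by (rule algebra_almost_algebra[OF ad])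
  fix T :: "nat set set" assume T: "\<A> \<union> {F. finite F} \<subseteq> T" "algebra UNIV T"
  interpret algebra UNIV T by (rule T(2))
  have small: "X \<in> T" if X: "almost_union \<B> X" for X
  proof -
    obtain F where F: "F \<subseteq> \<B>" "finite F" "finite (X - \<Union>F)" "finite (\<Union>F - X)"
      using X by (auto simp: almost_union_def)
    then have "\<Union>F \<in> T" using sub T(1) by (intro finite_Union) auto
    moreover have "X - \<Union>F \<in> T" "\<Union>F - X \<in> T" using F T(1) by auto
    ultimately have "(\<Union>F \<union> (X - \<Union>F)) - (\<Union>F - X) \<in> T" by blast
    also have "(\<Union>F \<union> (X - \<Union>F)) - (\<Union>F - X) = X" by auto
    finally show ?thesis .
  qed
  show "almost_algebra \<B> \<subseteq> T"
  proof
    fix X assume "X \<in> almost_algebra \<B>"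
    then consider "almost_union \<B> X" | "almost_union \<B> (- X)" by (auto simp: almost_algebra_def)
    then show "X \<in> T"
    proof cases
      case 2
      then have "UNIV - (- X) \<in> T" using small by blast
      then show ?thesis by (simp add: Compl_eq_Diff_UNIV[symmetric])
    qed (rule small)
  qed
qed

text \<open>
  Finite members of \<open>\<A>\<close> add nothing to the algebra. If finitely many infinite members cover all but
  finitely many points, then these are all the infinite members, since a further one would have
  to meet one of them in an infinite set. Any one of them is then almost the complement of the union
  of the others and can be dropped from the generators, and the others no longer cover. The
  non-covering condition is what provides the point at infinity of the Stone space.
\<close>

lemma exists_non_covering_generators:
  fixes \<A> :: "nat set set"
  assumes ad: "almost_disjoint \<A>"
  shows "\<exists>\<B>\<subseteq>\<A>. (\<forall>B\<in>\<B>. infinite B) \<and> (\<forall>F\<subseteq>\<B>. finite F \<longrightarrow> infinite (- \<Union>F)) \<and>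
           generated_algebra UNIV (\<A> \<union> {F. finite F}) = almost_algebra \<B>"
proof -
  define \<A>' where "\<A>' = {A \<in> \<A>. infinite A}"
  have ad': "almost_disjoint \<C>" if "\<C> \<subseteq> \<A>" for \<C>
    using ad that by (auto simp: almost_disjoint_def)
  have mem: "A \<in> almost_algebra \<C>" if "A \<in> \<A> - \<A>'" for A \<C>
    using that by (auto simp: \<A>'_def almost_algebra_def almost_union_finite)
  show ?thesis
  proof (cases "\<forall>F\<subseteq>\<A>'. finite F \<longrightarrow> infinite (- \<Union>F)")
    case True
    have "\<A> \<subseteq> almost_algebra \<A>'"
      using mem[of _ \<A>'] almost_union_member[of _ \<A>'] unfolding almost_algebra_def by blast
    then have "generated_algebra UNIV (\<A> \<union> {F. finite F}) = almost_algebra \<A>'"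
      by (intro generated_algebra_eq_almost_algebra ad') (auto simp: \<A>'_def)
    then show ?thesis using True by (intro exI[of _ \<A>']) (auto simp: \<A>'_def)
  next
    case False
    then obtain F where F: "F \<subseteq> \<A>'" "finite F" "finite (- \<Union>F)" by auto
    have "A \<in> F" if A: "A \<in> \<A>'" for A
    proof (rule ccontr)
      assume "A \<notin> F"
      then have "finite (- \<Union>F \<union> (\<Union>B\<in>F. A \<inter> B))"
        using F A by (intro finite_UnI finite_UN_I) (auto intro: almost_disjointD[OF ad] simp: \<A>'_def)
      moreover have "A \<subseteq> - \<Union>F \<union> (\<Union>B\<in>F. A \<inter> B)" by auto
      ultimately show False using A by (auto simp: \<A>'_def dest: finite_subset)
    qed
    with F have AF: "\<A>' = F" by auto
    have "F \<noteq> {}" using F(3) by auto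
    then obtain A0 where A0: "A0 \<in> F" by auto
    define \<B> where "\<B> = F - {A0}"
    have B: "\<B> \<subseteq> \<A>" using F by (auto simp: \<B>_def \<A>'_def)
    have fin: "finite (A0 \<inter> \<Union>\<B>)"
    proof -
      have "finite (\<Union>B\<in>\<B>. A0 \<inter> B)"
        using F A0 by (intro finite_UN_I almost_disjointD[OF ad]) (auto simp: \<B>_def \<A>'_def)
      then show ?thesis by (simp only: Int_Union)
    qed
    have "infinite (- \<Union>G)" if "G \<subseteq> \<B>" for G
    proof
      assume "finite (- \<Union>G)"
      then have "finite (- \<Union>G \<union> (A0 \<inter> \<Union>\<B>))" using fin by simp
      moreover have "A0 \<subseteq> - \<Union>G \<union> (A0 \<inter> \<Union>\<B>)" using that by auto
      moreover have "infinite A0" using A0 F by (auto simp: \<A>'_def)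
      ultimately show False by (metis finite_subset)
    qed
    moreover have A0_in: "A0 \<in> almost_algebra \<B>"
    proof -
      have "- A0 - \<Union>\<B> \<subseteq> - \<Union>F" by (auto simp: \<B>_def)
      then have "finite (- A0 - \<Union>\<B>)" using F by (metis finite_subset)
      moreover have "\<Union>\<B> - - A0 = A0 \<inter> \<Union>\<B>" by auto
      ultimately have "almost_union \<B> (- A0)"
        unfolding almost_union_def using fin F by (intro exI[of _ \<B>]) (auto simp: \<B>_def)
      then show ?thesis by (simp add: almost_algebra_def)
    qed
    have "\<A> \<subseteq> almost_algebra \<B>"
    proof (intro subsetI)
      fix A assume "A \<in> \<A>"
      then consider "A \<in> \<A> - \<A>'" | "A = A0" | "A \<in> \<B>" unfolding AF \<B>_def by blast
      then show "A \<in> almost_algebra \<B>"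
        using A0_in mem by cases (auto simp: almost_algebra_def almost_union_member)
    qed
    then have "generated_algebra UNIV (\<A> \<union> {F. finite F}) = almost_algebra \<B>"
      by (intro generated_algebra_eq_almost_algebra ad' B)
    ultimately show ?thesis
      using F B by (intro exI[of _ \<B>]) (auto simp: \<B>_def \<A>'_def)
  qed
qed

text \<open>
  The space \<open>K\<close> has three kinds of points: an isolated point \<open>principal n\<close> for each \<open>n\<close>, a point
  \<open>limit B\<close> for each \<open>B \<in> \<B>\<close>, to which \<open>B\<close> converges, and \<open>infty\<close>, which compactifies the rest.
\<close>

locale almost_disjoint_stone =
  fixes \<B> :: "nat set set" and K :: "nat set set topology"
  assumes ad: "almost_disjoint \<B>"
    and inf: "\<And>B. B \<in> \<B> \<Longrightarrow> infinite B"
    and noncover: "\<And>F. F \<subseteq> \<B> \<Longrightarrow> finite F \<Longrightarrow> infinite (- \<Union>F)"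
    and K: "K = stone_space UNIV (almost_algebra \<B>)"
begin

abbreviation "\<AA> \<equiv> almost_algebra \<B>"

sublocale algebra UNIV \<AA>
  by (rule algebra_almost_algebra[OF ad])

definition principal :: "nat \<Rightarrow> nat set set" where
  "principal n = {X \<in> \<AA>. n \<in> X}"

definition limit :: "nat set \<Rightarrow> nat set set" where
  "limit B = {X \<in> \<AA>. finite (B - X)}"

definition infty :: "nat set set" where
  "infty = {X. almost_union \<B> (- X)}"

definition clopen :: "nat set \<Rightarrow> nat set set set" where
  "clopen X = {U \<in> topspace K. X \<in> U}"

lemma member_algebra: "B \<in> \<B> \<Longrightarrow> B \<in> \<AA>"
  by (simp add: almost_algebra_def almost_union_member)

lemma finite_algebra: "finite X \<Longrightarrow> X \<in> \<AA>"
  by (simp add: almost_algebra_def almost_union_finite)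

lemma compl_algebra: "X \<in> \<AA> \<Longrightarrow> - X \<in> \<AA>"
  by (auto simp: almost_algebra_def)

text \<open>
  Otherwise the whole of \<open>\<nat>\<close> would be almost covered by finitely many members of \<open>\<B>\<close>.
\<close>

lemma not_almost_union_both: "almost_union \<B> X \<Longrightarrow> \<not> almost_union \<B> (- X)"
proof
  assume "almost_union \<B> X" "almost_union \<B> (- X)"
  then have "almost_union \<B> UNIV" using almost_union_Un[of \<B> X "- X"] by simp
  then show False using noncover by (auto simp: almost_union_def Compl_eq_Diff_UNIV)
qed

lemma finite_Diff_or_Int:
  assumes B: "B \<in> \<B>" and X: "X \<in> \<AA>"
  shows "finite (B - X) \<or> finite (B \<inter> X)"
proof -
  have *: "finite (B - X) \<or> finite (B \<inter> X)" if small: "almost_union \<B> X" for X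
  proof -
    obtain F where F: "F \<subseteq> \<B>" "finite F" "finite (X - \<Union>F)" "finite (\<Union>F - X)"
      using small by (auto simp: almost_union_def)
    show ?thesis
    proof (cases "B \<in> F")
      case True
      then have "B - X \<subseteq> \<Union>F - X" by auto
      then show ?thesis using F by (metis finite_subset)
    next
      case False
      then have "finite ((X - \<Union>F) \<union> (\<Union>A\<in>F. B \<inter> A))"
        using F B False by (intro finite_UnI finite_UN_I) (auto intro: almost_disjointD[OF ad])
      moreover have "B \<inter> X \<subseteq> (X - \<Union>F) \<union> (\<Union>A\<in>F. B \<inter> A)" by auto
      ultimately show ?thesis by (metis finite_subset)
    qed
  qed
  consider "almost_union \<B> X" | "almost_union \<B> (- X)" using X by (auto simp: almost_algebra_def)
  then show ?thesis
  proof cases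
    case 2
    then show ?thesis using *[of "- X"] by (auto simp: Diff_eq)
  qed (rule *)
qed

lemma topspace_K: "topspace K = ultrafilters_on UNIV \<AA>"
proof -
  have "topspace K = (\<Union>a\<in>\<AA>. {U \<in> ultrafilters_on UNIV \<AA>. a \<in> U})"
    unfolding K stone_space_def topology_generated_by_topspace ..
  also have "\<dots> = ultrafilters_on UNIV \<AA>"
    using top by (auto simp: ultrafilters_on_def)
  finally show ?thesis .
qed

lemma topspace_iff:
  "U \<in> topspace K \<longleftrightarrow> U \<subseteq> \<AA> \<and> UNIV \<in> U \<and> {} \<notin> U \<and> (\<forall>a\<in>U. \<forall>b\<in>U. a \<inter> b \<in> U) \<and>
     (\<forall>a\<in>U. \<forall>b\<in>\<AA>. a \<subseteq> b \<longrightarrow> b \<in> U) \<and> (\<forall>a\<in>\<AA>. a \<in> U \<or> - a \<in> U)"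
  by (simp add: topspace_K ultrafilters_on_def Compl_eq_Diff_UNIV)

lemma ultra_compl: "U \<in> topspace K \<Longrightarrow> X \<in> \<AA> \<Longrightarrow> - X \<in> U \<longleftrightarrow> X \<notin> U"
  unfolding topspace_iff by (metis Compl_disjoint)

lemma ultra_eqI:
  assumes "U \<in> topspace K" "V \<in> topspace K" "U \<subseteq> V"
  shows "U = V"
  using assms ultra_compl by (metis subsetD subsetI subset_antisym topspace_iff)

lemma principal_in: "principal n \<in> topspace K"
  using Int top compl_algebra by (auto simp: topspace_iff principal_def)

lemma limit_in:
  assumes B: "B \<in> \<B>" shows "limit B \<in> topspace K"
proof -
  have "finite (B - X \<inter> Y)" if "finite (B - X)" "finite (B - Y)" for X Y
    using that by (simp add: Diff_Int)
  moreover have "finite (B - Y)" if "finite (B - X)" "X \<subseteq> Y" for X Y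
    using that by (meson Diff_mono finite_subset subset_refl)
  ultimately show ?thesis
    using inf[OF B] finite_Diff_or_Int[OF B] compl_algebra Int top
    by (auto simp: topspace_iff limit_def Diff_eq)
qed

lemma infty_in: "infty \<in> topspace K"
proof -
  have sub: "infty \<subseteq> \<AA>" by (auto simp: infty_def almost_algebra_def)
  have "Y \<in> infty" if "X \<in> infty" "Y \<in> \<AA>" "X \<subseteq> Y" for X Y
  proof (rule ccontr)
    assume "Y \<notin> infty"
    with that have "almost_union \<B> Y" "almost_union \<B> (- X)"
      by (auto simp: infty_def almost_algebra_def)
    then have "almost_union \<B> (Y \<union> - X)" by (rule almost_union_Un)
    moreover have "Y \<union> - X = UNIV" using that by auto
    ultimately show False
      using not_almost_union_both[of UNIV] almost_union_finite[of "{}"] by auto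
  qed
  moreover have "X \<inter> Y \<in> infty" if "X \<in> infty" "Y \<in> infty" for X Y
    using that almost_union_Un by (auto simp: infty_def)
  moreover have "{} \<notin> infty"
    using not_almost_union_both[of "{}"] almost_union_finite[of "{}"] by (auto simp: infty_def)
  ultimately show ?thesis
    using sub unfolding topspace_iff
    by (auto simp: infty_def almost_algebra_def almost_union_finite)
qed

text \<open>
  An ultrafilter that contains a finite set is principal. One that contains no finite set but some
  \<open>B \<in> \<B>\<close> contains every set that almost includes \<open>B\<close>. One that contains neither contains the
  complements of all finite sets and of all members of \<open>\<B>\<close>, hence \<open>infty\<close>. Inclusion of
  ultrafilters is equality.
\<close>

lemma ultra_cases:
  assumes U: "U \<in> topspace K"
  obtains (principal) n where "U = principal n" | (limit) B where "B \<in> \<B>" "U = limit B"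
    | (infty) "U = infty"
proof -
  have UA: "U \<subseteq> \<AA>" and Int: "\<And>a b. a \<in> U \<Longrightarrow> b \<in> U \<Longrightarrow> a \<inter> b \<in> U"
    and up: "\<And>a b. a \<in> U \<Longrightarrow> b \<in> \<AA> \<Longrightarrow> a \<subseteq> b \<Longrightarrow> b \<in> U" and ne: "{} \<notin> U"
    and dich: "\<And>a. a \<in> \<AA> \<Longrightarrow> a \<in> U \<or> - a \<in> U" and UNIV: "UNIV \<in> U"
    using U unfolding topspace_iff by blast+
  consider (1) X where "finite X" "X \<in> U" | (2) B where "B \<in> \<B>" "B \<in> U" "\<And>X. finite X \<Longrightarrow> X \<notin> U"
    | (3) "\<And>B. B \<in> \<B> \<Longrightarrow> B \<notin> U" "\<And>X. finite X \<Longrightarrow> X \<notin> U" by blast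
  then show ?thesis
  proof cases
    case 1
    have "\<exists>n. {n} \<in> U"
      using 1
    proof (induction X rule: finite_induct)
      case empty
      then show ?case using ne by simp
    next
      case (insert n X)
      show ?case
      proof (cases "{n} \<in> U")
        case False
        then have "- {n} \<in> U" using dich[of "{n}"] by (auto simp: finite_algebra)
        then have "insert n X \<inter> - {n} \<in> U" using insert Int by blast
        then have "X \<in> U" using up insert.hyps finite_algebra by blast
        then show ?thesis by (rule insert.IH)
      qed auto
    qed
    then obtain n where n: "{n} \<in> U" ..
    then have "principal n \<subseteq> U" using up by (auto simp: principal_def)
    then show ?thesis using ultra_eqI[OF principal_in U] principal by blast
  next
    case 2
    have "X \<in> U" if X: "X \<in> \<AA>" "finite (B - X)" for X
    proof -
      have "- (B - X) \<in> U" using dich[of "B - X"] 2(3) X finite_algebra by blast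
      then have "B \<inter> - (B - X) \<in> U" using 2 Int by blast
      then show ?thesis using up X by blast
    qed
    then have "limit B \<subseteq> U" by (auto simp: limit_def)
    then show ?thesis using ultra_eqI[OF limit_in U] limit 2 by blast
  next
    case 3
    have "X \<in> U" if X: "almost_union \<B> (- X)" for X
    proof -
      obtain F where F: "F \<subseteq> \<B>" "finite F" "finite (- X - \<Union>F)" "finite (\<Union>F - - X)"
        using X by (auto simp: almost_union_def)
      have "- \<Union>F \<in> U" using F(2,1)
      proof (induction F rule: finite_induct)
        case empty
        then show ?case using UNIV by simp
      next
        case (insert B F)
        then have "- B \<in> U" using 3(1) dich member_algebra by blast
        moreover have "- \<Union>(insert B F) = - B \<inter> - \<Union>F" by auto
        ultimately show ?case using insert Int by auto
      qed
      moreover have "- (- X - \<Union>F) \<in> U" using dich[of "- X - \<Union>F"] 3(2) F finite_algebra by blast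
      ultimately have "- \<Union>F \<inter> - (- X - \<Union>F) \<in> U" using Int by blast
      moreover have "X \<in> \<AA>" using X by (simp add: almost_algebra_def)
      ultimately show ?thesis using up by blast
    qed
    then have "infty \<subseteq> U" by (auto simp: infty_def)
    then show ?thesis using ultra_eqI[OF infty_in U] infty by blast
  qed
qed

lemma topspace_eq: "topspace K = range principal \<union> limit ` \<B> \<union> {infty}"
  using principal_in limit_in infty_in by (auto elim: ultra_cases)

lemma openin_clopen: "X \<in> \<AA> \<Longrightarrow> openin K (clopen X)"
proof -
  assume "X \<in> \<AA>"
  then have "openin K {U \<in> ultrafilters_on UNIV \<AA>. X \<in> U}"
    unfolding K stone_space_def by (intro topology_generated_by_Basis) auto
  then show ?thesis by (simp add: clopen_def topspace_K)
qed

lemma clopen_Int: "X \<in> \<AA> \<Longrightarrow> Y \<in> \<AA> \<Longrightarrow> clopen (X \<inter> Y) = clopen X \<inter> clopen Y"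
proof -
  assume "X \<in> \<AA>" "Y \<in> \<AA>"
  then have "X \<inter> Y \<in> U \<longleftrightarrow> X \<in> U \<and> Y \<in> U" if "U \<in> topspace K" for U
    using that unfolding topspace_iff by (metis inf_le1 inf_le2)
  then show ?thesis by (auto simp: clopen_def)
qed

lemma clopen_Compl: "X \<in> \<AA> \<Longrightarrow> clopen (- X) = topspace K - clopen X"
  using ultra_compl by (auto simp: clopen_def)

text \<open>
  The sets \<open>clopen X\<close> generate the topology and are closed under intersections, so they are a base.
\<close>

lemma openin_iff:
  "openin K S \<longleftrightarrow> S \<subseteq> topspace K \<and> (\<forall>U\<in>S. \<exists>X\<in>\<AA>. U \<in> clopen X \<and> clopen X \<subseteq> S)"
proof
  assume R: "S \<subseteq> topspace K \<and> (\<forall>U\<in>S. \<exists>X\<in>\<AA>. U \<in> clopen X \<and> clopen X \<subseteq> S)"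
  show "openin K S"
  proof (subst openin_subopen, intro ballI)
    fix U assume "U \<in> S"
    with R obtain X where "X \<in> \<AA>" "U \<in> clopen X" "clopen X \<subseteq> S" by blast
    then show "\<exists>T. openin K T \<and> U \<in> T \<and> T \<subseteq> S" using openin_clopen by blast
  qed
next
  assume S: "openin K S"
  have "\<exists>X\<in>\<AA>. U \<in> clopen X \<and> clopen X \<subseteq> S" if "U \<in> S" for U
  proof -
    have "generate_topology_on ((\<lambda>a. {U \<in> ultrafilters_on UNIV \<AA>. a \<in> U}) ` \<AA>) S"
      using S unfolding K stone_space_def openin_topology_generated_by_iff .
    then show ?thesis using that
    proof (induction arbitrary: U rule: generate_topology_on.induct)
      case (Int S T)
      then obtain X Y where "X \<in> \<AA>" "U \<in> clopen X" "clopen X \<subseteq> S"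
        "Y \<in> \<AA>" "U \<in> clopen Y" "clopen Y \<subseteq> T" by (metis IntE)
      then show ?case using Int clopen_Int by (intro bexI[of _ "X \<inter> Y"]) auto
    next
      case (UN \<S>)
      then obtain S where "S \<in> \<S>" "U \<in> S" by auto
      then show ?case using UN.IH[of S U] by blast
    next
      case (Basis S)
      then show ?case by (auto simp: clopen_def topspace_K)
    qed auto
  qed
  then show "S \<subseteq> topspace K \<and> (\<forall>U\<in>S. \<exists>X\<in>\<AA>. U \<in> clopen X \<and> clopen X \<subseteq> S)"
    using openin_subset[OF S] by auto
qed

lemma limit_almost_unionI:
  assumes X: "X \<in> infty" and F: "finite (- X - \<Union>F)" "F \<subseteq> \<B>" "finite F" and B: "B \<in> \<B>" "B \<notin> F"
  shows "X \<in> limit B"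
proof -
  have "finite ((- X - \<Union>F) \<union> (\<Union>A\<in>F. B \<inter> A))"
    using F B by (intro finite_UnI finite_UN_I) (auto intro: almost_disjointD[OF ad])
  moreover have "B - X \<subseteq> (- X - \<Union>F) \<union> (\<Union>A\<in>F. B \<inter> A)" by auto
  ultimately have "finite (B - X)" by (metis finite_subset)
  then show ?thesis using X by (auto simp: limit_def infty_def almost_algebra_def)
qed

text \<open>
  If every point of \<open>K\<close> has a neighbourhood \<open>clopen (X U)\<close> assigned to it, then the one of \<open>infty\<close>
  contains all points except finitely many limit points, indexed by \<open>F\<close>, and isolated points that
  mostly lie in the members of \<open>F\<close>. The neighbourhoods of these limit points contain all but finitely
  many of them, and \<open>N\<close> collects the exceptions, including the overlaps of the members of \<open>F\<close>. Both
  compactness and the approximation of continuous functions follow from this.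
\<close>

lemma neighbourhoods_almost_cover:
  assumes X: "\<forall>U\<in>topspace K. X U \<in> U"
  shows "\<exists>F N. F \<subseteq> \<B> \<and> finite F \<and> finite N \<and> (\<forall>n. n \<notin> N \<longrightarrow>
         n \<in> X infty \<and> n \<notin> \<Union>F \<or> (\<exists>B\<in>F. n \<in> B \<and> n \<in> X (limit B) \<and> (\<forall>A\<in>F - {B}. n \<notin> A))) \<and>
       (\<forall>B\<in>\<B> - F. X infty \<in> limit B)"
proof -
  have "X infty \<in> infty" using X infty_in by blast
  then obtain F where F: "F \<subseteq> \<B>" "finite F" "finite (- X infty - \<Union>F)"
    by (auto simp: infty_def almost_union_def)
  define N where "N = (- X infty - \<Union>F) \<union> (\<Union>B\<in>F. B - X (limit B)) \<union> (\<Union>B\<in>F. \<Union>A\<in>F - {B}. B \<inter> A)"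
  have "finite (B - X (limit B))" if "B \<in> F" for B
  proof -
    have "X (limit B) \<in> limit B" using X limit_in F that by blast
    then show ?thesis by (simp add: limit_def)
  qed
  moreover have "finite (B \<inter> A)" if "B \<in> F" "A \<in> F - {B}" for A B
    using ad F that by (auto simp: almost_disjoint_def)
  ultimately have "finite N" unfolding N_def using F by (intro finite_UnI finite_UN_I) auto
  moreover have "n \<in> X infty \<and> n \<notin> \<Union>F \<or> (\<exists>B\<in>F. n \<in> B \<and> n \<in> X (limit B) \<and> (\<forall>A\<in>F - {B}. n \<notin> A))"
    if n: "n \<notin> N" for n
  proof (cases "n \<in> \<Union>F")
    case True
    then obtain B where B: "B \<in> F" "n \<in> B" by auto
    then have "n \<in> X (limit B)" "\<forall>A\<in>F - {B}. n \<notin> A" using n unfolding N_def by auto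
    with B show ?thesis by blast
  next
    case False
    then show ?thesis using n unfolding N_def by auto
  qed
  moreover have "X infty \<in> limit B" if "B \<in> \<B> - F" for B
    using limit_almost_unionI[OF \<open>X infty \<in> infty\<close> F(3,1,2)] that by blast
  ultimately show ?thesis using F(1,2) by (intro exI[of _ F] exI[of _ N] conjI allI impI ballI)
qed

lemma compact_K: "compact_space K"
  unfolding compact_space_alt
proof (intro allI impI)
  fix \<U> assume "(\<forall>U\<in>\<U>. openin K U) \<and> topspace K \<subseteq> \<Union>\<U>"
  then have op: "\<forall>U\<in>\<U>. openin K U" and cov: "topspace K \<subseteq> \<Union>\<U>" by auto
  have "\<exists>S X. S \<in> \<U> \<and> X \<in> U \<and> clopen X \<subseteq> S" if U: "U \<in> topspace K" for U
  proof -
    obtain S where "S \<in> \<U>" "U \<in> S" using cov U by blast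
    moreover from this obtain X where "U \<in> clopen X" "clopen X \<subseteq> S" using op openin_iff by blast
    ultimately show ?thesis by (auto simp: clopen_def)
  qed
  then obtain S X where S: "\<And>U. U \<in> topspace K \<Longrightarrow> S U \<in> \<U>" and X: "\<And>U. U \<in> topspace K \<Longrightarrow> X U \<in> U"
    and SX: "\<And>U. U \<in> topspace K \<Longrightarrow> clopen (X U) \<subseteq> S U" by metis
  have X': "\<forall>U\<in>topspace K. X U \<in> U" using X by blast
  obtain F N where F: "F \<subseteq> \<B>" "finite F" "finite N"
    "\<forall>n. n \<notin> N \<longrightarrow> n \<in> X infty \<and> n \<notin> \<Union>F \<or> (\<exists>B\<in>F. n \<in> B \<and> n \<in> X (limit B) \<and> (\<forall>A\<in>F - {B}. n \<notin> A))"
    "\<forall>B\<in>\<B> - F. X infty \<in> limit B"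
    using neighbourhoods_almost_cover[OF X'] by (elim exE conjE) (rule that)
  define P where "P = principal ` N \<union> limit ` F \<union> {infty}"
  have P: "P \<subseteq> topspace K" using F by (auto simp: P_def principal_in limit_in infty_in)
  have XA: "X U \<in> \<AA>" if "U \<in> topspace K" for U
    using X[OF that] that by (auto simp: topspace_iff)
  have "U \<in> \<Union>(S ` P)" if U: "U \<in> topspace K" for U
  proof -
    have "\<exists>V\<in>P. X V \<in> U" using U
    proof (cases rule: ultra_cases)
      case (principal n)
      show ?thesis
      proof (cases "n \<in> N")
        case True
        then show ?thesis using X[OF U] principal by (auto simp: P_def)
      next
        case False
        then obtain V where V: "V \<in> P" "n \<in> X V" using F(4)[rule_format, OF False] by (auto simp: P_def)
        then have "X V \<in> principal n" using XA P by (auto simp: principal_def)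
        then show ?thesis using V principal by blast
      qed
    next
      case (limit B)
      then show ?thesis using F(5) X[OF U] by (cases "B \<in> F") (auto simp: P_def)
    next
      case infty
      then show ?thesis using X[OF U] by (auto simp: P_def)
    qed
    then obtain V where V: "V \<in> P" "X V \<in> U" ..
    then have "U \<in> clopen (X V)" using U by (simp add: clopen_def)
    then show ?thesis using SX[of V] V P by blast
  qed
  moreover have "finite (S ` P)" using F by (simp add: P_def)
  moreover have "S ` P \<subseteq> \<U>" using S P by auto
  ultimately show "\<exists>\<F>. finite \<F> \<and> \<F> \<subseteq> \<U> \<and> topspace K \<subseteq> \<Union>\<F>" by blast
qed

lemma Hausdorff_K: "Hausdorff_space K"
  unfolding Hausdorff_space_def
proof (intro allI impI)
  fix U V assume UV: "U \<in> topspace K \<and> V \<in> topspace K \<and> U \<noteq> V"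
  then obtain X where X: "X \<in> U" "X \<notin> V" using ultra_eqI by blast
  then have XA: "X \<in> \<AA>" using UV by (auto simp: topspace_iff)
  then have "U \<in> clopen X" "V \<in> clopen (- X)" "disjnt (clopen X) (clopen (- X))"
    using X UV ultra_compl by (auto simp: clopen_def disjnt_def)
  then show "\<exists>S T. openin K S \<and> openin K T \<and> U \<in> S \<and> V \<in> T \<and> disjnt S T"
    using openin_clopen XA compl_algebra by blast
qed

lemma principal_eq_iff: "U \<in> topspace K \<Longrightarrow> {n} \<in> U \<longleftrightarrow> U = principal n"
proof
  assume U: "U \<in> topspace K" and n: "{n} \<in> U"
  then have "principal n \<subseteq> U" unfolding topspace_iff principal_def by blast
  then show "U = principal n" using ultra_eqI[OF principal_in U, of n] by simp
qed (simp add: principal_def finite_algebra)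

lemma clopen_singleton: "clopen {n} = {principal n}"
  using principal_eq_iff principal_in by (auto simp: clopen_def)

lemma open_principals:
  assumes S: "S \<subseteq> range principal"
  shows "openin K S"
proof -
  have "S = (\<Union>n\<in>{n. principal n \<in> S}. clopen {n})"
    using S by (auto simp: clopen_singleton)
  then show ?thesis
    by (metis (no_types, lifting) finite.emptyI finite.insertI finite_algebra openin_Union openin_clopen imageE)
qed

lemma member_limit:
  assumes B: "B \<in> \<B>" and A: "A \<in> \<B>"
  shows "A \<in> limit B \<longleftrightarrow> A = B"
proof -
  have "infinite (B - A)" if "A \<noteq> B"
    using almost_disjointD[OF ad B A] inf[OF B] that by (metis Un_Diff_Int finite_UnI)
  then show ?thesis using A by (auto simp: limit_def member_algebra)
qed

lemma member_infty: "B \<in> \<B> \<Longrightarrow> B \<notin> infty"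
  using not_almost_union_both almost_union_member by (auto simp: infty_def)

lemma finite_not_limit: "B \<in> \<B> \<Longrightarrow> finite X \<Longrightarrow> X \<notin> limit B"
  using inf by (auto simp: limit_def)

lemma finite_not_infty: "finite X \<Longrightarrow> X \<notin> infty"
  using not_almost_union_both almost_union_finite by (auto simp: infty_def)

text \<open>
  The isolated points are open, the limit points are open relative to the complement of the isolated
  points, and the single remaining point is the complement of all others. So every subset is a union
  of three Borel pieces.
\<close>

lemma subset_borel: "S \<subseteq> topspace K \<Longrightarrow> S \<in> borel_sets K"
proof -
  assume S: "S \<subseteq> topspace K"
  interpret B: sigma_algebra "topspace K" "borel_sets K"
    unfolding borel_sets_def by (rule sigma_algebra_sigma_sets) (auto dest: openin_subset)
  have op: "T \<in> borel_sets K" if "openin K T" for T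
    unfolding borel_sets_def using that by (intro sigma_sets.Basic) auto
  have P: "range principal \<in> borel_sets K" by (intro op open_principals) auto
  have L: "T - range principal \<in> borel_sets K" if T: "T \<subseteq> limit ` \<B>" for T
  proof -
    have "openin K (range principal \<union> T)"
      unfolding openin_iff
    proof (intro conjI ballI)
      show "range principal \<union> T \<subseteq> topspace K" using T by (auto simp: topspace_eq)
      fix U assume "U \<in> range principal \<union> T"
      then consider n where "U = principal n" | B where "B \<in> \<B>" "U = limit B" "U \<in> T" using T by auto
      then show "\<exists>X\<in>\<AA>. U \<in> clopen X \<and> clopen X \<subseteq> range principal \<union> T"
      proof cases
        case 1
        then show ?thesis using clopen_singleton finite_algebra by (intro bexI[of _ "{n}"]) auto
      next
        case 2
        have "clopen B \<subseteq> range principal \<union> {limit B}"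
          using 2 member_limit member_infty by (auto simp: clopen_def elim: ultra_cases)
        then show ?thesis
          using 2 limit_in member_limit[of B B] member_algebra
          by (intro bexI[of _ B]) (auto simp: clopen_def)
      qed
    qed
    then have "(range principal \<union> T) - range principal \<in> borel_sets K" using op P by blast
    then show ?thesis by (simp add: Un_Diff)
  qed
  have "infty \<notin> range principal"
    using finite_not_infty principal_eq_iff[OF infty_in] by blast
  moreover have "infty \<notin> limit ` \<B>"
    using member_limit member_infty by (metis imageE)
  ultimately have "topspace K - range principal - (limit ` \<B> - range principal) = {infty}"
    unfolding topspace_eq by auto
  then have I: "{infty} \<in> borel_sets K" using P L[of "limit ` \<B>"] by (metis B.Diff B.top subset_refl)
  have "S = (S \<inter> range principal) \<union> ((S \<inter> limit ` \<B>) - range principal) \<union> (S \<inter> {infty})"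
    using S unfolding topspace_eq by blast
  moreover have "S \<inter> range principal \<in> borel_sets K" by (intro op open_principals) auto
  moreover have "(S \<inter> limit ` \<B>) - range principal \<in> borel_sets K" by (intro L) auto
  moreover have "S \<inter> {infty} \<in> borel_sets K" using I by (cases "infty \<in> S") auto
  ultimately show ?thesis by (metis B.Un)
qed

lemma borel_sets_K: "borel_sets K = Pow (topspace K)"
proof -
  have "borel_sets K \<subseteq> Pow (topspace K)"
    unfolding borel_sets_def using sigma_sets_into_sp[of "{U. openin K U}" "topspace K"]
    by (auto dest: openin_subset)
  then show ?thesis using subset_borel by auto
qed

definition char_fun :: "nat set \<Rightarrow> nat set set \<Rightarrow> real" where
  "char_fun X = indicator (clopen X)"

lemma char_fun_C: "X \<in> \<AA> \<Longrightarrow> char_fun X \<in> C_space K"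
proof -
  assume X: "X \<in> \<AA>"
  have "openin K {U \<in> topspace K. char_fun X U \<in> T}" for T
  proof -
    have "{U \<in> topspace K. char_fun X U \<in> T} =
        (if 1 \<in> T then clopen X else {}) \<union> (if 0 \<in> T then clopen (- X) else {})"
      unfolding clopen_Compl[OF X] by (auto simp: char_fun_def indicator_def clopen_def)
    then show ?thesis using openin_clopen X compl_algebra by auto
  qed
  then show ?thesis
    by (auto simp: C_space_def continuous_map_def char_fun_def clopen_def)
qed

lemma char_fun_simps:
  "X \<in> \<AA> \<Longrightarrow> char_fun X (principal n) = indicator X n"
  "B \<in> \<B> \<Longrightarrow> A \<in> \<B> \<Longrightarrow> char_fun A (limit B) = (if A = B then 1 else 0)"
  "B \<in> \<B> \<Longrightarrow> finite X \<Longrightarrow> char_fun X (limit B) = 0"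
  "B \<in> \<B> \<Longrightarrow> char_fun B infty = 0"
  "finite X \<Longrightarrow> char_fun X infty = 0"
  "U \<in> topspace K \<Longrightarrow> char_fun UNIV U = 1"
  using principal_in limit_in infty_in
  by (auto simp: char_fun_def clopen_def principal_def member_limit member_infty finite_not_limit
      finite_not_infty indicator_def topspace_iff)

text \<open>
  Near \<open>infty\<close> the function is almost constant, and near each of the finitely many other limit points
  it is almost constant as well, so subtracting the corresponding multiples of \<open>char_fun B\<close> leaves
  finitely many isolated points to be corrected.
\<close>

lemma C_space_approximation:
  assumes g: "g \<in> C_space K" and \<epsilon>: "\<epsilon> > 0"
  shows "\<exists>F N a b. F \<subseteq> \<B> \<and> finite F \<and> finite N \<and>
     (\<forall>U\<in>topspace K. \<bar>g U - (g infty * char_fun UNIV U + (\<Sum>B\<in>F. a B * char_fun B U) +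
        (\<Sum>n\<in>N. b n * char_fun {n} U))\<bar> \<le> \<epsilon>)"
proof -
  have "\<exists>X\<in>U. \<forall>V\<in>clopen X. \<bar>g V - g U\<bar> \<le> \<epsilon>" if U: "U \<in> topspace K" for U
  proof -
    have "openin K {V \<in> topspace K. g V \<in> ball (g U) \<epsilon>}"
      using g unfolding C_space_def continuous_map_def by auto
    moreover have "U \<in> {V \<in> topspace K. g V \<in> ball (g U) \<epsilon>}" using U \<epsilon> by auto
    ultimately obtain X where "X \<in> \<AA>" "U \<in> clopen X" "clopen X \<subseteq> {V \<in> topspace K. g V \<in> ball (g U) \<epsilon>}"
      unfolding openin_iff by blast
    then show ?thesis by (force simp: clopen_def dist_real_def)
  qed
  then obtain X where X: "\<And>U. U \<in> topspace K \<Longrightarrow> X U \<in> U"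
    and near: "\<And>U V. U \<in> topspace K \<Longrightarrow> V \<in> clopen (X U) \<Longrightarrow> \<bar>g V - g U\<bar> \<le> \<epsilon>" by metis
  have X': "\<forall>U\<in>topspace K. X U \<in> U" using X by blast
  obtain F N where F: "F \<subseteq> \<B>" "finite F" "finite N"
    "\<forall>n. n \<notin> N \<longrightarrow> n \<in> X infty \<and> n \<notin> \<Union>F \<or> (\<exists>B\<in>F. n \<in> B \<and> n \<in> X (limit B) \<and> (\<forall>A\<in>F - {B}. n \<notin> A))"
    "\<forall>B\<in>\<B> - F. X infty \<in> limit B"
    using neighbourhoods_almost_cover[OF X'] by (elim exE conjE) (rule that)
  have XA: "X U \<in> \<AA>" if "U \<in> topspace K" for U
    using X[OF that] that by (auto simp: topspace_iff)
  define a where "a B = g (limit B) - g infty" for B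
  define s where "s U = g infty * char_fun UNIV U + (\<Sum>B\<in>F. a B * char_fun B U)" for U
  define b where "b n = g (principal n) - s (principal n)" for n
  define c where "c U = (\<Sum>n\<in>N. b n * char_fun {n} U)" for U
  have char_n: "char_fun {n} (principal m) = (if n = m then 1 else 0)" for n m
    by (simp add: char_fun_simps finite_algebra)
  have "\<bar>g U - (s U + c U)\<bar> \<le> \<epsilon>" if U: "U \<in> topspace K" for U
    using U
  proof (cases rule: ultra_cases)
    case (principal m)
    have c: "c U = (if m \<in> N then b m else 0)"
      using F(3) by (simp add: c_def principal char_n if_distrib cong: if_cong)
    show ?thesis
    proof (cases "m \<in> N")
      case True
      then show ?thesis using \<epsilon> c by (simp add: b_def principal)
    next
      case False
      have s: "s U = g infty + (\<Sum>B\<in>F. a B * indicator B m)"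
        unfolding s_def principal using F(1)
        by (auto simp: char_fun_simps member_algebra principal_in intro!: sum.cong)
      consider "m \<in> X infty" "m \<notin> \<Union>F" | B where "B \<in> F" "m \<in> B" "m \<in> X (limit B)" "\<And>A. A \<in> F \<Longrightarrow> A \<noteq> B \<Longrightarrow> m \<notin> A"
        using F(4)[rule_format, OF False] by blast
      then show ?thesis
      proof cases
        case 1
        have "(\<Sum>B\<in>F. a B * indicator B m) = 0" using 1 by (intro sum.neutral) auto
        moreover have "U \<in> clopen (X infty)"
          using 1 principal XA[OF infty_in] principal_in by (auto simp: clopen_def principal_def)
        ultimately show ?thesis using near[OF infty_in] s c False by simp
      next
        case 2
        have "(\<Sum>A\<in>F. a A * indicator A m) = (\<Sum>A\<in>F. if A = B then a B else 0)"
          using 2(2,4) by (intro sum.cong) (auto simp: indicator_def)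
        also have "\<dots> = a B" using F(2) 2(1) by simp
        finally have "s U = g (limit B)" using s by (simp add: a_def)
        moreover have lB: "limit B \<in> topspace K" using 2(1) F(1) limit_in by blast
        moreover have "U \<in> clopen (X (limit B))"
          using 2(3) principal XA[OF lB] principal_in by (auto simp: clopen_def principal_def)
        ultimately show ?thesis using near[OF lB] c False by simp
      qed
    qed
  next
    case (limit B)
    have "c U = 0" unfolding c_def limit(2) using limit(1) by (simp add: char_fun_simps)
    moreover have "s U = g infty + (\<Sum>A\<in>F. if A = B then a B else 0)"
      unfolding s_def limit(2) using limit(1) F(1) limit_in
      by (auto simp: char_fun_simps intro!: sum.cong)
    moreover have "U \<in> clopen (X infty)" if "B \<notin> F"
      using F(5) limit that U by (simp add: clopen_def)
    ultimately show ?thesis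
      using F(2) \<epsilon> near[OF infty_in] by (cases "B \<in> F") (simp_all add: a_def limit(2))
  next
    case infty
    have "c U = 0" unfolding c_def infty by (simp add: char_fun_simps)
    moreover have "s U = g infty"
      unfolding s_def infty using F(1) infty_in by (auto simp: char_fun_simps intro!: sum.neutral)
    ultimately show ?thesis using infty \<epsilon> by simp
  qed
  then show ?thesis unfolding s_def c_def using F by (intro exI[of _ F] exI[of _ N] exI[of _ a] exI[of _ b]) auto
qed

lemma clopen_Un: "X \<in> \<AA> \<Longrightarrow> Y \<in> \<AA> \<Longrightarrow> clopen (X \<union> Y) = clopen X \<union> clopen Y"
proof -
  assume X: "X \<in> \<AA>" and Y: "Y \<in> \<AA>"
  have "X \<union> Y \<in> U \<longleftrightarrow> X \<in> U \<or> Y \<in> U" if "U \<in> topspace K" for U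
  proof
    assume XY: "X \<union> Y \<in> U"
    show "X \<in> U \<or> Y \<in> U"
    proof (rule ccontr)
      assume "\<not> (X \<in> U \<or> Y \<in> U)"
      then have "- X \<in> U" "- Y \<in> U" using that X Y ultra_compl by auto
      then have "(X \<union> Y) \<inter> (- X \<inter> - Y) \<in> U" using that XY unfolding topspace_iff by blast
      moreover have "(X \<union> Y) \<inter> (- X \<inter> - Y) = {}" by auto
      ultimately show False using that unfolding topspace_iff by simp
    qed
  next
    assume "X \<in> U \<or> Y \<in> U"
    then show "X \<union> Y \<in> U"
      using that Un[OF X Y] unfolding topspace_iff by (meson Un_upper1 Un_upper2)
  qed
  then show ?thesis by (auto simp: clopen_def)
qed

lemma clopen_disjoint: "X \<in> \<AA> \<Longrightarrow> Y \<in> \<AA> \<Longrightarrow> X \<inter> Y = {} \<Longrightarrow> clopen X \<inter> clopen Y = {}"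
  by (metis (no_types, lifting) clopen_Int clopen_def empty_Collect_eq topspace_iff)

lemma char_fun_Un:
  assumes "X \<in> \<AA>" "Y \<in> \<AA>" "X \<inter> Y = {}"
  shows "char_fun (X \<union> Y) = char_fun X + char_fun Y"
  using clopen_disjoint[OF assms]
  by (auto simp: char_fun_def fun_eq_iff clopen_Un[OF assms(1,2)] indicator_def)

lemma inj_principal: "inj principal"
proof (rule injI)
  fix n k assume "principal n = principal k"
  moreover have "{n} \<in> principal n" by (simp add: principal_def finite_algebra)
  ultimately show "n = k" by (simp add: principal_def)
qed

lemma ultra_in_algebra: "U \<in> topspace K \<Longrightarrow> X \<in> U \<Longrightarrow> X \<in> \<AA>"
  unfolding topspace_iff by blast

lemma inj_limit: "inj_on limit \<B>"
  by (metis inj_onI member_limit)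

lemma principal_not_limit: "B \<in> \<B> \<Longrightarrow> principal n \<noteq> limit B"
  by (metis finite.emptyI finite.insertI finite_not_limit principal_eq_iff principal_in)

lemma principal_not_infty: "principal n \<noteq> infty"
  by (metis finite.emptyI finite.insertI finite_not_infty principal_eq_iff principal_in)

lemma limit_not_infty: "B \<in> \<B> \<Longrightarrow> limit B \<noteq> infty"
  by (metis member_infty member_limit)

lemma infty_not_in: "infty \<notin> range principal" "infty \<notin> limit ` \<B>"
  using principal_not_infty limit_not_infty by (metis rangeE, metis imageE)

lemma clopen_member: "B \<in> \<B> \<Longrightarrow> clopen B = principal ` B \<union> {limit B}"
proof -
  assume B: "B \<in> \<B>"
  have "U \<in> clopen B \<longleftrightarrow> U \<in> principal ` B \<union> {limit B}" if "U \<in> topspace K" for U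
    using that
  proof (cases rule: ultra_cases)
    case (principal n)
    then show ?thesis
      using B that inj_principal principal_not_limit[OF B]
      by (auto simp: clopen_def principal_def member_algebra inj_def)
  next
    case (limit A)
    then show ?thesis using B that principal_not_limit inj_limit
      by (auto simp: clopen_def member_limit dest: inj_onD)
  next
    case infty
    then show ?thesis using B that principal_not_infty limit_not_infty
      by (auto simp: clopen_def member_infty)
  qed
  moreover have "principal ` B \<union> {limit B} \<subseteq> topspace K" using B principal_in limit_in by auto
  moreover have "clopen B \<subseteq> topspace K" by (auto simp: clopen_def)
  ultimately show ?thesis by blast
qed

lemma ultra_INT:
  assumes U: "U \<in> topspace K" and "finite I" "\<And>i. i \<in> I \<Longrightarrow> X i \<in> U"
  shows "(\<Inter>i\<in>I. X i) \<in> U"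
  using assms(2,3)
proof (induction I rule: finite_induct)
  case empty
  then show ?case using U by (simp add: topspace_iff)
next
  case (insert i I)
  then have "X i \<in> U" "(\<Inter>i\<in>I. X i) \<in> U" by auto
  then show ?case using U by (simp add: topspace_iff)
qed

text \<open>
  For \<open>U \<noteq> V\<close> there is a set in \<open>U\<close> but not in \<open>V\<close>. Making the separating sets disjoint symmetrically,
  by \<open>S U V \<inter> - S V U\<close>, lets a plain intersection over all other points do.
\<close>

lemma separate_finitely_many:
  assumes P: "finite P" "P \<subseteq> topspace K"
  shows "\<exists>Z. (\<forall>U\<in>P. Z U \<in> U) \<and> disjoint_family_on Z P"
proof -
  have "\<exists>S. S \<in> U \<and> S \<notin> V" if "U \<in> P" "V \<in> P" "U \<noteq> V" for U V
    using ultra_eqI[of U V] that P by blast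
  then obtain S where S: "\<And>U V. U \<in> P \<Longrightarrow> V \<in> P \<Longrightarrow> U \<noteq> V \<Longrightarrow> S U V \<in> U \<and> S U V \<notin> V" by metis
  define Z where "Z U = (\<Inter>V\<in>P - {U}. S U V \<inter> - S V U)" for U
  have "Z U \<in> U" if U: "U \<in> P" for U
  proof -
    have UK: "U \<in> topspace K" using P U by auto
    have "S U V \<inter> - S V U \<in> U" if "V \<in> P - {U}" for V
    proof -
      have "S U V \<in> U" "S V U \<notin> U" "S V U \<in> V" using S[of U V] S[of V U] U that by auto
      moreover have "S V U \<in> \<AA>" using \<open>S V U \<in> V\<close> P that by (intro ultra_in_algebra[of V]) auto
      ultimately have "- S V U \<in> U" "S U V \<in> U" using ultra_compl[OF UK] by auto
      then show ?thesis using UK by (simp add: topspace_iff)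
    qed
    then show ?thesis unfolding Z_def using P by (intro ultra_INT UK) auto
  qed
  moreover have "disjoint_family_on Z P" unfolding disjoint_family_on_def Z_def by blast
  ultimately show ?thesis by blast
qed

lemma char_fun_empty: "char_fun {} = 0"
proof -
  have "clopen {} = {}" by (auto simp: clopen_def topspace_iff)
  then show ?thesis by (simp add: char_fun_def fun_eq_iff)
qed

lemma sum_char_fun_le:
  assumes J: "finite J" "\<And>j. j \<in> J \<Longrightarrow> X j \<in> \<AA>" "disjoint_family_on X J"
  shows "(\<Sum>j\<in>J. \<bar>char_fun (X j) U\<bar>) \<le> 1"
proof (cases "\<exists>i\<in>J. U \<in> clopen (X i)")
  case True
  then obtain i where i: "i \<in> J" "U \<in> clopen (X i)" by blast
  have "U \<notin> clopen (X j)" if "j \<in> J" "j \<noteq> i" for j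
    using clopen_disjoint[OF J(2)[OF that(1)] J(2)[OF i(1)]] J(3) i that
    by (auto simp: disjoint_family_on_def)
  then have "(\<Sum>j\<in>J. \<bar>char_fun (X j) U\<bar>) = (\<Sum>j\<in>J. if j = i then 1 else 0)"
    using i by (intro sum.cong) (auto simp: char_fun_def)
  then show ?thesis using J i by simp
next
  case False
  then have "(\<Sum>j\<in>J. \<bar>char_fun (X j) U\<bar>) = 0"
    by (intro sum.neutral) (auto simp: char_fun_def)
  then show ?thesis by simp
qed

end

section \<open>Approximating measures from Martin's axiom\<close>

text \<open>
  Measures on \<open>\<nat>\<close> with finite support and rational masses are represented by lists of pairs of a point
  and its mass. The type of these lists is countable, which is what the countable chain condition
  below rests on.
\<close>

definition atomic_eval :: "(nat \<times> rat) list \<Rightarrow> (nat \<Rightarrow> real) \<Rightarrow> real" where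
  "atomic_eval l f = (\<Sum>(x, c)\<leftarrow>l. real_of_rat c * f x)"

definition atomic_mass :: "(nat \<times> rat) list \<Rightarrow> real" where
  "atomic_mass l = (\<Sum>(x, c)\<leftarrow>l. \<bar>real_of_rat c\<bar>)"

lemma atomic_eval_add: "atomic_eval l (\<lambda>x. f x + g x) = atomic_eval l f + atomic_eval l g"
  by (induction l) (auto simp: atomic_eval_def algebra_simps)

lemma atomic_eval_scale: "atomic_eval l (\<lambda>x. c * f x) = c * atomic_eval l f"
  by (induction l) (auto simp: atomic_eval_def algebra_simps)

lemma atomic_eval_bound:
  assumes "\<And>x. \<bar>f x\<bar> \<le> b"
  shows "\<bar>atomic_eval l f\<bar> \<le> atomic_mass l * b"
proof (induction l)
  case (Cons a l)
  obtain x c where a: "a = (x, c)" by force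
  have "\<bar>real_of_rat c * f x\<bar> \<le> \<bar>real_of_rat c\<bar> * b"
    using assms[of x] by (simp add: abs_mult mult_left_mono)
  with Cons a show ?case
    by (auto simp: atomic_eval_def atomic_mass_def algebra_simps)
qed (auto simp: atomic_eval_def atomic_mass_def)

text \<open>
  The approximation is from the side of \<open>0\<close>, so that rounding does not increase the total mass.
\<close>

lemma rat_approx_inside:
  fixes a :: real assumes "\<epsilon> > 0"
  shows "\<exists>c. \<bar>real_of_rat c\<bar> \<le> \<bar>a\<bar> \<and> \<bar>real_of_rat c - a\<bar> \<le> \<epsilon>"
proof (cases a "0::real" rule: linorder_cases)
  case less
  then have "max a (-\<epsilon>+a) < min 0 (a+\<epsilon>)" using assms by auto
  then obtain r where "r \<in> \<rat>" "max a (-\<epsilon>+a) < r" "r < min 0 (a+\<epsilon>)"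
    using Rats_dense_in_real by blast
  then obtain q where "max a (-\<epsilon>+a) < real_of_rat q" "real_of_rat q < min 0 (a+\<epsilon>)"
    by (auto simp: Rats_def)
  then show ?thesis using less assms by (intro exI[of _ q]) linarith
next
  case equal
  then show ?thesis using assms by (intro exI[of _ 0]) auto
next
  case greater
  then have "max 0 (a-\<epsilon>) < a" using assms by auto
  then obtain r where "r \<in> \<rat>" "max 0 (a-\<epsilon>) < r" "r < a"
    using Rats_dense_in_real by blast
  then obtain q where "max 0 (a-\<epsilon>) < real_of_rat q" "real_of_rat q < a"
    by (auto simp: Rats_def)
  then show ?thesis using greater assms by (intro exI[of _ q]) linarith
qed

text \<open>
  Each \<open>B \<in> F\<close> is infinite and meets the others in a finite set, so it contains a point beyond \<open>n\<close>
  that belongs to none of the others. Masses at these points prescribe the values on \<open>F\<close>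
  independently of each other.
\<close>

lemma atomic_measure_on_almost_disjoint:
  fixes \<B> :: "nat set set" and a :: "nat set \<Rightarrow> real"
  assumes ad: "almost_disjoint \<B>" and inf: "\<And>B. B \<in> \<B> \<Longrightarrow> infinite B"
    and F: "finite F" "F \<subseteq> \<B>" and \<epsilon>: "\<epsilon> > 0"
  shows "\<exists>l. atomic_mass l \<le> (\<Sum>B\<in>F. \<bar>a B\<bar>) \<and> (\<forall>(x, c)\<in>set l. n \<le> x) \<and>
             (\<forall>B\<in>F. \<bar>atomic_eval l (indicator B) - a B\<bar> \<le> \<epsilon>)"
proof -
  have "\<exists>x. x \<in> B \<and> n \<le> x \<and> (\<forall>B'\<in>F - {B}. x \<notin> B')" if "B \<in> F" for B
  proof -
    have "finite ({..<n} \<union> (\<Union>B'\<in>F - {B}. B \<inter> B'))"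
      using F ad that by (intro finite_UnI finite_UN_I) (auto simp: almost_disjoint_def)
    with inf[of B] that F have "B - ({..<n} \<union> (\<Union>B'\<in>F - {B}. B \<inter> B')) \<noteq> {}"
      by (metis finite.emptyI finite_Diff2 subsetD)
    then show ?thesis by (auto simp: not_less)
  qed
  then obtain x where x: "\<And>B. B \<in> F \<Longrightarrow> x B \<in> B" "\<And>B. B \<in> F \<Longrightarrow> n \<le> x B"
    "\<And>B B'. B \<in> F \<Longrightarrow> B' \<in> F \<Longrightarrow> B' \<noteq> B \<Longrightarrow> x B \<notin> B'" by (metis Diff_iff singletonD)
  obtain c where c: "\<And>B. \<bar>real_of_rat (c B)\<bar> \<le> \<bar>a B\<bar>" "\<And>B. \<bar>real_of_rat (c B) - a B\<bar> \<le> \<epsilon>"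
    using rat_approx_inside[OF \<epsilon>] by (atomize_elim, simp add: choice_iff'[symmetric] flip: all_conj_distrib) (intro choice allI rat_approx_inside[OF \<epsilon>])
  obtain xs where xs: "set xs = F" "distinct xs"
    using F finite_distinct_list by blast
  define l where "l = map (\<lambda>B. (x B, c B)) xs"
  have ev: "atomic_eval l f = (\<Sum>B\<in>F. real_of_rat (c B) * f (x B))" for f
    using xs by (simp add: atomic_eval_def l_def comp_def sum_list_distinct_conv_sum_set)
  have "atomic_mass l = (\<Sum>B\<in>F. \<bar>real_of_rat (c B)\<bar>)"
    using xs by (simp add: atomic_mass_def l_def comp_def sum_list_distinct_conv_sum_set)
  then have "atomic_mass l \<le> (\<Sum>B\<in>F. \<bar>a B\<bar>)"
    using c by (simp add: sum_mono)
  moreover have "atomic_eval l (indicator B) = real_of_rat (c B)" if "B \<in> F" for B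
  proof -
    have "atomic_eval l (indicator B) = (\<Sum>B'\<in>F. if B' = B then real_of_rat (c B) else 0)"
      unfolding ev using x that by (intro sum.cong) (auto simp: indicator_def)
    then show ?thesis using F that by simp
  qed
  ultimately show ?thesis
    using c x xs by (intro exI[of _ l]) (auto simp: l_def)
qed

text \<open>
  Only the size of the carrier matters for Martin's axiom: an order with an injection into \<open>'p\<close> is
  replaced by its image.
\<close>

lemma martin_axiom_transfer:
  fixes P :: "'a set" and code :: "'a \<Rightarrow> 'p" and D :: "'k \<Rightarrow> 'a set"
  assumes MA: "martin_axiom TYPE('p) \<kappa>" and code: "inj_on code P"
    and P: "P \<noteq> {}" "partial_order_on P r" "ccc_poset P r"
    and D: "\<And>\<xi>. \<xi> \<in> Field \<kappa> \<Longrightarrow> dense_in_poset P r (D \<xi>)"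
  shows "\<exists>G\<subseteq>P. directed_in_poset r G \<and> (\<forall>\<xi>\<in>Field \<kappa>. G \<inter> D \<xi> \<noteq> {})"
proof -
  define s where "s = map_prod code code ` r"
  have rP: "r \<subseteq> P \<times> P"
    using P(2) by (auto simp: partial_order_on_def preorder_on_def)
  have s: "(code p, code q) \<in> s \<longleftrightarrow> (p, q) \<in> r" if "p \<in> P" "q \<in> P" for p q
  proof
    assume "(code p, code q) \<in> s"
    then obtain p' q' where *: "(p', q') \<in> r" "code p = code p'" "code q = code q'"
      by (auto simp: s_def)
    then have "p' \<in> P" "q' \<in> P" using rP by auto
    then have "p = p'" "q = q'" using * that code by (auto dest: inj_onD)
    then show "(p, q) \<in> r" using * by simp
  qed (force simp: s_def)
  have sP: "s \<subseteq> code ` P \<times> code ` P"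
    using rP by (auto simp: s_def)
  have po: "partial_order_on (code ` P) s"
    unfolding partial_order_on_def preorder_on_def
  proof (intro conjI)
    show "s \<subseteq> code ` P \<times> code ` P" by (rule sP)
    show "refl_on (code ` P) s"
      using P(2) by (auto simp: refl_on_def s partial_order_on_def preorder_on_def)
    show "trans s"
    proof (rule transI)
      fix x y z assume "(x, y) \<in> s" "(y, z) \<in> s"
      moreover from this obtain p q u where "p \<in> P" "q \<in> P" "u \<in> P" "x = code p" "y = code q" "z = code u"
        using sP by blast
      ultimately show "(x, z) \<in> s"
        using P(2) s by (auto simp: partial_order_on_def preorder_on_def elim: transE)
    qed
    show "antisym s"
    proof (rule antisymI)
      fix x y assume "(x, y) \<in> s" "(y, x) \<in> s"
      moreover from this obtain p q where "p \<in> P" "q \<in> P" "x = code p" "y = code q"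
        using sP by blast
      ultimately show "x = y"
        using P(2) s by (auto simp: partial_order_on_def dest: antisymD)
    qed
  qed
  have "ccc_poset (code ` P) s"
    unfolding ccc_poset_def
  proof (intro allI impI)
    fix X assume X: "X \<subseteq> code ` P" "uncountable X"
    define Y where "Y = {p \<in> P. code p \<in> X}"
    have XY: "X = code ` Y" using X by (auto simp: Y_def)
    then have "uncountable Y" using X by auto
    with P(3) obtain p1 p2 q where *: "p1 \<in> Y" "p2 \<in> Y" "p1 \<noteq> p2" "q \<in> P" "(p1, q) \<in> r" "(p2, q) \<in> r"
      unfolding ccc_poset_def by (metis (no_types, lifting) Y_def mem_Collect_eq subsetI)
    then show "\<exists>p1\<in>X. \<exists>p2\<in>X. p1 \<noteq> p2 \<and> (\<exists>q\<in>code ` P. (p1, q) \<in> s \<and> (p2, q) \<in> s)"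
      using code s by (intro bexI[of _ "code p1"] bexI[of _ "code p2"]) (auto simp: Y_def inj_on_def)
  qed
  moreover have "dense_in_poset (code ` P) s (code ` D \<xi>)" if "\<xi> \<in> Field \<kappa>" for \<xi>
    unfolding dense_in_poset_def
  proof (intro conjI ballI)
    have D\<xi>: "D \<xi> \<subseteq> P" "\<And>p. p \<in> P \<Longrightarrow> \<exists>d\<in>D \<xi>. (p, d) \<in> r"
      using D[OF that] by (auto simp: dense_in_poset_def)
    then show "code ` D \<xi> \<subseteq> code ` P" by auto
    fix x assume "x \<in> code ` P"
    then obtain p where p: "p \<in> P" "x = code p" by auto
    then obtain d where "d \<in> D \<xi>" "(p, d) \<in> r" using D\<xi>(2) by blast
    then show "\<exists>d\<in>code ` D \<xi>. (x, d) \<in> s" using p s D\<xi>(1) by blast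
  qed
  ultimately have "code ` P \<noteq> {} \<and> partial_order_on (code ` P) s \<and> ccc_poset (code ` P) s \<and>
      (\<forall>\<xi>\<in>Field \<kappa>. dense_in_poset (code ` P) s (code ` D \<xi>))"
    using P(1) po by simp
  from MA[unfolded martin_axiom_def, rule_format, OF this]
  obtain H where H: "H \<subseteq> code ` P" "directed_in_poset s H"
      "\<And>\<xi>. \<xi> \<in> Field \<kappa> \<Longrightarrow> H \<inter> code ` D \<xi> \<noteq> {}"
    by blast
  define G where "G = {p \<in> P. code p \<in> H}"
  have HG: "H = code ` G" using H by (auto simp: G_def)
  have "directed_in_poset r G"
    unfolding directed_in_poset_def
  proof (intro ballI)
    fix p q assume "p \<in> G" "q \<in> G"
    then obtain u where "u \<in> G" "(code p, code u) \<in> s" "(code q, code u) \<in> s"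
      using H(2) unfolding directed_in_poset_def HG by blast
    then show "\<exists>u\<in>G. (p, u) \<in> r \<and> (q, u) \<in> r"
      using s \<open>p \<in> G\<close> \<open>q \<in> G\<close> by (auto simp: G_def)
  qed
  moreover have "G \<inter> D \<xi> \<noteq> {}" if \<xi>: "\<xi> \<in> Field \<kappa>" for \<xi>
  proof -
    have "D \<xi> \<subseteq> P" using D[OF \<xi>] by (simp add: dense_in_poset_def)
    with H(3)[OF \<xi>] show ?thesis by (auto simp: G_def)
  qed
  ultimately show ?thesis by (intro exI[of _ G]) (auto simp: G_def)
qed

text \<open>
  A finite list of subsets of \<open>\<nat>\<close> is coded as the sequence of its entries in the rows from \<open>2\<close> on of
  \<open>\<nat> \<times> \<nat>\<close>; rows \<open>0\<close> and \<open>1\<close> hold the other component and the length.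
\<close>

lemma inj_finite_sets_of_nat_sets:
  "\<exists>code :: 'c::countable \<times> nat set set \<Rightarrow> nat set. inj_on code {(c, F). finite F}"
proof -
  define list :: "nat set set \<Rightarrow> nat set list" where "list F = (SOME xs. set xs = F)" for F
  have list: "set (list F) = F" if "finite F" for F
    unfolding list_def using someI_ex[OF finite_list[OF that]] .
  define code :: "'c \<times> nat set set \<Rightarrow> nat set" where
    "code = (\<lambda>(c, F). {prod_encode (0, Suc (to_nat c)), prod_encode (1, length (list F))} \<union>
       {prod_encode (i + 2, j) | i j. i < length (list F) \<and> j \<in> list F ! i})"
  have "inj_on code {(c, F). finite F}"
  proof (rule inj_onI, clarify)
    fix c F d G assume fin: "finite F" "finite G" and eq: "code (c, F) = code (d, G)"
    have mem: "prod_encode (i, j) \<in> code (c, F) \<longleftrightarrow>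
        (i = 0 \<and> j = Suc (to_nat c) \<or> i = 1 \<and> j = length (list F) \<or>
         i \<ge> 2 \<and> i - 2 < length (list F) \<and> j \<in> list F ! (i - 2))" for i j c F
      by (auto simp: code_def prod_encode_eq)
    have c: "c = d" using mem[of 0 "Suc (to_nat c)" c F] mem[of 0 "Suc (to_nat c)" d G] eq by simp
    have len: "length (list F) = length (list G)"
      using mem[of 1 "length (list F)" c F] mem[of 1 "length (list F)" d G] eq by simp
    have "list F ! i = list G ! i" if "i < length (list F)" for i
      using mem[of "i + 2" _ c F] mem[of "i + 2" _ d G] eq that len by auto
    then have "list F = list G" using len by (intro nth_equalityI) auto
    then show "c = d \<and> F = G" using list fin c by metis
  qed
  then show ?thesis by blast
qed

text \<open>
  A condition consists of measures for finitely many indices and of a finite set \<open>F\<close> of members of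
  \<open>\<B>\<close> for which all later measures have to be accurate. The sum over \<open>F\<close> is bounded by \<open>1\<close> from the
  length on, but the measures may have mass \<open>2\<close>: this slack makes conditions with the same measures
  compatible. The bound on \<open>card F\<close> forces long sequences of measures into a filter that meets
  infinitely many promises.
\<close>

definition promise_poset :: "nat set set \<Rightarrow> (nat set \<Rightarrow> nat \<Rightarrow> real) \<Rightarrow> ((nat \<times> rat) list list \<times> nat set set) set" where
  "promise_poset \<B> t = {(ms, F). F \<subseteq> \<B> \<and> finite F \<and> card F \<le> length ms \<and>
     (\<forall>n\<ge>length ms. (\<Sum>B\<in>F. \<bar>t B n\<bar>) \<le> 1) \<and>
     (\<forall>n<length ms. atomic_mass (ms ! n) \<le> 2 \<and> (\<forall>(x, c)\<in>set (ms ! n). n \<le> x))}"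

definition promise_order ::
  "nat set set \<Rightarrow> (nat set \<Rightarrow> nat \<Rightarrow> real) \<Rightarrow> ((nat \<times> rat) list list \<times> nat set set) rel" where
  "promise_order \<B> t = {((ms, F), (ms', F')). (ms, F) \<in> promise_poset \<B> t \<and> (ms', F') \<in> promise_poset \<B> t \<and>
     length ms \<le> length ms' \<and> take (length ms) ms' = ms \<and> F \<subseteq> F' \<and>
     (\<forall>n. length ms \<le> n \<and> n < length ms' \<longrightarrow>
        (\<forall>B\<in>F. \<bar>atomic_eval (ms' ! n) (indicator B) - t B n\<bar> \<le> 1 / (real n + 1)))}"

lemma promise_order_partial_order: "partial_order_on (promise_poset \<B> t) (promise_order \<B> t)"
  unfolding partial_order_on_def preorder_on_def
proof (intro conjI)
  show "promise_order \<B> t \<subseteq> promise_poset \<B> t \<times> promise_poset \<B> t"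
    by (auto simp: promise_order_def)
  show "refl_on (promise_poset \<B> t) (promise_order \<B> t)"
    by (auto simp: refl_on_def promise_order_def)
  show "antisym (promise_order \<B> t)"
    by (auto simp: antisym_def promise_order_def)
  show "trans (promise_order \<B> t)"
  proof (rule transI)
    fix x y z assume xy: "(x, y) \<in> promise_order \<B> t" and yz: "(y, z) \<in> promise_order \<B> t"
    obtain a F b G c H where e: "x = (a, F)" "y = (b, G)" "z = (c, H)" by (metis surj_pair)
    have ab: "length a \<le> length b" "take (length a) b = a" "F \<subseteq> G"
      "\<And>n B. \<lbrakk>length a \<le> n; n < length b; B \<in> F\<rbrakk> \<Longrightarrow> \<bar>atomic_eval (b ! n) (indicator B) - t B n\<bar> \<le> 1 / (real n + 1)"
      using xy unfolding e promise_order_def by auto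
    have bc: "length b \<le> length c" "take (length b) c = b" "G \<subseteq> H"
      "\<And>n B. \<lbrakk>length b \<le> n; n < length c; B \<in> G\<rbrakk> \<Longrightarrow> \<bar>atomic_eval (c ! n) (indicator B) - t B n\<bar> \<le> 1 / (real n + 1)"
      using yz unfolding e promise_order_def by auto
    have "c ! n = b ! n" if "n < length b" for n
      using bc(2) that by (metis nth_take)
    moreover have "take (length a) c = a"
      using ab bc by (metis min.absorb1 take_take)
    moreover have "\<bar>atomic_eval (c ! n) (indicator B) - t B n\<bar> \<le> 1 / (real n + 1)"
      if "length a \<le> n" "n < length c" "B \<in> F" for n B
      using ab(3) ab(4)[of n B] bc(4)[of n B] calculation(1)[of n] that by (cases "n < length b") auto
    moreover have "x \<in> promise_poset \<B> t" "z \<in> promise_poset \<B> t"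
      using xy yz by (auto simp: promise_order_def)
    ultimately show "(x, z) \<in> promise_order \<B> t"
      using ab bc unfolding e promise_order_def by simp
  qed
qed

text \<open>
  The promises of both conditions together may sum to more than \<open>1\<close> at finitely many indices. There,
  measures of mass at most \<open>1 + 1\<close> that respect both promises are put in; beyond, the sum over \<open>H\<close> is
  at most \<open>1\<close>. With \<open>F = G\<close> this also shows that promises can be added to any condition.
\<close>

lemma promise_poset_amalgamation:
  assumes ad: "almost_disjoint \<B>" and inf: "\<And>B. B \<in> \<B> \<Longrightarrow> infinite B"
    and t: "\<And>F. F \<subseteq> \<B> \<Longrightarrow> finite F \<Longrightarrow> \<forall>\<^sub>F n in sequentially. (\<Sum>B\<in>F. \<bar>t B n\<bar>) \<le> 1"
    and p: "(ms, F) \<in> promise_poset \<B> t" and q: "(ms, G) \<in> promise_poset \<B> t"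
    and H: "finite H" "H \<subseteq> \<B>" "F \<union> G \<subseteq> H"
  shows "\<exists>ms'. (ms', H) \<in> promise_poset \<B> t \<and> ((ms, F), (ms', H)) \<in> promise_order \<B> t \<and>
           ((ms, G), (ms', H)) \<in> promise_order \<B> t"
proof -
  have FG: "finite F" "finite G" "F \<subseteq> \<B>" "G \<subseteq> \<B>"
    using p q by (auto simp: promise_poset_def)
  have "\<exists>l. atomic_mass l \<le> (\<Sum>B\<in>F \<union> G. \<bar>t B n\<bar>) \<and> (\<forall>(x, c)\<in>set l. n \<le> x) \<and>
      (\<forall>B\<in>F \<union> G. \<bar>atomic_eval l (indicator B) - t B n\<bar> \<le> 1 / (real n + 1))" for n
    using FG by (intro atomic_measure_on_almost_disjoint[OF ad inf]) auto
  then obtain l where l: "\<And>n. atomic_mass (l n) \<le> (\<Sum>B\<in>F \<union> G. \<bar>t B n\<bar>)"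
      "\<And>n. \<forall>(x, c)\<in>set (l n). n \<le> x"
      "\<And>n B. B \<in> F \<union> G \<Longrightarrow> \<bar>atomic_eval (l n) (indicator B) - t B n\<bar> \<le> 1 / (real n + 1)"
    by metis
  obtain k0 where k0: "\<And>n. n \<ge> k0 \<Longrightarrow> (\<Sum>B\<in>H. \<bar>t B n\<bar>) \<le> 1"
    using t[OF H(2,1)] by (auto simp: eventually_sequentially)
  define k where "k = Max {k0, card H, length ms}"
  have k: "k0 \<le> k" "card H \<le> k" "length ms \<le> k" by (auto simp: k_def)
  define ms' where "ms' = ms @ map l [length ms..<k]"
  have len: "length ms' = k" using k by (simp add: ms'_def)
  have old: "ms' ! n = ms ! n" if "n < length ms" for n
    using that by (simp add: ms'_def nth_append)
  have new: "ms' ! n = l n" if "length ms \<le> n" "n < k" for n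
    using that by (simp add: ms'_def nth_append)
  have mass: "atomic_mass (l n) \<le> 2" if "length ms \<le> n" for n
  proof -
    have "(\<Sum>B\<in>F \<union> G. \<bar>t B n\<bar>) \<le> (\<Sum>B\<in>F. \<bar>t B n\<bar>) + (\<Sum>B\<in>G. \<bar>t B n\<bar>)"
    proof -
      have "0 \<le> (\<Sum>B\<in>F \<inter> G. \<bar>t B n\<bar>)" by (simp add: sum_nonneg)
      then show ?thesis
        using sum.union_inter[OF FG(1,2), of "\<lambda>B. \<bar>t B n\<bar>"] by linarith
    qed
    also have "\<dots> \<le> 1 + 1"
      using p q that by (intro add_mono) (auto simp: promise_poset_def)
    finally show ?thesis using l(1)[of n] by linarith
  qed
  have r: "(ms', H) \<in> promise_poset \<B> t"
    unfolding promise_poset_def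
  proof (clarsimp simp: len H k, intro conjI allI impI)
    fix n assume "k \<le> n"
    then show "(\<Sum>B\<in>H. \<bar>t B n\<bar>) \<le> 1" using k0 k by force
  next
    fix n assume n: "n < k"
    show "atomic_mass (ms' ! n) \<le> 2"
      using p old new mass n by (cases "n < length ms") (auto simp: promise_poset_def)
    show "\<forall>(x, c)\<in>set (ms' ! n). n \<le> x"
      using p old new l(2) n by (cases "n < length ms") (auto simp: promise_poset_def)
  qed
  moreover have "take (length ms) ms' = ms" by (simp add: ms'_def)
  ultimately show ?thesis
    using p q H k len new l(3)
    by (intro exI[of _ ms']) (auto simp: promise_order_def)
qed

text \<open>
  There are only countably many finite sequences of measures, so among uncountably many conditions two
  share theirs.
\<close>

lemma promise_poset_ccc:
  assumes ad: "almost_disjoint \<B>" and inf: "\<And>B. B \<in> \<B> \<Longrightarrow> infinite B"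
    and t: "\<And>F. F \<subseteq> \<B> \<Longrightarrow> finite F \<Longrightarrow> \<forall>\<^sub>F n in sequentially. (\<Sum>B\<in>F. \<bar>t B n\<bar>) \<le> 1"
  shows "ccc_poset (promise_poset \<B> t) (promise_order \<B> t)"
  unfolding ccc_poset_def
proof (intro allI impI)
  fix X assume X: "X \<subseteq> promise_poset \<B> t" "uncountable X"
  have "\<not> inj_on fst X"
    using X(2) countable_image_inj_on[of fst X] by auto
  then obtain ms F G where *: "(ms, F) \<in> X" "(ms, G) \<in> X" "F \<noteq> G"
    unfolding inj_on_def by (metis prod.collapse)
  with X have "(ms, F) \<in> promise_poset \<B> t" "(ms, G) \<in> promise_poset \<B> t" by auto
  moreover from this have "finite (F \<union> G)" "F \<union> G \<subseteq> \<B>" by (auto simp: promise_poset_def)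
  ultimately show "\<exists>p1\<in>X. \<exists>p2\<in>X. p1 \<noteq> p2 \<and> (\<exists>q\<in>promise_poset \<B> t.
      (p1, q) \<in> promise_order \<B> t \<and> (p2, q) \<in> promise_order \<B> t)"
    using promise_poset_amalgamation[OF ad inf t, of ms F G "F \<union> G"] * by blast
qed

lemma promise_poset_dense:
  assumes ad: "almost_disjoint \<B>" and inf: "\<And>B. B \<in> \<B> \<Longrightarrow> infinite B"
    and t: "\<And>F. F \<subseteq> \<B> \<Longrightarrow> finite F \<Longrightarrow> \<forall>\<^sub>F n in sequentially. (\<Sum>B\<in>F. \<bar>t B n\<bar>) \<le> 1"
    and B: "B \<in> \<B>"
  shows "dense_in_poset (promise_poset \<B> t) (promise_order \<B> t) {p \<in> promise_poset \<B> t. B \<in> snd p}"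
  unfolding dense_in_poset_def
proof (intro conjI ballI)
  fix p assume p: "p \<in> promise_poset \<B> t"
  obtain ms F where e: "p = (ms, F)" by force
  have "finite (insert B F)" "insert B F \<subseteq> \<B>" using p B by (auto simp: e promise_poset_def)
  then obtain ms' where "(ms', insert B F) \<in> promise_poset \<B> t" "(p, (ms', insert B F)) \<in> promise_order \<B> t"
    using promise_poset_amalgamation[OF ad inf t, of ms F F "insert B F"] p by (auto simp: e)
  then show "\<exists>d\<in>{p \<in> promise_poset \<B> t. B \<in> snd p}. (p, d) \<in> promise_order \<B> t"
    by force
qed auto

text \<open>
  A directed set of conditions that meets the dense set of each \<open>B \<in> \<B>\<close> defines one sequence of
  measures, which is infinite as soon as \<open>\<B>\<close> is. For finite \<open>\<B>\<close> the measures are written down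
  directly.
\<close>

lemma martin_axiom_atomic_measures:
  fixes \<B> :: "nat set set" and t :: "nat set \<Rightarrow> nat \<Rightarrow> real" and \<kappa> :: "'k rel"
  assumes MA: "martin_axiom TYPE(nat set) \<kappa>" and idx: "\<B> \<subseteq> b ` Field \<kappa>"
    and ad: "almost_disjoint \<B>" and inf: "\<And>B. B \<in> \<B> \<Longrightarrow> infinite B"
    and t: "\<And>F. F \<subseteq> \<B> \<Longrightarrow> finite F \<Longrightarrow> \<forall>\<^sub>F n in sequentially. (\<Sum>B\<in>F. \<bar>t B n\<bar>) \<le> 1"
  shows "\<exists>l. (\<forall>n. atomic_mass (l n) \<le> 2 \<and> (\<forall>(x, c)\<in>set (l n). n \<le> x)) \<and>
             (\<forall>B\<in>\<B>. (\<lambda>n. atomic_eval (l n) (indicator B) - t B n) \<longlonglongrightarrow> 0)"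
proof (cases "finite \<B>")
  case True
  have "\<exists>l. atomic_mass l \<le> (\<Sum>B\<in>\<B>. \<bar>t B n\<bar>) \<and> (\<forall>(x, c)\<in>set l. n \<le> x) \<and>
      (\<forall>B\<in>\<B>. \<bar>atomic_eval l (indicator B) - t B n\<bar> \<le> 1 / (real n + 1))" for n
    using True by (intro atomic_measure_on_almost_disjoint[OF ad inf]) auto
  then obtain l where l: "\<And>n. atomic_mass (l n) \<le> (\<Sum>B\<in>\<B>. \<bar>t B n\<bar>)"
      "\<And>n. \<forall>(x, c)\<in>set (l n). n \<le> x"
      "\<And>n B. B \<in> \<B> \<Longrightarrow> \<bar>atomic_eval (l n) (indicator B) - t B n\<bar> \<le> 1 / (real n + 1)"
    by metis
  \<comment> \<open>The finitely many indices at which the values sum to more than \<open>1\<close> get the zero measure.\<close>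
  define l' where "l' n = (if (\<Sum>B\<in>\<B>. \<bar>t B n\<bar>) \<le> 1 then l n else [])" for n
  have "(\<lambda>n. atomic_eval (l' n) (indicator B) - t B n) \<longlonglongrightarrow> 0" if "B \<in> \<B>" for B
  proof (rule Lim_null_comparison)
    show "\<forall>\<^sub>F n in sequentially. norm (atomic_eval (l' n) (indicator B) - t B n) \<le> 1 / (real n + 1)"
      using t[OF subset_refl True] by eventually_elim (use l(3) that in \<open>simp add: l'_def\<close>)
    show "(\<lambda>n. 1 / (real n + 1)) \<longlonglongrightarrow> 0"
      using LIMSEQ_inverse_real_of_nat by (simp add: inverse_eq_divide add.commute)
  qed
  moreover have "atomic_mass (l' n) \<le> 2 \<and> (\<forall>(x, c)\<in>set (l' n). n \<le> x)" for n
    using l(1)[of n] l(2)[of n] by (auto simp: l'_def atomic_mass_def)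
  ultimately show ?thesis by (intro exI[of _ l']) auto
next
  case False
  let ?P = "promise_poset \<B> t" and ?r = "promise_order \<B> t"
  obtain code :: "(nat \<times> rat) list list \<times> nat set set \<Rightarrow> nat set" where
    "inj_on code {(c, F). finite F}"
    using inj_finite_sets_of_nat_sets by blast
  then have code: "inj_on code ?P"
    by (rule inj_on_subset) (auto simp: promise_poset_def)
  have ne: "([], {}) \<in> ?P" by (auto simp: promise_poset_def)
  define D where "D \<xi> = {p \<in> ?P. b \<xi> \<in> \<B> \<longrightarrow> b \<xi> \<in> snd p}" for \<xi>
  have "dense_in_poset ?P ?r (D \<xi>)" for \<xi>
  proof (cases "b \<xi> \<in> \<B>")
    case True
    then show ?thesis using promise_poset_dense[OF ad inf t True] by (simp add: D_def)
  next
    case False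
    then show ?thesis
      using promise_order_partial_order[of \<B> t]
      by (auto simp: D_def dense_in_poset_def partial_order_on_def preorder_on_def refl_on_def)
  qed
  then obtain G where G: "G \<subseteq> ?P" "directed_in_poset ?r G" "\<And>\<xi>. \<xi> \<in> Field \<kappa> \<Longrightarrow> G \<inter> D \<xi> \<noteq> {}"
    using martin_axiom_transfer[OF MA code _ promise_order_partial_order promise_poset_ccc[OF ad inf t], of D] ne
    by blast
  have meet: "\<exists>p\<in>G. B \<in> snd p" if B: "B \<in> \<B>" for B
  proof -
    obtain \<xi> where "\<xi> \<in> Field \<kappa>" "B = b \<xi>" using idx B by blast
    then show ?thesis using G(3)[of \<xi>] B by (auto simp: D_def)
  qed
  have up: "\<exists>u\<in>G. (p, u) \<in> ?r \<and> (q, u) \<in> ?r" if "p \<in> G" "q \<in> G" for p q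
    using G(2) that by (auto simp: directed_in_poset_def)
  have finmeet: "\<exists>p\<in>G. F \<subseteq> snd p" if "finite F" "F \<subseteq> \<B>" for F
    using that
  proof (induction F rule: finite_induct)
    case empty
    from False obtain B where "B \<in> \<B>" by (metis ex_in_conv finite.emptyI)
    then show ?case using meet[of B] by auto
  next
    case (insert B F)
    then obtain p q where "p \<in> G" "F \<subseteq> snd p" "q \<in> G" "B \<in> snd q"
      using meet[of B] by blast
    moreover from this obtain u where "u \<in> G" "(p, u) \<in> ?r" "(q, u) \<in> ?r" using up by blast
    moreover from this have "snd p \<subseteq> snd u" "snd q \<subseteq> snd u" by (auto simp: promise_order_def)
    ultimately show ?case by blast
  qed
  have long: "\<exists>p\<in>G. n < length (fst p)" for n
  proof -
    obtain F where F: "F \<subseteq> \<B>" "finite F" "card F = Suc n"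
      using infinite_arbitrarily_large[OF False] by blast
    obtain p where p: "p \<in> G" "F \<subseteq> snd p" using finmeet[OF F(2,1)] by blast
    have "finite (snd p)" "card (snd p) \<le> length (fst p)" using p G(1) by (auto simp: promise_poset_def)
    then have "Suc n \<le> length (fst p)" using card_mono[of "snd p" F] p F by simp
    then show ?thesis using p by (intro bexI[of _ p]) auto
  qed
  have coherent: "fst p ! n = fst u ! n" if "(p, u) \<in> ?r" "n < length (fst p)" for p u n
    using that by (auto simp: promise_order_def) (metis nth_take)
  define l where "l n = fst (SOME p. p \<in> G \<and> n < length (fst p)) ! n" for n
  have l: "l n = fst p ! n" if "p \<in> G" "n < length (fst p)" for p n
  proof -
    define q where "q = (SOME p. p \<in> G \<and> n < length (fst p))"
    have q: "q \<in> G \<and> n < length (fst q)"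
      unfolding q_def by (rule someI[of _ p]) (use that in simp)
    then obtain u where "(p, u) \<in> ?r" "(q, u) \<in> ?r" using up[of p q] \<open>p \<in> G\<close> by auto
    then show ?thesis using coherent[of p u n] coherent[of q u n] q that by (simp add: l_def q_def)
  qed
  have "atomic_mass (l n) \<le> 2 \<and> (\<forall>(x, c)\<in>set (l n). n \<le> x)" for n
  proof -
    obtain p where p: "p \<in> G" "n < length (fst p)" using long by blast
    moreover obtain ms F where "p = (ms, F)" by force
    moreover from calculation have "(ms, F) \<in> promise_poset \<B> t" using G(1) by auto
    ultimately show ?thesis using l[OF p] by (simp add: promise_poset_def)
  qed
  moreover have "(\<lambda>n. atomic_eval (l n) (indicator B) - t B n) \<longlonglongrightarrow> 0" if B: "B \<in> \<B>" for B
  proof (rule Lim_null_comparison)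
    obtain p where p: "p \<in> G" "B \<in> snd p" using meet[OF B] by blast
    have "\<bar>atomic_eval (l n) (indicator B) - t B n\<bar> \<le> 1 / (real n + 1)" if n: "n \<ge> length (fst p)" for n
    proof -
      obtain q where q: "q \<in> G" "n < length (fst q)" using long by blast
      obtain u where u: "u \<in> G" "(p, u) \<in> ?r" "(q, u) \<in> ?r" using up[OF p(1) q(1)] by blast
      have "n < length (fst u)" using u(3) q by (auto simp: promise_order_def)
      then show ?thesis using l[OF u(1)] u(2) p(2) n by (auto simp: promise_order_def)
    qed
    then show "\<forall>\<^sub>F n in sequentially. norm (atomic_eval (l n) (indicator B) - t B n) \<le> 1 / (real n + 1)"
      by (auto simp: eventually_sequentially)
    show "(\<lambda>n. 1 / (real n + 1)) \<longlonglongrightarrow> 0"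
      using LIMSEQ_inverse_real_of_nat by (simp add: inverse_eq_divide add.commute)
  qed
  ultimately show ?thesis by blast
qed

section \<open>Lifting operators modulo null sequences\<close>

lemma almost_linear_minus:
  assumes "almost_linear K \<tau> c" and mu_bound: "\<And>g n. g \<in> C_space K \<Longrightarrow> \<bar>\<mu> g n\<bar> \<le> d * sup_norm (topspace K) g"
    and mu_add: "\<And>g h n. g \<in> C_space K \<Longrightarrow> h \<in> C_space K \<Longrightarrow> \<mu> (g + h) n = \<mu> g n + \<mu> h n"
    and mu_scale: "\<And>g a n. g \<in> C_space K \<Longrightarrow> \<mu> (a *\<^sub>R g) n = a * \<mu> g n" and d: "d \<ge> 0"
  shows "almost_linear K (\<lambda>g n. \<tau> g n - \<mu> g n) (c + d)"
proof -
  interpret almost_linear K \<tau> c by fact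
  show ?thesis
  proof
    fix g n assume g: "g \<in> C_space K"
    show "\<bar>\<tau> g n - \<mu> g n\<bar> \<le> (c + d) * sup_norm (topspace K) g"
      using bound[OF g, of n] mu_bound[OF g, of n] by (simp add: distrib_right)
  next
    fix g h assume gh: "g \<in> C_space K" "h \<in> C_space K"
    show "(\<lambda>n. \<tau> (g + h) n - \<mu> (g + h) n - (\<tau> g n - \<mu> g n + (\<tau> h n - \<mu> h n))) \<longlonglongrightarrow> 0"
      using add[OF gh] by (simp add: mu_add[OF gh] algebra_simps)
  next
    fix g a assume g: "g \<in> C_space K"
    show "(\<lambda>n. \<tau> (a *\<^sub>R g) n - \<mu> (a *\<^sub>R g) n - a * (\<tau> g n - \<mu> g n)) \<longlonglongrightarrow> 0"
      using scale[OF g, of a] by (simp add: mu_scale[OF g] algebra_simps)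
  qed (use compact c_nonneg d in auto)
qed

text \<open>
  The height \<open>m n\<close> is the largest \<open>m \<le> n\<close> for which the partial sum obeys the bound at \<open>n\<close>; each fixed
  number is eventually exceeded.
\<close>

lemma truncation_height:
  fixes t :: "nat \<Rightarrow> nat \<Rightarrow> real"
  assumes ev: "\<And>m. \<forall>\<^sub>F n in sequentially. (\<Sum>i<m. \<bar>t i n\<bar>) \<le> b" and b: "b \<ge> 0"
  shows "\<exists>m. (\<forall>n. (\<Sum>i<m n. \<bar>t i n\<bar>) \<le> b) \<and> (\<forall>i. \<forall>\<^sub>F n in sequentially. i < m n)"
proof -
  define S where "S n = {m. m \<le> n \<and> (\<Sum>i<m. \<bar>t i n\<bar>) \<le> b}" for n
  have S: "finite (S n)" "0 \<in> S n" for n using b by (auto simp: S_def)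
  define m where "m n = Max (S n)" for n
  have "m n \<in> S n" for n unfolding m_def using S by (intro Max_in) auto
  moreover have "\<forall>\<^sub>F n in sequentially. i < m n" for i
    using ev[of "Suc i"] eventually_ge_at_top[of "Suc i"]
  proof eventually_elim
    case (elim n)
    then have "Suc i \<in> S n" by (simp add: S_def)
    then show ?case using Max_ge[OF S(1)[of n], of "Suc i"] by (simp add: m_def)
  qed
  ultimately show ?thesis unfolding S_def by (intro exI[of _ m]) auto
qed

context almost_disjoint_stone
begin

text \<open>
  Removing the finite set \<open>M\<close> of overlaps makes the members of \<open>F\<close> disjoint and, since \<open>\<tau>\<close> is null
  on singletons, changes the values of \<open>\<tau>\<close> by null sequences only.
\<close>

lemma eventually_limit_part_bounded:
  assumes al: "almost_linear K \<tau> c" and single: "\<And>i. (\<lambda>n. \<tau> (char_fun {i}) n) \<longlonglongrightarrow> 0"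
    and F: "F \<subseteq> \<B>" "finite F"
  shows "\<forall>\<^sub>F n in sequentially. (\<Sum>B\<in>F. \<bar>\<tau> (char_fun B) n\<bar>) \<le> c + 2"
proof -
  interpret T: almost_linear K \<tau> c by fact
  define M where "M = (\<Union>B\<in>F. \<Union>A\<in>F - {B}. B \<inter> A)"
  have M: "finite M" unfolding M_def using F by (intro finite_UN_I almost_disjointD[OF ad]) auto
  have disj: "disjoint_family_on (\<lambda>B. B - M) F"
    unfolding disjoint_family_on_def M_def by blast
  have BM: "B - M \<in> \<AA>" "B \<inter> M \<in> \<AA>" if "B \<in> F" for B
    using that F M member_algebra finite_algebra by auto
  have fin: "(\<lambda>n. \<tau> (char_fun N) n) \<longlonglongrightarrow> 0" if "finite N" for N
    using that
  proof (induction N rule: finite_induct)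
    case empty
    then show ?case using T.zero by (simp add: char_fun_empty zero_fun_def)
  next
    case (insert i N)
    have "(\<lambda>n. \<tau> (char_fun {i} + char_fun N) n - (\<tau> (char_fun {i}) n + \<tau> (char_fun N) n) +
        (\<tau> (char_fun {i}) n + \<tau> (char_fun N) n)) \<longlonglongrightarrow> 0 + (0 + 0)"
      using insert by (intro tendsto_add T.add single char_fun_C finite_algebra) auto
    then have "(\<lambda>n. \<tau> (char_fun {i} + char_fun N) n) \<longlonglongrightarrow> 0" by simp
    moreover have "char_fun (insert i N) = char_fun {i} + char_fun N"
      using insert.hyps char_fun_Un[of "{i}" N] by (simp add: finite_algebra)
    ultimately show ?case by (simp only:)
  qed
  have close: "(\<lambda>n. \<tau> (char_fun B) n - \<tau> (char_fun (B - M)) n) \<longlonglongrightarrow> 0" if B: "B \<in> F" for B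
  proof -
    have "(\<lambda>n. \<tau> (char_fun (B - M) + char_fun (B \<inter> M)) n - (\<tau> (char_fun (B - M)) n + \<tau> (char_fun (B \<inter> M)) n)
        + \<tau> (char_fun (B \<inter> M)) n) \<longlonglongrightarrow> 0 + 0"
      using M BM[OF B] by (intro tendsto_add T.add fin char_fun_C) auto
    moreover have "(B - M) \<inter> (B \<inter> M) = {}" "(B - M) \<union> (B \<inter> M) = B" by auto
    then have "char_fun (B - M) + char_fun (B \<inter> M) = char_fun B"
      using char_fun_Un[OF BM[OF B]] by metis
    ultimately show ?thesis by simp
  qed
  have "(\<lambda>n. \<Sum>B\<in>F. \<bar>\<tau> (char_fun B) n - \<tau> (char_fun (B - M)) n\<bar>) \<longlonglongrightarrow> (\<Sum>B\<in>F. 0)"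
    using close by (intro tendsto_sum tendsto_rabs_zero)
  then have "\<forall>\<^sub>F n in sequentially. (\<Sum>B\<in>F. \<bar>\<tau> (char_fun B) n - \<tau> (char_fun (B - M)) n\<bar>) < 1"
    by (rule order_tendstoD(2)) simp
  moreover have "\<forall>\<^sub>F n in sequentially. (\<Sum>B\<in>F. \<bar>\<tau> (char_fun (B - M)) n\<bar>) \<le> c + 1"
    using F BM disj by (intro T.eventually_sum_abs_le char_fun_C sum_char_fun_le) auto
  ultimately show ?thesis
  proof eventually_elim
    case (elim n)
    have "(\<Sum>B\<in>F. \<bar>\<tau> (char_fun B) n\<bar>) \<le>
        (\<Sum>B\<in>F. \<bar>\<tau> (char_fun B) n - \<tau> (char_fun (B - M)) n\<bar> + \<bar>\<tau> (char_fun (B - M)) n\<bar>)"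
      by (intro sum_mono) linarith
    also have "\<dots> = (\<Sum>B\<in>F. \<bar>\<tau> (char_fun B) n - \<tau> (char_fun (B - M)) n\<bar>) + (\<Sum>B\<in>F. \<bar>\<tau> (char_fun (B - M)) n\<bar>)"
      by (rule sum.distrib)
    finally show ?case using elim by linarith
  qed
qed

lemma close_if_close_on_generators:
  assumes al: "almost_linear K \<tau> c"
    and E_add: "\<And>g h n. g \<in> C_space K \<Longrightarrow> h \<in> C_space K \<Longrightarrow> E (g + h) n = E g n + E h n"
    and E_scale: "\<And>g a n. g \<in> C_space K \<Longrightarrow> E (a *\<^sub>R g) n = a * E g n"
    and E_bound: "\<And>g n. g \<in> C_space K \<Longrightarrow> \<bar>E g n\<bar> \<le> d * sup_norm (topspace K) g"
    and one: "(\<lambda>n. E (char_fun UNIV) n - \<tau> (char_fun UNIV) n) \<longlonglongrightarrow> 0"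
    and single: "\<And>i. (\<lambda>n. E (char_fun {i}) n - \<tau> (char_fun {i}) n) \<longlonglongrightarrow> 0"
    and member: "\<And>B. B \<in> \<B> \<Longrightarrow> (\<lambda>n. E (char_fun B) n - \<tau> (char_fun B) n) \<longlonglongrightarrow> 0"
    and g: "g \<in> C_space K"
  shows "(\<lambda>n. E g n - \<tau> g n :: real) \<longlonglongrightarrow> 0"
proof -
  interpret T: almost_linear K \<tau> c by fact
  let ?G = "{g \<in> C_space K. (\<lambda>n. E g n - \<tau> g n) \<longlonglongrightarrow> 0}"
  have sub: "subspace ?G"
    by (intro T.subspace_close E_add E_scale)
  have gen: "char_fun UNIV \<in> ?G" "char_fun {i} \<in> ?G" "B \<in> \<B> \<Longrightarrow> char_fun B \<in> ?G" for i B
    using one single member by (auto intro!: char_fun_C simp: finite_algebra member_algebra)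
  show ?thesis
  proof (rule T.close_limit[OF E_add E_bound g])
    fix \<epsilon> :: real assume \<epsilon>: "\<epsilon> > 0"
    obtain F N a b where F: "F \<subseteq> \<B>" "finite F" "finite N" and
      near: "\<forall>U\<in>topspace K. \<bar>g U - (g infty * char_fun UNIV U + (\<Sum>B\<in>F. a B * char_fun B U) +
        (\<Sum>n\<in>N. b n * char_fun {n} U))\<bar> \<le> \<epsilon>"
      using C_space_approximation[OF g \<epsilon>] by (elim exE conjE) (rule that)
    let ?s = "g infty *\<^sub>R char_fun UNIV + (\<Sum>B\<in>F. a B *\<^sub>R char_fun B) + (\<Sum>n\<in>N. b n *\<^sub>R char_fun {n})"
    have "?s \<in> ?G"
      using F gen by (intro subspace_add[OF sub] subspace_scale[OF sub] subspace_sum[OF sub]) auto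
    moreover have "\<bar>g U - ?s U\<bar> \<le> \<epsilon>" if "U \<in> topspace K" for U
      using near[rule_format, OF that] by (simp add: sum_fun_apply scaleR_fun_def)
    ultimately show "\<exists>s\<in>C_space K. (\<lambda>n. E s n - \<tau> s n) \<longlonglongrightarrow> 0 \<and> (\<forall>x\<in>topspace K. \<bar>g x - s x\<bar> \<le> \<epsilon>)"
      by (intro bexI[of _ ?s]) auto
  qed
qed

text \<open>
  The functions \<open>char_fun UNIV\<close>, \<open>char_fun {i}\<close> and \<open>char_fun B\<close> span a dense subspace, so three kinds of
  values have to be matched. Singletons are matched by measures \<open>\<mu>\<close> on the isolated points, the
  constant function by multiples of the evaluation at \<open>infty\<close>, and the members of \<open>\<B>\<close> by the measures
  that Martin's axiom provides. The supports of the latter move to infinity and so do not disturb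
  the singletons, and evaluation at \<open>infty\<close> does not see the singletons or the members of \<open>\<B>\<close>.
\<close>

theorem lifting_modulo_c0:
  fixes \<kappa> :: "'k rel"
  assumes MA: "martin_axiom TYPE(nat set) \<kappa>" and idx: "\<B> \<subseteq> b ` Field \<kappa>"
    and al: "almost_linear K \<tau> c"
  shows "\<exists>E d. (\<forall>g\<in>C_space K. \<forall>h\<in>C_space K. \<forall>n. E (g + h) n = E g n + E h n) \<and>
           (\<forall>a. \<forall>g\<in>C_space K. \<forall>n. E (a *\<^sub>R g) n = a * E g n) \<and>
           (\<forall>g\<in>C_space K. \<forall>n. \<bar>E g n\<bar> \<le> d * sup_norm (topspace K) g) \<and>
           (\<forall>g\<in>C_space K. (\<lambda>n. E g n - \<tau> g n :: real) \<longlonglongrightarrow> 0)"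
proof -
  interpret T: almost_linear K \<tau> c by fact
  let ?C = "C_space K" and ?N = "sup_norm (topspace K)"
  have pt: "\<bar>g U\<bar> \<le> ?N g" if "g \<in> ?C" for g U
    using C_space_le_sup_norm[OF compact_K that] .
  have one: "char_fun UNIV \<in> ?C" by (intro char_fun_C) auto
  have single: "char_fun {i} \<in> ?C" for i by (intro char_fun_C finite_algebra) auto

  \<comment> \<open>Matching the singletons: the truncation keeps the total mass at most \<open>c + 1\<close>.\<close>
  define t where "t i n = \<tau> (char_fun {i}) n" for i n
  have "\<forall>\<^sub>F n in sequentially. (\<Sum>i<m. \<bar>t i n\<bar>) \<le> c + 1" for m
    unfolding t_def
    by (intro T.eventually_sum_abs_le sum_char_fun_le)
      (auto simp: single finite_algebra disjoint_family_on_def)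
  then obtain m where m: "\<And>n. (\<Sum>i<m n. \<bar>t i n\<bar>) \<le> c + 1" "\<And>i. \<forall>\<^sub>F n in sequentially. i < m n"
    using truncation_height[of t "c + 1"] T.c_nonneg by auto
  define \<mu> where "\<mu> g n = (\<Sum>i<m n. t i n * g (principal i))" for g :: "nat set set \<Rightarrow> real" and n
  have mu_bound: "\<bar>\<mu> g n\<bar> \<le> (c + 1) * ?N g" if g: "g \<in> ?C" for g n
  proof -
    have "\<bar>\<mu> g n\<bar> \<le> (\<Sum>i<m n. \<bar>t i n\<bar> * ?N g)"
      unfolding \<mu>_def using pt[OF g] by (intro sum_abs[THEN order_trans] sum_mono) (simp add: abs_mult mult_left_mono)
    also have "\<dots> = (\<Sum>i<m n. \<bar>t i n\<bar>) * ?N g" by (simp add: sum_distrib_right)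
    also have "\<dots> \<le> (c + 1) * ?N g"
      using m(1) pt[OF g] by (intro mult_right_mono) (auto intro: order_trans[OF abs_ge_zero])
    finally show ?thesis .
  qed
  have mu_add: "\<mu> (g + h) n = \<mu> g n + \<mu> h n" for g h n
    by (simp add: \<mu>_def algebra_simps sum.distrib)
  have mu_scale: "\<mu> (a *\<^sub>R g) n = a * \<mu> g n" for a g n
    by (simp add: \<mu>_def scaleR_fun_def sum_distrib_left mult_ac)
  have mu_single: "\<forall>\<^sub>F n in sequentially. \<mu> (char_fun {i}) n = t i n" for i
    using m(2)[of i]
  proof eventually_elim
    case (elim n)
    have "\<mu> (char_fun {i}) n = (\<Sum>j<m n. if j = i then t i n else 0)"
      unfolding \<mu>_def by (intro sum.cong) (auto simp: char_fun_simps finite_algebra)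
    then show ?case using elim by simp
  qed

  \<comment> \<open>The remainder is corrected by evaluation at \<open>infty\<close> so as to vanish on constants.\<close>
  define \<tau>1 where "\<tau>1 g n = \<tau> g n - \<mu> g n" for g n
  have al1: "almost_linear K \<tau>1 (c + (c + 1))"
    unfolding \<tau>1_def[abs_def] using T.c_nonneg
    by (intro almost_linear_minus al) (auto simp: mu_add mu_scale mu_bound)
  interpret T1: almost_linear K \<tau>1 "c + (c + 1)" by (rule al1)
  define \<tau>2 where "\<tau>2 g n = \<tau>1 g n - \<tau>1 (char_fun UNIV) n * g infty" for g n
  have N1: "?N (char_fun UNIV) \<le> 1"
    by (intro sup_norm_least) (auto simp: char_fun_def indicator_def)
  have tau1_one: "\<bar>\<tau>1 (char_fun UNIV) n\<bar> \<le> c + (c + 1)" for n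
    using order_trans[OF T1.bound[OF one, of n] mult_left_mono[OF N1 T1.c_nonneg]] by simp
  have al2: "almost_linear K \<tau>2 (c + (c + 1) + (c + (c + 1)))"
    unfolding \<tau>2_def[abs_def]
  proof (intro almost_linear_minus al1)
    fix g n assume g: "g \<in> ?C"
    show "\<bar>\<tau>1 (char_fun UNIV) n * g infty\<bar> \<le> (c + (c + 1)) * ?N g"
      using tau1_one[of n] pt[OF g, of infty] T1.c_nonneg by (simp only: abs_mult) (intro mult_mono, auto)
  qed (use T1.c_nonneg in \<open>auto simp: algebra_simps scaleR_fun_def\<close>)
  have single2: "(\<lambda>n. \<tau>2 (char_fun {i}) n) \<longlonglongrightarrow> 0" for i
  proof (rule tendsto_eventually)
    show "\<forall>\<^sub>F n in sequentially. \<tau>2 (char_fun {i}) n = 0"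
      using mu_single[of i] by eventually_elim (simp add: \<tau>2_def \<tau>1_def t_def char_fun_simps)
  qed

  \<comment> \<open>Here \<open>r\<close> is the eventual bound for sums of values on members of \<open>\<B>\<close>; dividing by it normalizes
    the bound to \<open>1\<close>.\<close>
  define r where "r = c + (c + 1) + (c + (c + 1)) + 2"
  have r: "r > 0" using T.c_nonneg by (simp add: r_def)
  define s where "s B n = \<tau>2 (char_fun B) n / r" for B n
  have s: "\<forall>\<^sub>F n in sequentially. (\<Sum>B\<in>F. \<bar>s B n\<bar>) \<le> 1" if "F \<subseteq> \<B>" "finite F" for F
    using eventually_limit_part_bounded[OF al2 single2 that]
  proof eventually_elim
    case (elim n)
    then have "(\<Sum>B\<in>F. \<bar>\<tau>2 (char_fun B) n\<bar>) \<le> r" unfolding r_def by simp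
    then show ?case using r by (simp add: s_def sum_divide_distrib[symmetric])
  qed
  have "\<exists>l. (\<forall>n. atomic_mass (l n) \<le> 2 \<and> (\<forall>(x, c)\<in>set (l n). n \<le> x)) \<and>
      (\<forall>B\<in>\<B>. (\<lambda>n. atomic_eval (l n) (indicator B) - s B n) \<longlonglongrightarrow> 0)"
    by (rule martin_axiom_atomic_measures[OF MA idx ad]) (simp_all add: inf s)
  then obtain l where l: "\<And>n. atomic_mass (l n) \<le> 2" "\<And>n. \<forall>(x, c)\<in>set (l n). n \<le> x"
      "\<And>B. B \<in> \<B> \<Longrightarrow> (\<lambda>n. atomic_eval (l n) (indicator B) - s B n) \<longlonglongrightarrow> 0"
    by blast
  define \<nu> where "\<nu> g n = r * atomic_eval (l n) (\<lambda>i. g (principal i))" for g :: "nat set set \<Rightarrow> real" and n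
  have nu_bound: "\<bar>\<nu> g n\<bar> \<le> (2 * r) * ?N g" if g: "g \<in> ?C" for g n
  proof -
    have "\<bar>atomic_eval (l n) (\<lambda>i. g (principal i))\<bar> \<le> atomic_mass (l n) * ?N g"
      using pt[OF g] by (intro atomic_eval_bound)
    also have "\<dots> \<le> 2 * ?N g"
      using l(1) pt[OF g] by (intro mult_right_mono) (auto intro: order_trans[OF abs_ge_zero])
    finally show ?thesis using r by (simp add: \<nu>_def abs_mult)
  qed
  have nu_add: "\<nu> (g + h) n = \<nu> g n + \<nu> h n" for g h n
    by (simp add: \<nu>_def atomic_eval_add algebra_simps)
  have nu_scale: "\<nu> (a *\<^sub>R g) n = a * \<nu> g n" for a g n
    by (simp add: \<nu>_def atomic_eval_scale scaleR_fun_def)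
  have nu_single: "\<forall>\<^sub>F n in sequentially. \<nu> (char_fun {i}) n = 0" for i
    using eventually_gt_at_top[of i]
  proof eventually_elim
    case (elim n)
    have "(\<Sum>(x, c)\<leftarrow>l n. real_of_rat c * char_fun {i} (principal x)) = (\<Sum>(x, c)\<leftarrow>l n. 0)"
      using l(2)[of n] elim
      by (intro arg_cong[of _ _ sum_list] map_cong) (auto simp: char_fun_simps finite_algebra)
    then show ?case by (simp add: \<nu>_def atomic_eval_def sum_list_0 case_prod_unfold)
  qed

  \<comment> \<open>The coefficient at \<open>infty\<close> makes \<open>E\<close> and \<open>\<tau>\<close> agree exactly on constants.\<close>
  define E where "E g n = \<mu> g n + \<nu> g n + (\<tau>1 (char_fun UNIV) n - \<nu> (char_fun UNIV) n) * g infty" for g n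
  have E_add: "E (g + h) n = E g n + E h n" for g h n
    by (simp add: E_def mu_add nu_add algebra_simps)
  have E_scale: "E (a *\<^sub>R g) n = a * E g n" for a g n
    unfolding E_def mu_scale nu_scale by (simp add: scaleR_fun_def algebra_simps)
  define d where "d = (c + 1) + 2 * r + ((c + (c + 1)) + 2 * r)"
  have E_bound: "\<bar>E g n\<bar> \<le> d * ?N g" if g: "g \<in> ?C" for g n
  proof -
    have "\<bar>\<nu> (char_fun UNIV) n\<bar> \<le> 2 * r"
      using nu_bound[OF one, of n] mult_left_mono[OF N1, of "2 * r"] r by linarith
    then have "\<bar>(\<tau>1 (char_fun UNIV) n - \<nu> (char_fun UNIV) n) * g infty\<bar> \<le> ((c + (c + 1)) + 2 * r) * ?N g"
      unfolding abs_mult using tau1_one[of n] pt[OF g, of infty] T1.c_nonneg r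
      by (intro mult_mono) auto
    then show ?thesis
      using mu_bound[OF g, of n] nu_bound[OF g, of n] unfolding E_def d_def by (simp add: distrib_right)
  qed
  have E_one: "(\<lambda>n. E (char_fun UNIV) n - \<tau> (char_fun UNIV) n) \<longlonglongrightarrow> 0"
    using infty_in by (simp add: E_def \<tau>1_def char_fun_simps)
  have E_single: "(\<lambda>n. E (char_fun {i}) n - \<tau> (char_fun {i}) n) \<longlonglongrightarrow> 0" for i
  proof (rule tendsto_eventually)
    show "\<forall>\<^sub>F n in sequentially. E (char_fun {i}) n - \<tau> (char_fun {i}) n = 0"
      using mu_single[of i] nu_single[of i]
      by eventually_elim (simp add: E_def t_def char_fun_simps)
  qed
  have E_member: "(\<lambda>n. E (char_fun B) n - \<tau> (char_fun B) n) \<longlonglongrightarrow> 0" if B: "B \<in> \<B>" for B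
  proof -
    have "\<nu> (char_fun B) n = r * atomic_eval (l n) (indicator B)" for n
      using B by (simp add: \<nu>_def char_fun_simps member_algebra)
    then have "E (char_fun B) n - \<tau> (char_fun B) n = r * (atomic_eval (l n) (indicator B) - s B n)" for n
      using B r by (simp add: E_def s_def \<tau>2_def \<tau>1_def char_fun_simps field_simps)
    then show ?thesis
      using l(3)[OF B, THEN tendsto_mult_right_zero, of r] by simp
  qed
  have "(\<lambda>n. E g n - \<tau> g n) \<longlonglongrightarrow> 0" if "g \<in> ?C" for g
    by (rule close_if_close_on_generators[OF al E_add E_scale E_bound E_one E_single E_member that])
  then show ?thesis
    using E_add E_scale E_bound by (intro exI[of _ E] exI[of _ d]) auto
qed

end

section \<open>Riesz representation by atomic measures\<close>

sublocale almost_disjoint_stone \<subseteq> discrete_borel K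
  by unfold_locales (rule borel_sets_K)

lemma abs_summable_if_bounded:
  fixes f :: "'z \<Rightarrow> real"
  assumes "\<And>F. finite F \<Longrightarrow> F \<subseteq> A \<Longrightarrow> (\<Sum>x\<in>F. \<bar>f x\<bar>) \<le> 1"
  shows "(\<lambda>x. \<bar>f x\<bar>) summable_on A"
  using assms by (intro nonneg_bdd_above_summable_on) (auto intro!: bdd_aboveI2[of _ _ 1])

text \<open>
  The Riesz representation theorem for \<open>K\<close>: a functional in the unit ball of the dual of \<open>C(K)\<close> is
  integration with respect to an atomic measure. The mass of an isolated point is the value on its
  characteristic function; the mass of a limit point is what is left of the value on \<open>B\<close> when the
  masses of the isolated points are taken away, and the mass of \<open>infty\<close> is what is left of the value
  on \<open>1\<close>.
\<close>

locale stone_functional = almost_disjoint_stone +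
  fixes \<phi> :: "(nat set set \<Rightarrow> real) \<Rightarrow> real"
  assumes phi_add: "\<And>g h. g \<in> C_space K \<Longrightarrow> h \<in> C_space K \<Longrightarrow> \<phi> (g + h) = \<phi> g + \<phi> h"
    and phi_scale: "\<And>g a. g \<in> C_space K \<Longrightarrow> \<phi> (a *\<^sub>R g) = a * \<phi> g"
    and phi_bound: "\<And>g. g \<in> C_space K \<Longrightarrow> \<bar>\<phi> g\<bar> \<le> sup_norm (topspace K) g"
begin

definition charge :: "nat set \<Rightarrow> real" where "charge X = \<phi> (char_fun X)"

lemma charge_Un: "X \<in> \<AA> \<Longrightarrow> Y \<in> \<AA> \<Longrightarrow> X \<inter> Y = {} \<Longrightarrow> charge (X \<union> Y) = charge X + charge Y"
  by (simp add: charge_def char_fun_Un phi_add char_fun_C)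

lemma phi_sum:
  assumes "finite J" "\<And>j. j \<in> J \<Longrightarrow> f j \<in> C_space K"
  shows "\<phi> (\<Sum>j\<in>J. s j *\<^sub>R f j) = (\<Sum>j\<in>J. s j * \<phi> (f j))"
  using assms
proof (induction J rule: finite_induct)
  case empty
  then show ?case using phi_scale[OF subspace_0[OF subspace_C_space], of 0] by (simp add: zero_fun_def)
next
  case (insert j J)
  have "\<phi> (s j *\<^sub>R f j + (\<Sum>j\<in>J. s j *\<^sub>R f j)) = \<phi> (s j *\<^sub>R f j) + \<phi> (\<Sum>j\<in>J. s j *\<^sub>R f j)"
    using insert.prems by (intro phi_add subspace_scale subspace_sum subspace_C_space) auto
  then show ?case using insert phi_scale by (simp add: plus_fun_def)
qed

lemma sum_abs_charge_le:
  assumes J: "finite J" "\<And>j. j \<in> J \<Longrightarrow> X j \<in> \<AA>" "disjoint_family_on X J"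
  shows "(\<Sum>j\<in>J. \<bar>charge (X j)\<bar>) \<le> 1"
proof -
  define s where "s j = sgn (charge (X j))" for j
  define g where "g = (\<Sum>j\<in>J. s j *\<^sub>R char_fun (X j))"
  have gC: "g \<in> C_space K"
    unfolding g_def using J by (intro subspace_sum subspace_scale subspace_C_space char_fun_C)
  have "sup_norm (topspace K) g \<le> 1"
  proof (rule sup_norm_least)
    fix U assume U: "U \<in> topspace K"
    have g: "g U = (\<Sum>j\<in>J. s j * char_fun (X j) U)"
      by (simp add: g_def sum_fun_apply scaleR_fun_def)
    have "\<bar>g U\<bar> \<le> (\<Sum>j\<in>J. \<bar>char_fun (X j) U\<bar>)"
      unfolding g by (intro sum_abs[THEN order_trans] sum_mono) (simp add: s_def abs_mult sgn_if)
    then show "\<bar>g U\<bar> \<le> 1" using sum_char_fun_le[OF J, of U] by linarith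
  qed simp
  then have "\<bar>\<phi> g\<bar> \<le> 1" using phi_bound[OF gC] by linarith
  moreover have "\<phi> g = (\<Sum>j\<in>J. s j * charge (X j))"
    unfolding g_def charge_def using J by (intro phi_sum char_fun_C) auto
  moreover have "(\<Sum>j\<in>J. s j * charge (X j)) = (\<Sum>j\<in>J. \<bar>charge (X j)\<bar>)"
    by (intro sum.cong) (auto simp: s_def sgn_if)
  ultimately show ?thesis by linarith
qed

text \<open>
  If each \<open>w U\<close> is a cluster value of \<open>charge\<close> along the neighbourhoods of \<open>U\<close>, then disjoint small
  neighbourhoods of finitely many points show that the absolute values sum to at most \<open>1\<close>, the
  bound for the norm of the functional. This covers all three kinds of points, and it provides the summability
  needed to define the mass of the next kind.
\<close>

lemma finite_point_masses:
  assumes P: "finite P" "P \<subseteq> topspace K"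
    and w: "\<And>U X \<epsilon>. U \<in> P \<Longrightarrow> X \<in> U \<Longrightarrow> \<epsilon> > 0 \<Longrightarrow> \<exists>Y\<in>U. Y \<subseteq> X \<and> \<bar>charge Y - w U\<bar> \<le> \<epsilon>"
  shows "(\<Sum>U\<in>P. \<bar>w U\<bar>) \<le> 1"
proof (rule field_le_epsilon)
  fix \<epsilon> :: real assume \<epsilon>: "\<epsilon> > 0"
  obtain Z where Z: "\<And>U. U \<in> P \<Longrightarrow> Z U \<in> U" "disjoint_family_on Z P"
    using separate_finitely_many[OF P] by blast
  define \<delta> where "\<delta> = \<epsilon> / (real (card P) + 1)"
  have \<delta>: "\<delta> > 0" using \<epsilon> by (simp add: \<delta>_def)
  have "\<exists>Y. Y \<in> U \<and> Y \<subseteq> Z U \<and> \<bar>charge Y - w U\<bar> \<le> \<delta>" if "U \<in> P" for U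
    using w[OF that Z(1)[OF that] \<delta>] by blast
  then obtain Y where Y: "\<And>U. U \<in> P \<Longrightarrow> Y U \<in> U" "\<And>U. U \<in> P \<Longrightarrow> Y U \<subseteq> Z U"
    "\<And>U. U \<in> P \<Longrightarrow> \<bar>charge (Y U) - w U\<bar> \<le> \<delta>" by metis
  have "(\<Sum>U\<in>P. \<bar>w U\<bar>) \<le> (\<Sum>U\<in>P. \<bar>charge (Y U)\<bar> + \<delta>)"
    using Y(3) by (intro sum_mono) (smt (verit))
  also have "\<dots> = (\<Sum>U\<in>P. \<bar>charge (Y U)\<bar>) + real (card P) * \<delta>" by (simp add: sum.distrib)
  also have "(\<Sum>U\<in>P. \<bar>charge (Y U)\<bar>) \<le> 1"
  proof (rule sum_abs_charge_le)
    show "Y U \<in> \<AA>" if "U \<in> P" for U using Y(1)[OF that] P that by (intro ultra_in_algebra[of U]) auto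
    show "disjoint_family_on Y P"
      using Z(2) Y(2) unfolding disjoint_family_on_def by (metis (no_types) Int_mono subset_empty)
  qed (rule P)
  also have "real (card P) * \<delta> \<le> \<epsilon>" using \<epsilon> by (simp add: \<delta>_def field_simps)
  finally show "(\<Sum>U\<in>P. \<bar>w U\<bar>) \<le> 1 + \<epsilon>" by simp
qed

abbreviation atom :: "nat \<Rightarrow> real" where "atom n \<equiv> charge {n}"

lemma atom_summable: "(\<lambda>n. \<bar>atom n\<bar>) summable_on X" "atom summable_on X"
proof -
  show *: "(\<lambda>n. \<bar>atom n\<bar>) summable_on X" for X
    by (intro abs_summable_if_bounded sum_abs_charge_le) (auto simp: disjoint_family_on_def finite_algebra)
  show "atom summable_on X" using abs_summable_summable[of atom X] *[of X] by simp
qed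

text \<open>
  The part of the charge that is not carried by isolated points. It is additive and vanishes on finite
  sets, so it does not depend on finitely many points.
\<close>

definition limit_part :: "nat set \<Rightarrow> real" where "limit_part X = charge X - infsum atom X"

lemma limit_part_Un: "X \<in> \<AA> \<Longrightarrow> Y \<in> \<AA> \<Longrightarrow> X \<inter> Y = {} \<Longrightarrow> limit_part (X \<union> Y) = limit_part X + limit_part Y"
  by (simp add: limit_part_def charge_Un infsum_Un_disjoint atom_summable)

lemma limit_part_finite: "finite X \<Longrightarrow> limit_part X = 0"
proof (induction X rule: finite_induct)
  case empty
  show ?case using limit_part_Un[of "{}" "{}"] by simp
next
  case (insert n X)
  have "limit_part {n} = 0" by (simp add: limit_part_def)
  then show ?case using insert limit_part_Un[of "{n}" X] by (simp add: finite_algebra)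
qed

lemma limit_part_UN:
  assumes "finite J" "\<And>j. j \<in> J \<Longrightarrow> X j \<in> \<AA>" "disjoint_family_on X J"
  shows "limit_part (\<Union>j\<in>J. X j) = (\<Sum>j\<in>J. limit_part (X j))"
  using assms
proof (induction J rule: finite_induct)
  case (insert j J)
  have "X j \<inter> (\<Union>j\<in>J. X j) = {}" using insert by (auto simp: disjoint_family_on_def)
  moreover have "disjoint_family_on X J" using insert.prems by (auto simp: disjoint_family_on_def)
  ultimately show ?case using insert limit_part_Un[of "X j" "\<Union>j\<in>J. X j"] by (auto intro: finite_UN)
qed (simp add: limit_part_finite)

lemma limit_part_Diff_finite:
  assumes X: "X \<in> \<AA>" and M: "finite M"
  shows "limit_part (X - M) = limit_part X"
proof -
  have "limit_part ((X - M) \<union> (X \<inter> M)) = limit_part (X - M) + limit_part (X \<inter> M)"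
    using X M finite_algebra by (intro limit_part_Un) auto
  moreover have "(X - M) \<union> (X \<inter> M) = X" by auto
  ultimately show ?thesis using limit_part_finite[of "X \<inter> M"] M by simp
qed

lemma infsum_atom_small:
  assumes "Y \<inter> M = {}" "\<bar>infsum (\<lambda>n. \<bar>atom n\<bar>) (UNIV - M)\<bar> < \<epsilon>"
  shows "\<bar>infsum atom Y\<bar> \<le> \<epsilon>"
proof -
  have "\<bar>infsum atom Y\<bar> \<le> infsum (\<lambda>n. \<bar>atom n\<bar>) Y"
    using norm_infsum_bound[of atom Y] atom_summable(1) by simp
  also have "\<dots> \<le> infsum (\<lambda>n. \<bar>atom n\<bar>) (UNIV - M)"
    using assms by (intro infsum_mono_neutral atom_summable) auto
  finally show ?thesis using assms by linarith
qed

lemma principal_mass: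
  assumes "X \<in> principal n" "\<epsilon> > 0"
  shows "\<exists>Y\<in>principal n. Y \<subseteq> X \<and> \<bar>charge Y - atom n\<bar> \<le> \<epsilon>"
  using assms by (intro bexI[of _ "{n}"]) (auto simp: principal_def finite_algebra)

text \<open>
  For \<open>Y\<close> almost equal to \<open>B\<close>, \<open>charge Y - limit_part B\<close> is the total mass of the isolated points in
  \<open>Y\<close>, which is small if \<open>Y\<close> avoids a large finite set.
\<close>

lemma limit_mass:
  assumes B: "B \<in> \<B>" and X: "X \<in> limit B" and \<epsilon>: "\<epsilon> > 0"
  shows "\<exists>Y\<in>limit B. Y \<subseteq> X \<and> \<bar>charge Y - limit_part B\<bar> \<le> \<epsilon>"
proof -
  obtain M where M: "finite M" "\<bar>infsum (\<lambda>n. \<bar>atom n\<bar>) (UNIV - M)\<bar> < \<epsilon>"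
    using infsum_remainder_small[OF atom_summable(1) \<epsilon>] by blast
  define R where "R = (B - X) \<union> M"
  have R: "finite R" using X M by (simp add: R_def limit_def)
  have Y: "B - R \<in> limit B"
    using B R finite_algebra member_algebra by (auto simp: limit_def Diff_Diff_Int)
  have "\<bar>infsum atom (B - R)\<bar> \<le> \<epsilon>" using M(2) by (intro infsum_atom_small[of _ M]) (auto simp: R_def)
  moreover have "charge (B - R) - limit_part B = infsum atom (B - R)"
    using limit_part_Diff_finite[OF member_algebra[OF B] R] by (simp add: limit_part_def)
  ultimately have "\<bar>charge (B - R) - limit_part B\<bar> \<le> \<epsilon>" by (simp only:)
  moreover have "B - R \<subseteq> X" by (auto simp: R_def)
  ultimately show ?thesis using Y by blast
qed

lemma limit_part_summable: "(\<lambda>B. \<bar>limit_part B\<bar>) summable_on F" "limit_part summable_on F" if "F \<subseteq> \<B>" for F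
proof -
  have "(\<Sum>B\<in>G. \<bar>limit_part B\<bar>) \<le> 1" if G: "finite G" "G \<subseteq> F" for G
  proof -
    have inj: "inj_on limit G" using inj_limit G \<open>F \<subseteq> \<B>\<close> by (meson inj_on_subset subset_trans)
    have "(\<Sum>U\<in>limit ` G. \<bar>limit_part (inv_into G limit U)\<bar>) \<le> 1"
    proof (rule finite_point_masses)
      fix U X and \<epsilon> :: real assume "U \<in> limit ` G" "X \<in> U" "\<epsilon> > 0"
      then obtain B where B: "B \<in> G" "U = limit B" by auto
      then have "inv_into G limit U = B" using inj by simp
      then show "\<exists>Y\<in>U. Y \<subseteq> X \<and> \<bar>charge Y - limit_part (inv_into G limit U)\<bar> \<le> \<epsilon>"
        using limit_mass[of B X \<epsilon>] B G \<open>F \<subseteq> \<B>\<close> \<open>X \<in> U\<close> \<open>\<epsilon> > 0\<close> by auto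
    qed (use G \<open>F \<subseteq> \<B>\<close> limit_in in auto)
    then show ?thesis using inj by (simp add: sum.reindex)
  qed
  then show "(\<lambda>B. \<bar>limit_part B\<bar>) summable_on F" by (rule abs_summable_if_bounded)
  then show "limit_part summable_on F" using abs_summable_summable[of limit_part F] by simp
qed

text \<open>
  The neighbourhood \<open>Y\<close> of \<open>infty\<close> is the complement of a finite set \<open>R\<close> and of the union of a finite
  subfamily \<open>F\<close>. Its charge differs from the claimed mass by the masses of the isolated points in \<open>Y\<close>
  and of the limit points not in \<open>F\<close>, and both are small if \<open>R\<close> and \<open>F\<close> are large.
\<close>

lemma infty_mass:
  assumes X: "X \<in> infty" and \<epsilon>: "\<epsilon> > 0"
  shows "\<exists>Y\<in>infty. Y \<subseteq> X \<and> \<bar>charge Y - (limit_part UNIV - infsum limit_part \<B>)\<bar> \<le> \<epsilon>"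
proof -
  obtain G where G: "G \<subseteq> \<B>" "finite G" "finite (- X - \<Union>G)"
    using X by (auto simp: infty_def almost_union_def)
  have \<epsilon>2: "\<epsilon> / 2 > 0" using \<epsilon> by simp
  obtain M where M: "finite M" "\<bar>infsum (\<lambda>n. \<bar>atom n\<bar>) (UNIV - M)\<bar> < \<epsilon> / 2"
    using infsum_remainder_small[OF atom_summable(1) \<epsilon>2] by blast
  obtain H where H: "H \<subseteq> \<B>" "finite H" "\<bar>infsum (\<lambda>B. \<bar>limit_part B\<bar>) (\<B> - H)\<bar> < \<epsilon> / 2"
    using infsum_remainder_small[OF limit_part_summable(1)[OF subset_refl] \<epsilon>2] by blast
  define F where "F = G \<union> H"
  have F: "F \<subseteq> \<B>" "finite F" using G H by (auto simp: F_def)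
  define R where "R = M \<union> (- X - \<Union>G) \<union> (\<Union>B\<in>F. \<Union>A\<in>F - {B}. B \<inter> A)"
  have R: "finite R"
    unfolding R_def using M G F by (intro finite_UnI finite_UN_I almost_disjointD[OF ad]) auto
  define Y where "Y = - (R \<union> \<Union>F)"
  have YX: "Y \<subseteq> X" by (auto simp: Y_def R_def F_def)
  have "almost_union \<B> (R \<union> \<Union>F)"
    unfolding almost_union_def using F R
    by (intro exI[of _ F]) (auto intro: finite_subset[OF _ R])
  then have Y: "Y \<in> infty" by (simp add: Y_def infty_def)
  have disj: "disjoint_family_on (\<lambda>B. B - R) F"
    unfolding disjoint_family_on_def R_def by blast
  have BR: "B - R \<in> \<AA>" "B \<in> \<AA>" if "B \<in> F" for B
    using that F R member_algebra finite_algebra by auto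
  have YA: "Y \<in> \<AA>" using Y infty_in by (auto simp: topspace_iff)
  have UA: "(\<Union>B\<in>F. B - R) \<in> \<AA>" using F BR by (intro finite_UN) auto
  have "limit_part UNIV = limit_part (UNIV - R)" using R limit_part_Diff_finite[of UNIV R] by simp
  also have "UNIV - R = Y \<union> (\<Union>B\<in>F. B - R)" by (auto simp: Y_def)
  also have "limit_part \<dots> = limit_part Y + limit_part (\<Union>B\<in>F. B - R)"
    using YA UA by (intro limit_part_Un) (auto simp: Y_def)
  also have "limit_part (\<Union>B\<in>F. B - R) = (\<Sum>B\<in>F. limit_part (B - R))" using F BR disj by (intro limit_part_UN) auto
  also have "\<dots> = (\<Sum>B\<in>F. limit_part B)" using BR R by (intro sum.cong limit_part_Diff_finite) auto
  finally have dU: "limit_part UNIV = limit_part Y + (\<Sum>B\<in>F. limit_part B)" .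
  have "infsum limit_part (\<B> - F) = infsum limit_part \<B> - (\<Sum>B\<in>F. limit_part B)"
    using infsum_Diff[OF limit_part_summable(2)[OF subset_refl] limit_part_summable(2)[OF F(1)] F(1)] F by simp
  then have "charge Y - (limit_part UNIV - infsum limit_part \<B>) = infsum atom Y + infsum limit_part (\<B> - F)"
    using dU by (simp add: limit_part_def)
  moreover have "\<bar>infsum atom Y\<bar> \<le> \<epsilon> / 2"
    using M by (intro infsum_atom_small[of _ M]) (auto simp: Y_def R_def)
  moreover have "\<bar>infsum limit_part (\<B> - F)\<bar> \<le> \<epsilon> / 2"
  proof -
    have "\<bar>infsum limit_part (\<B> - F)\<bar> \<le> infsum (\<lambda>B. \<bar>limit_part B\<bar>) (\<B> - F)"
      using norm_infsum_bound[of limit_part "\<B> - F"] limit_part_summable(1)[of "\<B> - F"] by simp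
    also have "\<dots> \<le> infsum (\<lambda>B. \<bar>limit_part B\<bar>) (\<B> - H)"
      by (intro infsum_mono_neutral limit_part_summable) (auto simp: F_def)
    finally show ?thesis using H by linarith
  qed
  ultimately have "\<bar>charge Y - (limit_part UNIV - infsum limit_part \<B>)\<bar> \<le> \<epsilon>" by linarith
  then show ?thesis using Y YX by blast
qed

definition weight :: "nat set set \<Rightarrow> real" where
  "weight U = (if U \<in> range principal then atom (inv principal U)
     else if U \<in> limit ` \<B> then limit_part (inv_into \<B> limit U) else limit_part UNIV - infsum limit_part \<B>)"

lemma weight_principal: "weight (principal n) = atom n"
  using inj_principal by (simp add: weight_def)

lemma weight_limit: "B \<in> \<B> \<Longrightarrow> weight (limit B) = limit_part B"
  using inj_limit principal_not_limit by (auto simp: weight_def)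

lemma weight_infty: "weight infty = limit_part UNIV - infsum limit_part \<B>"
  using infty_not_in by (simp add: weight_def)

lemma finite_weight_sum: "finite P \<Longrightarrow> P \<subseteq> topspace K \<Longrightarrow> (\<Sum>U\<in>P. \<bar>weight U\<bar>) \<le> 1"
proof (rule finite_point_masses)
  fix U X and \<epsilon> :: real assume "P \<subseteq> topspace K" "U \<in> P" "X \<in> U" "\<epsilon> > 0"
  then have "U \<in> topspace K" by auto
  then show "\<exists>Y\<in>U. Y \<subseteq> X \<and> \<bar>charge Y - weight U\<bar> \<le> \<epsilon>"
  proof (cases rule: ultra_cases)
    case (principal n)
    then show ?thesis using principal_mass \<open>X \<in> U\<close> \<open>\<epsilon> > 0\<close> by (simp add: weight_principal)
  next
    case (limit B)
    then show ?thesis using limit_mass \<open>X \<in> U\<close> \<open>\<epsilon> > 0\<close> by (simp add: weight_limit)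
  next
    case infty
    then show ?thesis using infty_mass \<open>X \<in> U\<close> \<open>\<epsilon> > 0\<close> by (simp add: weight_infty)
  qed
qed

sublocale W: atomic K weight
  by unfold_locales (intro abs_summable_if_bounded finite_weight_sum)

lemma variation_weight: "variation K W.\<nu> (topspace K) \<le> 1"
  unfolding W.variation_atomic[OF subset_refl]
  by (intro infsum_le_finite_sums W.summable finite_weight_sum) auto

lemma integral_char_fun: "X \<in> \<AA> \<Longrightarrow> signed_integral K W.\<nu> (char_fun X) = infsum weight (clopen X)"
  unfolding char_fun_def by (intro W.signed_integral_indicator) (auto simp: clopen_def)

lemma infsum_principals: "infsum weight (principal ` X) = infsum atom X"
  using infsum_reindex[OF inj_on_subset[OF inj_principal], of X weight]
  by (simp add: comp_def weight_principal)

lemma represents_member: "B \<in> \<B> \<Longrightarrow> signed_integral K W.\<nu> (char_fun B) = \<phi> (char_fun B)"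
proof -
  assume B: "B \<in> \<B>"
  have "infsum weight (principal ` B \<union> {limit B}) = infsum weight (principal ` B) + infsum weight {limit B}"
    using principal_not_limit[OF B] principal_in limit_in[OF B] by (intro infsum_Un_disjoint W.summable) auto
  then show ?thesis
    using B by (simp add: integral_char_fun member_algebra clopen_member infsum_principals weight_limit)
      (simp add: limit_part_def charge_def)
qed

lemma represents_UNIV: "signed_integral K W.\<nu> (char_fun UNIV) = \<phi> (char_fun UNIV)"
proof -
  have disj: "range principal \<inter> limit ` \<B> = {}" "(range principal \<union> limit ` \<B>) \<inter> {infty} = {}"
    using principal_not_limit infty_not_in by auto
  have "clopen UNIV = topspace K" using top by (auto simp: clopen_def topspace_iff)
  then have "signed_integral K W.\<nu> (char_fun UNIV) = infsum weight (range principal \<union> limit ` \<B> \<union> {infty})"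
    by (simp add: integral_char_fun topspace_eq)
  also have "\<dots> = infsum weight (range principal \<union> limit ` \<B>) + infsum weight {infty}"
    using disj by (intro infsum_Un_disjoint W.summable) (auto simp: topspace_eq)
  also have "infsum weight (range principal \<union> limit ` \<B>) = infsum weight (range principal) + infsum weight (limit ` \<B>)"
    using disj by (intro infsum_Un_disjoint W.summable) (auto simp: topspace_eq)
  also have "infsum weight (limit ` \<B>) = infsum limit_part \<B>"
    using infsum_reindex[OF inj_limit, of weight] by (auto simp: comp_def weight_limit cong: infsum_cong)
  finally show ?thesis
    by (simp add: infsum_principals weight_infty) (simp add: limit_part_def charge_def)
qed

text \<open>
  Both sides are bounded linear functionals that agree on a set with dense span. Constant sequences
  reduce this to the criterion for lifts modulo \<open>c\<^sub>0\<close>.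
\<close>

lemma represents:
  assumes g: "g \<in> C_space K"
  shows "signed_integral K W.\<nu> g = \<phi> g"
proof -
  have al: "almost_linear K (\<lambda>g (n::nat). \<phi> g) 1"
    by unfold_locales (auto simp: compact_K phi_add phi_scale phi_bound)
  have "(\<lambda>n::nat. signed_integral K W.\<nu> g - \<phi> g) \<longlonglongrightarrow> 0"
  proof (rule close_if_close_on_generators[OF al, where E = "\<lambda>g n. signed_integral K W.\<nu> g" and d = "variation K W.\<nu> (topspace K)"])
    show "(\<lambda>n::nat. signed_integral K W.\<nu> (char_fun {i}) - \<phi> (char_fun {i})) \<longlonglongrightarrow> 0" for i
      using integral_char_fun[of "{i}"] by (simp add: finite_algebra clopen_singleton weight_principal charge_def)
  qed (use signed_integral_add[OF compact_K W.radon_atomic] signed_integral_scaleR[OF compact_K W.radon_atomic]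
        signed_integral_bound[OF compact_K W.radon_atomic] represents_member represents_UNIV g
      in \<open>auto simp: mult.commute\<close>)
  then show ?thesis by (simp add: LIMSEQ_const_iff)
qed

end

section \<open>Extension operators and the main result\<close>

text \<open>
  Open sets of the pullback are preimages of open sets, so a cover of \<open>S\<close> comes from a cover of the
  image.
\<close>

lemma compact_space_pullback:
  assumes im: "compactin T (f ` S)"
  shows "compact_space (pullback_topology S f T)"
  unfolding compact_space_alt
proof (intro allI impI)
  fix \<U> assume \<U>: "(\<forall>U\<in>\<U>. openin (pullback_topology S f T) U) \<and> topspace (pullback_topology S f T) \<subseteq> \<Union>\<U>"
  have S: "topspace (pullback_topology S f T) = S"
    using compactin_subset_topspace[OF im] by (auto simp: topspace_pullback_topology)
  have "\<forall>U\<in>\<U>. \<exists>V. openin T V \<and> U = f -` V \<inter> S" using \<U> by (simp add: openin_pullback_topology)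
  then obtain V where V: "\<And>U. U \<in> \<U> \<Longrightarrow> openin T (V U)" "\<And>U. U \<in> \<U> \<Longrightarrow> U = f -` V U \<inter> S" by metis
  have "f ` S \<subseteq> \<Union>(V ` \<U>)"
  proof
    fix y assume "y \<in> f ` S"
    then obtain x where x: "x \<in> S" "y = f x" by auto
    then obtain U where "U \<in> \<U>" "x \<in> U" using \<U> S by blast
    then show "y \<in> \<Union>(V ` \<U>)" using V(2)[of U] x by blast
  qed
  then obtain \<F> where F: "finite \<F>" "\<F> \<subseteq> V ` \<U>" "f ` S \<subseteq> \<Union>\<F>"
    using im V(1) unfolding compactin_def by (metis (no_types, lifting) imageE)
  then obtain \<G> where G: "finite \<G>" "\<G> \<subseteq> \<U>" "\<F> = V ` \<G>" by (meson finite_subset_image)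
  have "S \<subseteq> \<Union>\<G>"
  proof
    fix x assume x: "x \<in> S"
    then obtain U where "U \<in> \<G>" "f x \<in> V U" using F(3) G(3) by blast
    then show "x \<in> \<Union>\<G>" using V(2)[of U] G(2) x by blast
  qed
  then show "\<exists>\<F>. finite \<F> \<and> \<F> \<subseteq> \<U> \<and> topspace (pullback_topology S f T) \<subseteq> \<Union>\<F>"
    using G S by auto
qed

text \<open>
  The unit ball of the dual of \<open>C(K)\<close>, with functionals restricted to \<open>C(K)\<close> to make them points of a
  product space.
\<close>

definition dual_ball :: "'a topology \<Rightarrow> (('a \<Rightarrow> real) \<Rightarrow> real) set" where
  "dual_ball K = {\<phi> \<in> (\<Pi>\<^sub>E g\<in>C_space K. {- sup_norm (topspace K) g..sup_norm (topspace K) g}).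
     (\<forall>g\<in>C_space K. \<forall>h\<in>C_space K. \<phi> (g + h) = \<phi> g + \<phi> h) \<and>
     (\<forall>a. \<forall>g\<in>C_space K. \<phi> (a *\<^sub>R g) = a * \<phi> g)}"

text \<open>
  The Banach--Alaoglu theorem: linearity consists of closed conditions on a product of compact
  intervals.
\<close>

lemma compactin_dual_ball:
  "compactin (product_topology (\<lambda>_. euclideanreal) (C_space K)) (dual_ball K)"
proof -
  let ?C = "C_space K"
  let ?T = "product_topology (\<lambda>_. euclideanreal) ?C"
  let ?Box = "\<Pi>\<^sub>E g\<in>?C. {- sup_norm (topspace K) g..sup_norm (topspace K) g}"
  have box: "compactin ?T ?Box" by (simp add: compactin_PiE)
  define A where "A = (\<lambda>(g, h). {\<phi> \<in> topspace ?T. \<phi> (g + h) - \<phi> g - \<phi> h \<in> {0}})"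
  define S where "S = (\<lambda>(a, g). {\<phi> \<in> topspace ?T. \<phi> (a *\<^sub>R g) - a * \<phi> g \<in> {0}})"
  have proj: "continuous_map ?T euclideanreal (\<lambda>\<phi>. \<phi> g)" if "g \<in> ?C" for g
    using that by (rule continuous_map_product_projection)
  have A: "closedin ?T (A p)" if "p \<in> ?C \<times> ?C" for p
  proof -
    have "fst p \<in> ?C" "snd p \<in> ?C" "fst p + snd p \<in> ?C"
      using that subspace_add[OF subspace_C_space] by auto
    then show ?thesis unfolding A_def case_prod_unfold
      by (intro closedin_continuous_map_preimage[where Y = euclideanreal] continuous_map_diff proj) auto
  qed
  have S: "closedin ?T (S p)" if "p \<in> UNIV \<times> ?C" for p
  proof -
    have "snd p \<in> ?C" "fst p *\<^sub>R snd p \<in> ?C"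
      using that subspace_scale[OF subspace_C_space] by auto
    then show ?thesis unfolding S_def case_prod_unfold
      by (intro closedin_continuous_map_preimage[where Y = euclideanreal] continuous_map_diff
          continuous_map_real_mult_left proj) auto
  qed
  have zero: "0 \<in> ?C" by (rule subspace_0[OF subspace_C_space])
  have "closedin ?T (\<Inter>(A ` (?C \<times> ?C)))" "closedin ?T (\<Inter>(S ` (UNIV \<times> ?C)))"
    using A S zero by (auto intro!: closedin_Inter)
  then have "compactin ?T ((\<Inter>(A ` (?C \<times> ?C)) \<inter> \<Inter>(S ` (UNIV \<times> ?C))) \<inter> ?Box)"
    by (intro closed_Int_compactin closedin_Int box)
  also have "(\<Inter>(A ` (?C \<times> ?C)) \<inter> \<Inter>(S ` (UNIV \<times> ?C))) \<inter> ?Box = dual_ball K"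
  proof (intro set_eqI iffI)
    fix \<phi> assume "\<phi> \<in> (\<Inter>(A ` (?C \<times> ?C)) \<inter> \<Inter>(S ` (UNIV \<times> ?C))) \<inter> ?Box"
    then have 1: "\<phi> \<in> ?Box" and 2: "\<forall>p\<in>?C \<times> ?C. \<phi> \<in> A p" and 3: "\<forall>p\<in>UNIV \<times> ?C. \<phi> \<in> S p" by auto
    have "\<phi> (g + h) = \<phi> g + \<phi> h" if "g \<in> ?C" "h \<in> ?C" for g h
      using bspec[OF 2, of "(g, h)"] that by (simp add: A_def)
    moreover have "\<phi> (a *\<^sub>R g) = a * \<phi> g" if "g \<in> ?C" for a g
      using bspec[OF 3, of "(a, g)"] that by (simp add: S_def)
    ultimately show "\<phi> \<in> dual_ball K" using 1 by (simp add: dual_ball_def)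
  next
    fix \<phi> assume "\<phi> \<in> dual_ball K"
    then show "\<phi> \<in> (\<Inter>(A ` (?C \<times> ?C)) \<inter> \<Inter>(S ` (UNIV \<times> ?C))) \<inter> ?Box"
      unfolding dual_ball_def A_def S_def by (auto simp: PiE_def extensional_def)
  qed
  finally show ?thesis .
qed

context almost_disjoint_stone
begin

lemma dual_ball_representable:
  "(\<lambda>\<nu>. \<lambda>g\<in>C_space K. signed_integral K \<nu> g) ` {\<nu> \<in> radon_measures K. variation K \<nu> (topspace K) \<le> 1} = dual_ball K"
proof (intro set_eqI iffI)
  fix \<phi> assume "\<phi> \<in> (\<lambda>\<nu>. \<lambda>g\<in>C_space K. signed_integral K \<nu> g) ` {\<nu> \<in> radon_measures K. variation K \<nu> (topspace K) \<le> 1}"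
  then obtain \<nu> where \<nu>: "\<nu> \<in> radon_measures K" "variation K \<nu> (topspace K) \<le> 1"
    and \<phi>: "\<phi> = (\<lambda>g\<in>C_space K. signed_integral K \<nu> g)" by auto
  have "\<bar>signed_integral K \<nu> g\<bar> \<le> sup_norm (topspace K) g" if g: "g \<in> C_space K" for g
    using signed_integral_bound[OF compact_K \<nu>(1) g]
      mult_left_le[OF \<nu>(2) sup_norm_nonneg[OF C_space_bdd[OF compact_K g]]] by linarith
  then show "\<phi> \<in> dual_ball K"
    unfolding dual_ball_def \<phi>
    using subspace_add[OF subspace_C_space[of K]] subspace_scale[OF subspace_C_space[of K]]
      signed_integral_add[OF compact_K \<nu>(1)] signed_integral_scaleR[OF compact_K \<nu>(1)]
    by (auto simp: abs_le_iff minus_le_iff)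
next
  fix \<phi> assume \<phi>: "\<phi> \<in> dual_ball K"
  interpret stone_functional \<B> K \<phi>
  proof
    fix g assume "g \<in> C_space K"
    then have "\<phi> g \<in> {- sup_norm (topspace K) g..sup_norm (topspace K) g}"
      using \<phi> by (auto simp: dual_ball_def)
    then show "\<bar>\<phi> g\<bar> \<le> sup_norm (topspace K) g" by auto
  qed (use \<phi> in \<open>auto simp: dual_ball_def\<close>)
  have "\<phi> = (\<lambda>g\<in>C_space K. signed_integral K W.\<nu> g)"
    using \<phi> represents by (auto simp: dual_ball_def PiE_def extensional_def fun_eq_iff)
  then show "\<phi> \<in> (\<lambda>\<nu>. \<lambda>g\<in>C_space K. signed_integral K \<nu> g) ` {\<nu> \<in> radon_measures K. variation K \<nu> (topspace K) \<le> 1}"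
    using W.radon_atomic variation_weight by blast
qed

lemma compact_M1: "compact_space (M1_space K)"
  unfolding M1_space_def by (intro compact_space_pullback) (simp add: dual_ball_representable compactin_dual_ball)

end

lemma topspace_M1:
  "topspace (M1_space K) = {\<nu> \<in> radon_measures K. variation K \<nu> (topspace K) \<le> 1}"
  by (auto simp: M1_space_def topspace_pullback_topology)

lemma continuous_map_M1_eval:
  assumes g: "g \<in> C_space K"
  shows "continuous_map (M1_space K) euclideanreal (\<lambda>\<nu>. signed_integral K \<nu> g)"
proof -
  have "continuous_map (M1_space K) euclideanreal ((\<lambda>\<phi>. \<phi> g) \<circ> (\<lambda>\<nu>. \<lambda>g\<in>C_space K. signed_integral K \<nu> g))"
    unfolding M1_space_def by (intro continuous_map_pullback continuous_map_product_projection g)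
  then show ?thesis using g by (simp add: comp_def)
qed

text \<open>
  Away from \<open>0\<close> the preimages of open sets are sets of isolated points, and a neighbourhood of \<open>0\<close>
  misses only finitely many points.
\<close>

lemma continuous_map_to_real_if_null_on_discrete:
  fixes u :: "'l \<Rightarrow> real"
  assumes H: "Hausdorff_space L" and D: "D \<subseteq> topspace L" "\<And>S. S \<subseteq> D \<Longrightarrow> openin L S"
    and zero: "\<And>x. x \<in> topspace L - D \<Longrightarrow> u x = 0"
    and null: "\<And>\<epsilon>. \<epsilon> > 0 \<Longrightarrow> finite {x \<in> D. \<bar>u x\<bar> \<ge> \<epsilon>}"
  shows "continuous_map L euclideanreal u"
  unfolding continuous_map_def
proof (intro conjI allI impI)
  fix T :: "real set" assume T: "openin euclideanreal T"
  show "openin L {x \<in> topspace L. u x \<in> T}"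
  proof (cases "0 \<in> T")
    case False
    then have "{x \<in> topspace L. u x \<in> T} \<subseteq> D" using zero by force
    then show ?thesis by (rule D(2))
  next
    case True
    then obtain \<epsilon> where \<epsilon>: "\<epsilon> > 0" "ball 0 \<epsilon> \<subseteq> T" using T by (auto simp: open_contains_ball)
    have "{x \<in> topspace L. u x \<notin> T} \<subseteq> {x \<in> D. \<bar>u x\<bar> \<ge> \<epsilon>}"
      using zero True \<epsilon>(2) by (force simp: subset_iff)
    then have "finite {x \<in> topspace L. u x \<notin> T}" using null[OF \<epsilon>(1)] finite_subset by blast
    then have "closedin L {x \<in> topspace L. u x \<notin> T}"
      using H by (intro closedin_Hausdorff_finite) auto
    then have "openin L (topspace L - {x \<in> topspace L. u x \<notin> T})" by (simp add: closedin_def)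
    also have "topspace L - {x \<in> topspace L. u x \<notin> T} = {x \<in> topspace L. u x \<in> T}" by auto
    finally show ?thesis .
  qed
qed auto

text \<open>
  As \<open>M\<^sub>1(K)\<close> is compact, every \<open>g\<close>, regarded as a continuous function on it, extends to \<open>L'\<close>. Two
  extensions of the same function differ on the added points by a null sequence, so the values of
  the extensions on the added points depend linearly on \<open>g\<close> modulo \<open>c\<^sub>0\<close>. A linear lift of this
  operator replaces the extensions there by values that are linear in \<open>g\<close>, and it changes them only
  by null sequences, which preserves continuity.
\<close>

theorem star_extension_property_if_lifting:
  fixes K :: "'a topology"
  assumes K: "compact_space K" "Hausdorff_space K" and borel: "discrete_borel K"
    and M1: "compact_space (M1_space K)" and lift: "c0_lifting_property K"
  shows "star_extension_property TYPE('l) K"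
  unfolding star_extension_property_def
proof (intro conjI allI impI K)
  fix L' :: "'l topology" and e
  assume ext: "countable_discrete_extension (M1_space K) L' e"
  let ?C = "C_space K" and ?N = "sup_norm (topspace K)" and ?M = "topspace (M1_space K)"
  interpret discrete_borel K by (rule borel)
  define L where "L = e ` ?M"
  define D where "D = topspace L' - L"
  have L': "compact_space L'" "Hausdorff_space L'" and emb: "embedding_map (M1_space K) L' e"
    and cD: "countable D" and disc: "subtopology L' D = discrete_topology D"
    using ext by (auto simp: countable_discrete_extension_def D_def L_def)
  have hom: "homeomorphic_map (M1_space K) (subtopology L' L) e"
    using emb by (simp add: embedding_map_def L_def)
  have "continuous_map (M1_space K) L' e"
    using hom homeomorphic_imp_continuous_map continuous_map_in_subtopology by blast
  then have compL: "compactin L' L"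
    using M1 image_compactin unfolding L_def compact_space_def by blast
  then have clL: "closedin L' L" using L'(2) compactin_imp_closedin by blast
  have LL': "L \<subseteq> topspace L'" using clL closedin_subset by blast
  have opD: "openin L' D" using clL by (simp add: closedin_def D_def)
  have openD: "openin L' S" if "S \<subseteq> D" for S
  proof -
    have "openin (subtopology L' D) S" using that by (simp add: disc)
    then show ?thesis using opD openin_trans_full by blast
  qed
  obtain e' where e': "homeomorphic_maps (M1_space K) (subtopology L' L) e e'"
    using hom homeomorphic_map_maps by blast
  have e'e: "e' (e \<nu>) = \<nu>" if "\<nu> \<in> ?M" for \<nu>
    using e' that by (auto simp: homeomorphic_maps_def)
  have radon: "\<nu> \<in> radon_measures K" "variation K \<nu> (topspace K) \<le> 1" if "\<nu> \<in> ?M" for \<nu>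
    using that by (auto simp: topspace_M1)
  have e'L: "e' y \<in> ?M" if "y \<in> L" for y using that e'e by (auto simp: L_def)
  define ev where "ev g y = signed_integral K (e' y) g" for g y
  have ev_bound: "\<bar>ev g y\<bar> \<le> ?N g" if g: "g \<in> ?C" and y: "y \<in> L" for g y
    using signed_integral_bound[OF K(1) radon(1)[OF e'L[OF y]] g]
      mult_left_le[OF radon(2)[OF e'L[OF y]] sup_norm_nonneg[OF C_space_bdd[OF K(1) g]]]
    unfolding ev_def by linarith
  have ev_add: "ev (g + h) y = ev g y + ev h y" if "g \<in> ?C" "h \<in> ?C" "y \<in> L" for g h y
    using signed_integral_add[OF K(1) radon(1)[OF e'L]] that by (simp add: ev_def)
  have ev_scale: "ev (a *\<^sub>R g) y = a * ev g y" if "g \<in> ?C" "y \<in> L" for a g y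
    using signed_integral_scaleR[OF K(1) radon(1)[OF e'L]] that by (simp add: ev_def)

  \<comment> \<open>Continuous extensions \<open>x g\<close>, with the same bounds and in general not linear in \<open>g\<close>.\<close>
  have "\<exists>f. continuous_map L' euclideanreal f \<and> (\<forall>y\<in>L. f y = ev g y) \<and> (\<forall>y\<in>topspace L'. \<bar>f y\<bar> \<le> ?N g)"
    if g: "g \<in> ?C" for g
  proof -
    have "continuous_map (subtopology L' L) (M1_space K) e'"
      using e' by (simp add: homeomorphic_maps_def)
    then have cont: "continuous_map (subtopology L' L) euclideanreal (ev g)"
      using continuous_map_compose[OF _ continuous_map_M1_eval[OF g]] unfolding ev_def[abs_def] comp_def by blast
    have norm: "normal_space L'" using L' compact_Hausdorff_or_regular_imp_normal_space by blast
    have img: "ev g ` L \<subseteq> {- ?N g..?N g}" using ev_bound[OF g] by (auto simp: abs_le_iff minus_le_iff)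
    have "- ?N g \<le> ?N g" using sup_norm_nonneg[OF C_space_bdd[OF K(1) g]] by linarith
    from Tietze_extension_closed_real_interval[OF norm clL cont img this]
    obtain f where "continuous_map L' euclideanreal f" "\<And>y. y \<in> L \<Longrightarrow> f y = ev g y"
      "f ` topspace L' \<subseteq> {- ?N g..?N g}" by blast
    then show ?thesis by (intro exI[of _ f]) (auto simp: abs_le_iff image_subset_iff minus_le_iff)
  qed
  then obtain x where x_cont: "\<And>g. g \<in> ?C \<Longrightarrow> continuous_map L' euclideanreal (x g)"
    and x_L: "\<And>g y. g \<in> ?C \<Longrightarrow> y \<in> L \<Longrightarrow> x g y = ev g y"
    and x_bound: "\<And>g y. g \<in> ?C \<Longrightarrow> y \<in> topspace L' \<Longrightarrow> \<bar>x g y\<bar> \<le> ?N g"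
    by metis

  \<comment> \<open>Functions on the added points as sequences, padded with \<open>0\<close>. A continuous function that vanishes
    on \<open>L\<close> gives a null sequence, since it is at least \<open>\<epsilon>\<close> only on a compact set of isolated points.\<close>
  define ix where "ix = to_nat_on D"
  have ix: "inj_on ix D" unfolding ix_def using cD by (rule inj_on_to_nat_on)
  define sq where "sq f n = (if n \<in> ix ` D then f (inv_into D ix n) else 0)" for f :: "'l \<Rightarrow> real" and n
  have sq_ix: "sq f (ix y) = f y" if "y \<in> D" for f y using that ix by (simp add: sq_def)
  have null: "sq f \<longlonglongrightarrow> 0" if f: "continuous_map L' euclideanreal f" "\<And>y. y \<in> L \<Longrightarrow> f y = 0" for f
  proof (rule LIMSEQ_I)
    fix \<epsilon> :: real assume \<epsilon>: "\<epsilon> > 0"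
    define S where "S = {y \<in> topspace L'. f y \<in> {t. \<epsilon> \<le> \<bar>t\<bar>}}"
    have "closed {t::real. \<epsilon> \<le> \<bar>t\<bar>}" by (intro closed_Collect_le continuous_intros)
    then have "closedin L' S" unfolding S_def using f(1) by (intro closedin_continuous_map_preimage) auto
    then have "compactin L' S" by (rule closedin_compact_space[OF L'(1)])
    moreover have SD: "S \<subseteq> D" using f(2) \<epsilon> by (auto simp: S_def D_def)
    ultimately have "compactin (subtopology L' D) S" by (simp add: compactin_subtopology)
    then have "finite S" by (simp add: disc compactin_discrete_topology)
    then obtain N where N: "\<And>n. n \<in> ix ` S \<Longrightarrow> n < N"
      using finite_nat_set_iff_bounded[of "ix ` S"] by auto
    have "norm (sq f n - 0) < \<epsilon>" if "n \<ge> N" for n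
    proof (cases "n \<in> ix ` D")
      case True
      then obtain y where y: "y \<in> D" "n = ix y" by auto
      then have "y \<notin> S" using N that by force
      then show ?thesis using y sq_ix[of y f] by (auto simp: S_def D_def)
    qed (simp add: sq_def \<epsilon>)
    then show "\<exists>N. \<forall>n\<ge>N. norm (sq f n - 0) < \<epsilon>" by blast
  qed
  define \<tau> where "\<tau> g = sq (x g)" for g
  have "almost_linear K \<tau> 1"
  proof
    fix g n assume g: "g \<in> ?C"
    have "inv_into D ix n \<in> topspace L'" if "n \<in> ix ` D"
      using inv_into_into[OF that] by (auto simp: D_def)
    then show "\<bar>\<tau> g n\<bar> \<le> 1 * ?N g"
      using x_bound[OF g] sup_norm_nonneg[OF C_space_bdd[OF K(1) g]] by (auto simp: \<tau>_def sq_def)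
  next
    fix g h assume gh: "g \<in> ?C" "h \<in> ?C"
    then have "g + h \<in> ?C" by (intro subspace_add subspace_C_space)
    then have "sq (\<lambda>y. x (g + h) y - (x g y + x h y)) \<longlonglongrightarrow> 0"
      using gh x_cont x_L ev_add by (intro null continuous_map_diff continuous_map_add) auto
    moreover have "sq (\<lambda>y. x (g + h) y - (x g y + x h y)) = (\<lambda>n. \<tau> (g + h) n - (\<tau> g n + \<tau> h n))"
      by (simp add: \<tau>_def sq_def fun_eq_iff)
    ultimately show "(\<lambda>n. \<tau> (g + h) n - (\<tau> g n + \<tau> h n)) \<longlonglongrightarrow> 0" by (simp only:)
  next
    fix g a assume g: "g \<in> ?C"
    then have "a *\<^sub>R g \<in> ?C" by (intro subspace_scale subspace_C_space)
    then have "sq (\<lambda>y. x (a *\<^sub>R g) y - a * x g y) \<longlonglongrightarrow> 0"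
      using g x_cont x_L ev_scale by (intro null continuous_map_diff continuous_map_real_mult_left) auto
    moreover have "sq (\<lambda>y. x (a *\<^sub>R g) y - a * x g y) = (\<lambda>n. \<tau> (a *\<^sub>R g) n - a * \<tau> g n)"
      by (simp add: \<tau>_def sq_def fun_eq_iff)
    ultimately show "(\<lambda>n. \<tau> (a *\<^sub>R g) n - a * \<tau> g n) \<longlonglongrightarrow> 0" by (simp only:)
  qed (use K in auto)
  from lift[unfolded c0_lifting_property_def, THEN spec, THEN spec, THEN mp, OF this]
  obtain F d where F: "\<forall>g\<in>?C. \<forall>h\<in>?C. \<forall>n. F (g + h) n = F g n + F h n"
    "\<forall>a. \<forall>g\<in>?C. \<forall>n. F (a *\<^sub>R g) n = a * F g n"
    "\<forall>g\<in>?C. \<forall>n. \<bar>F g n\<bar> \<le> d * ?N g" "\<forall>g\<in>?C. (\<lambda>n. F g n - \<tau> g n) \<longlonglongrightarrow> 0"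
    by (elim exE conjE) (rule that)

  define E where "E g = (\<lambda>y. if y \<in> L then ev g y else if y \<in> D then F g (ix y) else 0)" for g
  have E_C: "E g \<in> C_space L'" if g: "g \<in> ?C" for g
  proof -
    \<comment> \<open>Continuity is checked on the difference to the continuous function \<open>x g\<close>.\<close>
    define u where "u y = E g y - x g y" for y
    have "continuous_map L' euclideanreal u"
    proof (rule continuous_map_to_real_if_null_on_discrete[OF L'(2) _ openD])
      show "D \<subseteq> topspace L'" by (auto simp: D_def)
      show "u y = 0" if "y \<in> topspace L' - D" for y
        using that x_L[OF g] by (auto simp: u_def E_def D_def)
      fix \<epsilon> :: real assume "\<epsilon> > 0"
      then obtain N where N: "\<And>n. n \<ge> N \<Longrightarrow> \<bar>F g n - \<tau> g n\<bar> < \<epsilon>"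
        using LIMSEQ_D[OF F(4)[rule_format, OF g]] by auto
      have "{y \<in> D. \<epsilon> \<le> \<bar>u y\<bar>} \<subseteq> {y \<in> D. ix y < N}"
      proof
        fix y assume y: "y \<in> {y \<in> D. \<epsilon> \<le> \<bar>u y\<bar>}"
        then have "u y = F g (ix y) - \<tau> g (ix y)"
          using sq_ix[of y "x g"] by (auto simp: u_def E_def \<tau>_def D_def)
        then show "y \<in> {y \<in> D. ix y < N}" using y N[of "ix y"] by force
      qed
      moreover have "finite {y \<in> D. ix y < N}"
        using ix by (intro inj_on_finite[of ix _ "{..<N}"]) (auto intro: inj_on_subset)
      ultimately show "finite {y \<in> D. \<epsilon> \<le> \<bar>u y\<bar>}" by (rule finite_subset)
    qed
    then have "continuous_map L' euclideanreal (\<lambda>y. u y + x g y)"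
      using x_cont[OF g] by (rule continuous_map_add)
    then have "continuous_map L' euclideanreal (E g)" by (simp add: u_def)
    moreover have "E g y = 0" if "y \<notin> topspace L'" for y using that LL' by (auto simp: E_def D_def)
    ultimately show ?thesis by (simp add: C_space_def)
  qed
  have "bounded_operator ?C ?N (C_space L') (sup_norm (topspace L')) E"
    unfolding bounded_operator_def
  proof (intro conjI ballI allI)
    show "E (g + h) = E g + E h" if "g \<in> ?C" "h \<in> ?C" for g h
      using that ev_add F(1) by (auto simp: E_def fun_eq_iff)
    show "E (a *\<^sub>R g) = a *\<^sub>R E g" if g: "g \<in> ?C" for a g
    proof
      fix y
      have "E (a *\<^sub>R g) y = a * E g y"
        using ev_scale[OF g, of y a] F(2)[rule_format, OF g, of a "ix y"] by (auto simp: E_def)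
      then show "E (a *\<^sub>R g) y = (a *\<^sub>R E g) y" by (simp add: scaleR_fun_def)
    qed
    have "sup_norm (topspace L') (E g) \<le> max 1 d * ?N g" if g: "g \<in> ?C" for g
    proof (rule sup_norm_least)
      have N: "0 \<le> ?N g" using sup_norm_nonneg[OF C_space_bdd[OF K(1) g]] .
      then show "0 \<le> max 1 d * ?N g" by simp
      fix y
      have "1 * ?N g \<le> max 1 d * ?N g" "d * ?N g \<le> max 1 d * ?N g"
        using N by (intro mult_right_mono; simp)+
      then show "\<bar>E g y\<bar> \<le> max 1 d * ?N g"
        using ev_bound[OF g, of y] F(3)[rule_format, OF g, of "ix y"] N by (auto simp: E_def)
    qed
    then show "\<exists>B. \<forall>g\<in>?C. sup_norm (topspace L') (E g) \<le> B * ?N g" by blast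
  qed (rule E_C)
  moreover have "E g (e \<nu>) = signed_integral K \<nu> g" if "\<nu> \<in> ?M" for g \<nu>
    using that e'e[OF that] by (simp add: E_def ev_def L_def)
  ultimately show "\<exists>E. bounded_operator ?C ?N (C_space L') (sup_norm (topspace L')) E \<and>
      (\<forall>g\<in>?C. \<forall>\<nu>\<in>?M. E g (e \<nu>) = signed_integral K \<nu> g)"
    by blast
qed

theorem corollary5p3:
  fixes \<kappa> :: "'k rel" and \<A> :: "nat set set" and K :: "nat set set topology"
  assumes "Card_order \<kappa>"
    and "\<kappa> <o |UNIV :: nat set set|"
    and "martin_axiom TYPE(nat set) \<kappa>"
    and "almost_disjoint \<A>"
    and "|\<A>| =o \<kappa>"
    and "K = stone_space UNIV (generated_algebra UNIV (\<A> \<union> {F. finite F}))"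
  shows "star_extension_property TYPE('l) K \<and>
    (\<forall>(i :: (nat \<Rightarrow> real) \<Rightarrow> 'x::banach) q.
       twisted_sum c0_space (sup_norm UNIV) (C_space K) (sup_norm (topspace K)) i q \<longrightarrow>
       trivial_twisted_sum c0_space (sup_norm UNIV) i)"
proof -
  obtain \<B> where \<B>: "\<B> \<subseteq> \<A>" "\<And>B. B \<in> \<B> \<Longrightarrow> infinite B"
    "\<And>F. F \<subseteq> \<B> \<Longrightarrow> finite F \<Longrightarrow> infinite (- \<Union>F)"
    and alg: "generated_algebra UNIV (\<A> \<union> {F. finite F}) = almost_algebra \<B>"
    using exists_non_covering_generators[OF assms(4)] by auto
  have "almost_disjoint \<B>"
    using assms(4) \<B>(1) unfolding almost_disjoint_def by blast
  then interpret almost_disjoint_stone \<B> K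
    by unfold_locales (simp_all add: \<B> assms(6) alg)
  have "|\<A>| =o |Field \<kappa>|"
    using assms(1,5) card_of_Field_ordIso ordIso_symmetric ordIso_transitive by blast
  then obtain b where "bij_betw b (Field \<kappa>) \<A>"
    using card_of_ordIso ordIso_symmetric by blast
  then have "\<B> \<subseteq> b ` Field \<kappa>" using \<B>(1) by (simp add: bij_betw_def)
  then have lift: "c0_lifting_property K"
    unfolding c0_lifting_property_def using lifting_modulo_c0[OF assms(3)] by blast
  show ?thesis
    using star_extension_property_if_lifting[OF compact_K Hausdorff_K discrete_borel_axioms compact_M1 lift]
      trivial_twisted_sum_if_lifting[OF compact_K lift] by blast
qed

end
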